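(* Let $N\ge1$ and let $\varphi_1,\dots,\varphi_N\in\mathcal G$ be distinct linear symbols with zero characteristic. Let $\lambda_1,\dots,\lambda_N$ be non-zero complex numbers. Then $\sum_{j=1}^N\lambda_jC_{\varphi_j}$ is compact on $\mathcal H$ if and only if each $C_{\varphi_j}$, $j=1,\dots,N$, is compact on $\mathcal H$.
   Context: For $\theta\in\mathbb R$, $\mathbb C_\theta=\{s\in\mathbb C:\ \mathrm{Re}\, s>\theta\}$. $\mathcal H$ is the Hilbert space of Dirichlet series $f(s)=\sum_{n\ge1}a_nn^{-s}$ with $\|f\|^2=\sum_n|a_n|^2<\infty$; its elements are analytic on $\mathbb C_{1/2}$. The Gordon-Hedenmalm class $\mathcal G$ is the set of maps $\varphi:\mathbb C_{1/2}\to\mathbb C_{1/2}$ of the form $\varphi(s)=c_0s+\psi(s)$, where $c_0$ is a non-negative integer (the characteristic of $\varphi$) and $\psi(s)=\sum_{n\ge1}c_nn^{-s}$ converges uniformly in $\mathbb C_\varepsilon$ for every $\varepsilon>0$ and satisfies: (a) if $c_0=0$, then $\psi(\mathbb C_0)\subseteq\mathbb C_{1/2}$; (b) if $c_0\ge1$, then either $\psi\equiv c_1$ with $\mathrm{Re}\,c_1\ge0$ or $\psi(\mathbb C_0)\subseteq\mathbb C_0$. These are exactly the analytic self-maps $\varphi$ of $\mathbb C_{1/2}$ for which $C_\varphi f=f\circ\varphi$ defines a bounded operator on $\mathcal H$. A linear symbol is a $\varphi\in\mathcal G$ of the form $\varphi(s)=c_0s+c_1+\sum_{k=1}^dc_{q_k}q_k^{-s}$,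 where $q_1,\dots,q_d$ are finitely many multiplicatively independent positive integers (i.e. $q_1^{a_1}\cdots q_d^{a_d}=1$ with $a_i\in\mathbb Z$ forces all $a_i=0$), $q_k\ne1$ and $c_{q_k}\ne0$ for each $k=1,\dots,d$. It has zero characteristic when $c_0=0$. *)

theory Defs
  imports "HOL-Analysis.Analysis"
begin

definition half_plane :: "real \<Rightarrow> complex set" where
  "half_plane \<theta> = {s. \<theta> < Re s}"

text \<open>Dirichlet series are indexed from 1: the term \<open>n^(-s)\<close> with \<open>n = Suc k\<close>; the value
  \<open>c 0\<close> is never used.\<close>

definition dirichlet_series :: "(nat \<Rightarrow> complex) \<Rightarrow> complex \<Rightarrow> complex" where
  "dirichlet_series c s = (\<Sum>k. c (Suc k) * of_nat (Suc k) powr (- s))"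

definition dirichlet_partial_sum :: "(nat \<Rightarrow> complex) \<Rightarrow> nat \<Rightarrow> complex \<Rightarrow> complex" where
  "dirichlet_partial_sum c m s = (\<Sum>n=1..m. c n * of_nat n powr (- s))"


section \<open>The Hilbert space of Dirichlet series with square summable coefficients\<close>

text \<open>An element is given by its coefficient sequence, normalised by \<open>a 0 = 0\<close>; the function on
  \<open>half_plane (1/2)\<close> it represents is \<open>dirichlet_series (coeff f)\<close>.\<close>

typedef dirichlet_H = "{a :: nat \<Rightarrow> complex. a 0 = 0 \<and> summable (\<lambda>n. (cmod (a n))\<^sup>2)}"
  morphisms coeff Abs_dirichlet_H
  by (rule exI[of _ "\<lambda>_. 0"]) simp

setup_lifting type_definition_dirichlet_H

lemma square_summable_add:
  fixes a b :: "nat \<Rightarrow> complex"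
  assumes "summable (\<lambda>n. (cmod (a n))\<^sup>2)" "summable (\<lambda>n. (cmod (b n))\<^sup>2)"
  shows "summable (\<lambda>n. (cmod (a n + b n))\<^sup>2)"
proof (rule summable_comparison_test')
  show "summable (\<lambda>n. 2 * (cmod (a n))\<^sup>2 + 2 * (cmod (b n))\<^sup>2)"
    using assms by (intro summable_add summable_mult)
  fix n
  have "(cmod (a n + b n))\<^sup>2 \<le> (cmod (a n) + cmod (b n))\<^sup>2"
    by (intro power_mono norm_triangle_ineq) simp
  also have "\<dots> \<le> 2 * (cmod (a n))\<^sup>2 + 2 * (cmod (b n))\<^sup>2"
    using sum_squares_bound[of "cmod (a n)" "cmod (b n)"] by (simp add: power2_sum)
  finally show "norm ((cmod (a n + b n))\<^sup>2) \<le> 2 * (cmod (a n))\<^sup>2 + 2 * (cmod (b n))\<^sup>2"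
    by simp
qed

lemma square_summable_mult:
  fixes a :: "nat \<Rightarrow> complex"
  assumes "summable (\<lambda>n. (cmod (a n))\<^sup>2)"
  shows "summable (\<lambda>n. (cmod (c * a n))\<^sup>2)"
  using summable_mult[OF assms, of "(cmod c)\<^sup>2"] by (simp add: norm_mult power_mult_distrib)

lemma summable_inner:
  fixes a b :: "nat \<Rightarrow> complex"
  assumes "summable (\<lambda>n. (cmod (a n))\<^sup>2)" "summable (\<lambda>n. (cmod (b n))\<^sup>2)"
  shows "summable (\<lambda>n. a n \<bullet> b n)"
proof (rule summable_comparison_test')
  show "summable (\<lambda>n. (cmod (a n))\<^sup>2 + (cmod (b n))\<^sup>2)"
    using assms by (rule summable_add)
  fix n
  have "\<bar>a n \<bullet> b n\<bar> \<le> cmod (a n) * cmod (b n)"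
    by (rule Cauchy_Schwarz_ineq2)
  also have "\<dots> \<le> 2 * cmod (a n) * cmod (b n)"
    by simp
  also have "\<dots> \<le> (cmod (a n))\<^sup>2 + (cmod (b n))\<^sup>2"
    by (rule sum_squares_bound)
  finally show "norm (a n \<bullet> b n) \<le> (cmod (a n))\<^sup>2 + (cmod (b n))\<^sup>2"
    by simp
qed

lemma coeff_summable: "summable (\<lambda>n. (cmod (coeff f n))\<^sup>2)"
  using coeff[of f] by simp

text \<open>The type classes only know real scalars; \<open>scaleC\<close> is the complex scalar multiplication,
  and the class inner product is the real part of the Hermitian one, which has the same norm.\<close>

lift_definition scaleC :: "complex \<Rightarrow> dirichlet_H \<Rightarrow> dirichlet_H"
  is "\<lambda>c a n. c * a n"
  by (simp add: square_summable_mult)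

instantiation dirichlet_H :: real_inner
begin

lift_definition zero_dirichlet_H :: dirichlet_H is "\<lambda>_. 0"
  by simp

lift_definition plus_dirichlet_H :: "dirichlet_H \<Rightarrow> dirichlet_H \<Rightarrow> dirichlet_H"
  is "\<lambda>a b n. a n + b n"
  by (simp add: square_summable_add)

lift_definition uminus_dirichlet_H :: "dirichlet_H \<Rightarrow> dirichlet_H"
  is "\<lambda>a n. - a n"
  by simp

definition minus_dirichlet_H :: "dirichlet_H \<Rightarrow> dirichlet_H \<Rightarrow> dirichlet_H" where
  "minus_dirichlet_H f g = f + - g"

definition scaleR_dirichlet_H :: "real \<Rightarrow> dirichlet_H \<Rightarrow> dirichlet_H" where
  "scaleR_dirichlet_H r f = scaleC (of_real r) f"

definition inner_dirichlet_H :: "dirichlet_H \<Rightarrow> dirichlet_H \<Rightarrow> real" where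
  "inner_dirichlet_H f g = (\<Sum>n. coeff f n \<bullet> coeff g n)"

definition norm_dirichlet_H :: "dirichlet_H \<Rightarrow> real" where
  "norm_dirichlet_H f = sqrt (\<Sum>n. (cmod (coeff f n))\<^sup>2)"

definition sgn_dirichlet_H :: "dirichlet_H \<Rightarrow> dirichlet_H" where
  "sgn_dirichlet_H f = scaleR (inverse (norm f)) f"

definition dist_dirichlet_H :: "dirichlet_H \<Rightarrow> dirichlet_H \<Rightarrow> real" where
  "dist_dirichlet_H f g = norm (f - g)"

definition uniformity_dirichlet_H :: "(dirichlet_H \<times> dirichlet_H) filter" where
  "uniformity_dirichlet_H = (INF e\<in>{0<..}. principal {(f, g). dist f g < e})"

definition open_dirichlet_H :: "dirichlet_H set \<Rightarrow> bool" where
  "open_dirichlet_H U \<longleftrightarrow> (\<forall>f\<in>U. \<forall>\<^sub>F (f', g) in uniformity. f' = f \<longrightarrow> g \<in> U)"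

instance
proof
  fix f g h :: dirichlet_H and r t :: real
  show "f + g + h = f + (g + h)" "f + g = g + f" "0 + f = f" "- f + f = 0"
    by (transfer, simp add: algebra_simps)+
  show "f - g = f + - g"
    by (rule minus_dirichlet_H_def)
  show "r *\<^sub>R (f + g) = r *\<^sub>R f + r *\<^sub>R g" "(r + t) *\<^sub>R f = r *\<^sub>R f + t *\<^sub>R f"
    "r *\<^sub>R t *\<^sub>R f = (r * t) *\<^sub>R f" "1 *\<^sub>R f = f"
    unfolding scaleR_dirichlet_H_def by (transfer, simp add: algebra_simps)+
  show "dist f g = norm (f - g)"
    by (rule dist_dirichlet_H_def)
  show "sgn f = scaleR (inverse (norm f)) f"
    by (rule sgn_dirichlet_H_def)
  show "uniformity = (INF e\<in>{0<..}. principal {(f::dirichlet_H, g). dist f g < e})"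
    by (rule uniformity_dirichlet_H_def)
  show "open U \<longleftrightarrow> (\<forall>f\<in>U. \<forall>\<^sub>F (f', g) in uniformity. f' = f \<longrightarrow> g \<in> U)"
    for U :: "dirichlet_H set"
    by (rule open_dirichlet_H_def)
  have summ: "summable (\<lambda>n. coeff f n \<bullet> coeff g n)" for f g
    by (intro summable_inner coeff_summable)
  show "f \<bullet> g = g \<bullet> f"
    by (simp add: inner_dirichlet_H_def inner_commute)
  show "(f + g) \<bullet> h = f \<bullet> h + g \<bullet> h"
    by (simp add: inner_dirichlet_H_def plus_dirichlet_H.rep_eq inner_add_left suminf_add summ)
  have "coeff (r *\<^sub>R f) n = r *\<^sub>R coeff f n" for n
    by (simp add: scaleR_dirichlet_H_def scaleC.rep_eq scaleR_conv_of_real)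
  then show "(r *\<^sub>R f) \<bullet> g = r * (f \<bullet> g)"
    by (simp add: inner_dirichlet_H_def suminf_mult summ)
  have inner_self: "f \<bullet> f = (\<Sum>n. (cmod (coeff f n))\<^sup>2)"
    by (simp add: inner_dirichlet_H_def power2_norm_eq_inner)
  show "0 \<le> f \<bullet> f"
    unfolding inner_self by (intro suminf_nonneg coeff_summable) simp
  show "norm f = sqrt (f \<bullet> f)"
    by (simp add: norm_dirichlet_H_def inner_self)
  have "f \<bullet> f = 0 \<longleftrightarrow> (\<forall>n. coeff f n = 0)"
    unfolding inner_self by (subst suminf_eq_zero_iff[OF coeff_summable]) auto
  then show "f \<bullet> f = 0 \<longleftrightarrow> f = 0"
    by (simp add: coeff_inject[symmetric] zero_dirichlet_H.rep_eq fun_eq_iff)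
qed

end


section \<open>Composition operators\<close>

text \<open>\<open>C\<^sub>\<phi> f\<close> is the element of the space which, as a function on \<open>half_plane (1/2)\<close>, is
  \<open>f \<circ> \<phi>\<close>. It exists and is unique for every \<open>\<phi>\<close> in the Gordon-Hedenmalm class below; for other
  \<open>\<phi>\<close> the value of the description may be arbitrary.\<close>

definition composition_operator :: "(complex \<Rightarrow> complex) \<Rightarrow> dirichlet_H \<Rightarrow> dirichlet_H" where
  "composition_operator \<phi> f =
     (THE g. \<forall>s\<in>half_plane (1/2).
        dirichlet_series (coeff g) s = dirichlet_series (coeff f) (\<phi> s))"

definition compact_operator :: "(dirichlet_H \<Rightarrow> dirichlet_H) \<Rightarrow> bool" where
  "compact_operator T \<longleftrightarrow>
     Vector_Spaces.linear scaleC scaleC T \<and> compact (closure (T ` cball 0 1))"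


section \<open>The Gordon-Hedenmalm class\<close>

text \<open>Symbols are total functions on the complex numbers of which only the restriction to
  \<open>half_plane (1/2)\<close> is meaningful.\<close>

definition gordon_hedenmalm :: "(complex \<Rightarrow> complex) set" where
  "gordon_hedenmalm = {\<phi>.
     \<phi> ` half_plane (1/2) \<subseteq> half_plane (1/2) \<and>
     (\<exists>(c0::nat) (c::nat \<Rightarrow> complex).
        (\<forall>s\<in>half_plane (1/2). \<phi> s = of_nat c0 * s + dirichlet_series c s) \<and>
        (\<forall>\<epsilon>>0. uniformly_convergent_on (half_plane \<epsilon>) (dirichlet_partial_sum c)) \<and>
        (c0 = 0 \<longrightarrow> dirichlet_series c ` half_plane 0 \<subseteq> half_plane (1/2)) \<and>
        (c0 \<ge> 1 \<longrightarrow>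
           ((\<forall>s\<in>half_plane 0. dirichlet_series c s = c 1) \<and> 0 \<le> Re (c 1)) \<or>
           dirichlet_series c ` half_plane 0 \<subseteq> half_plane 0))}"

definition multiplicatively_independent :: "nat \<Rightarrow> (nat \<Rightarrow> nat) \<Rightarrow> bool" where
  "multiplicatively_independent d q \<longleftrightarrow>
     (\<forall>k\<in>{1..d}. 0 < q k) \<and>
     (\<forall>a::nat \<Rightarrow> int. (\<Prod>k=1..d. real (q k) powi a k) = 1 \<longrightarrow> (\<forall>k\<in>{1..d}. a k = 0))"

definition linear_symbol :: "nat \<Rightarrow> (complex \<Rightarrow> complex) \<Rightarrow> bool" where
  "linear_symbol c0 \<phi> \<longleftrightarrow>
     \<phi> \<in> gordon_hedenmalm \<and>
     (\<exists>(c::nat \<Rightarrow> complex) (d::nat) (q::nat \<Rightarrow> nat).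
        multiplicatively_independent d q \<and>
        (\<forall>k\<in>{1..d}. q k \<noteq> 1 \<and> c (q k) \<noteq> 0) \<and>
        (\<forall>s\<in>half_plane (1/2).
           \<phi> s = of_nat c0 * s + c 1 + (\<Sum>k=1..d. c (q k) * of_nat (q k) powr (- s))))"

end

theory Submission
  imports Defs "HOL-Complex_Analysis.Complex_Analysis"
begin

text \<open>
  Write a linear symbol of zero characteristic as \<open>\<phi>(s) = c\<^sub>1 + \<Sum>k\<le>d. C\<^sub>k q\<^sub>k^(-s)\<close>. Since the
  \<open>q\<^sub>k\<close> are multiplicatively independent, the phases of the \<open>q\<^sub>k^(-s)\<close> can be prescribed
  independently on vertical lines (Kronecker), so the condition \<open>\<phi> ` half_plane 0 \<subseteq> half_plane (1/2)\<close> says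
  \<open>Re c\<^sub>1 \<ge> 1/2 + \<Sum>k. |C\<^sub>k|\<close>, with strict inequality for \<open>d = 0\<close>. This is \<open>linear_symbol_data\<close>.

  Expanding \<open>n^(-\<phi>(s))\<close> into exponential series gives the matrix of \<open>C\<^sub>\<phi>\<close>: its row at
  \<open>\<Prod>k. q\<^sub>k^\<alpha>\<^sub>k\<close> has the entries \<open>n^(-c\<^sub>1) \<Prod>k. (-C\<^sub>k log n)^\<alpha>\<^sub>k / \<alpha>\<^sub>k!\<close>. Up to the factor
  \<open>n^(-1/2)\<close> and a possible surplus in \<open>Re c\<^sub>1\<close>, the moduli are products of Poisson
  probabilities \<open>poisson (|C\<^sub>k| log n) \<alpha>\<^sub>k\<close>. The Schur test with weights \<open>n^(-1/2)\<close> on columns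
  and \<open>1\<close> on rows then bounds \<open>C\<^sub>\<phi>\<close>, because \<open>\<Sum>n. n^(-1) poisson (C log n) a\<close> is bounded
  uniformly in \<open>a\<close> (\<open>harmonic_poisson_sum\<close>). Moreover \<open>poisson z a\<close> is small uniformly in \<open>z\<close>
  when \<open>a\<close> is large (\<open>poisson_le\<close>). So if \<open>d \<ge> 2\<close>, one factor pays for summability and another
  one makes the row weight tend to \<open>0\<close>; if \<open>Re c\<^sub>1 > 1/2 + \<Sum>k. |C\<^sub>k|\<close>, the surplus pays for
  summability. In both cases \<open>C\<^sub>\<phi>\<close> is compact (\<open>compact_composition_operator\<close>).

  Hence a noncompact \<open>C\<^sub>\<phi>\<close> comes from a symbol
  \<open>\<phi>(s) = 1/2 + |K| + i\<tau> + K p^(-s)\<close> with a single frequency, which touches the line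
  \<open>Re = 1/2\<close> exactly at \<open>1/2 + i\<tau>\<close>. If a combination of all the given operators is compact, so is
  its part over these touching symbols, and it remains to see that the coefficients of that
  part vanish (\<open>touching_combination\<close>). Fix one index \<open>k\<close> and a point \<open>i t\<^sub>0\<close> with
  \<open>\<phi>\<^sub>k(i t\<^sub>0) = 1/2 + i\<tau>\<^sub>k\<close>. Apply the combination to normalised reproducing kernels and
  evaluate the result at points tending to \<open>i t\<^sub>0\<close> tangentially, with real part of the order of
  the square of the imaginary displacement. The evaluation is a combination of values
  \<open>\<zeta>(1 + u\<^sub>j)\<close>, and by the simple pole of \<open>\<zeta>\<close> the limit is a sum of \<open>\<mu>\<^sub>j / (b\<^sub>j + \<eta>)\<close> over
  those \<open>j\<close> that touch the same boundary point at \<open>i t\<^sub>0\<close> with the same first derivative. Here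
  \<open>\<eta> > 0\<close> is free and \<open>b\<^sub>j\<close> records the second derivative, that is \<open>log p\<^sub>j\<close>. Boundary point,
  first and second derivative determine the symbol, so the \<open>b\<^sub>j\<close> are distinct. Compactness
  makes the limit \<open>0\<close> for every \<open>\<eta>\<close>, and independence of the partial fractions gives \<open>\<mu>\<^sub>k = 0\<close>.
\<close>

no_notation Infinite_Set_Sum.abs_summable_on (infix \<open>abs'_summable'_on\<close> 50)

section \<open>The Schur test\<close>

lemma infsum_Cauchy_Schwarz:
  fixes f g :: "'a \<Rightarrow> real"
  assumes "(\<lambda>x. (f x)\<^sup>2) summable_on A" "(\<lambda>x. (g x)\<^sup>2) summable_on A"
    and pos: "\<And>x. x \<in> A \<Longrightarrow> 0 \<le> f x" "\<And>x. x \<in> A \<Longrightarrow> 0 \<le> g x"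
  shows "(\<lambda>x. f x * g x) summable_on A"
    and "(\<Sum>\<^sub>\<infinity>x\<in>A. f x * g x)\<^sup>2 \<le> (\<Sum>\<^sub>\<infinity>x\<in>A. (f x)\<^sup>2) * (\<Sum>\<^sub>\<infinity>x\<in>A. (g x)\<^sup>2)"
proof -
  let ?F = "\<Sum>\<^sub>\<infinity>x\<in>A. (f x)\<^sup>2" and ?G = "\<Sum>\<^sub>\<infinity>x\<in>A. (g x)\<^sup>2"
  have fin: "(\<Sum>x\<in>X. f x * g x) \<le> sqrt (?F * ?G)" if "finite X" "X \<subseteq> A" for X
  proof -
    have "(\<Sum>x\<in>X. f x * g x) = (\<Sum>x\<in>X. \<bar>f x\<bar> * \<bar>g x\<bar>)"
      using pos that by (intro sum.cong) auto
    also have "\<dots> \<le> L2_set f X * L2_set g X"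
      by (rule L2_set_mult_ineq)
    also have "\<dots> = sqrt ((\<Sum>x\<in>X. (f x)\<^sup>2) * (\<Sum>x\<in>X. (g x)\<^sup>2))"
      by (simp add: L2_set_def real_sqrt_mult)
    also have "\<dots> \<le> sqrt (?F * ?G)"
      using that assms(1,2)
      by (intro real_sqrt_le_mono mult_mono finite_sum_le_infsum sum_nonneg infsum_nonneg) auto
    finally show ?thesis .
  qed
  show summ: "(\<lambda>x. f x * g x) summable_on A"
    by (rule nonneg_bdd_above_summable_on) (use pos fin in \<open>auto intro!: bdd_aboveI2[where M="sqrt (?F * ?G)"]\<close>)
  have "(\<Sum>\<^sub>\<infinity>x\<in>A. f x * g x) \<le> sqrt (?F * ?G)"
    by (rule infsum_le_finite_sums[OF summ fin])
  then have "(\<Sum>\<^sub>\<infinity>x\<in>A. f x * g x)\<^sup>2 \<le> (sqrt (?F * ?G))\<^sup>2"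
    using pos by (intro power_mono infsum_nonneg) auto
  also have "\<dots> = ?F * ?G"
    by (intro real_sqrt_pow2 mult_nonneg_nonneg infsum_nonneg) auto
  finally show "(\<Sum>\<^sub>\<infinity>x\<in>A. f x * g x)\<^sup>2 \<le> ?F * ?G" .
qed

text \<open>The two sums are the row and column sums of a Schur test with the weights \<open>n^(-1/2)\<close> and \<open>1\<close>.
  The row bounds \<open>A\<close> are kept individually, because their decay is what yields compactness.
  Row and column \<open>0\<close> vanish since Dirichlet series start at \<open>n = 1\<close>.\<close>

definition schur_matrix :: "(nat \<Rightarrow> nat \<Rightarrow> complex) \<Rightarrow> (nat \<Rightarrow> real) \<Rightarrow> bool" where
  "schur_matrix E A \<longleftrightarrow>
     (\<forall>m n. m = 0 \<or> n = 0 \<longrightarrow> E m n = 0) \<and> (\<exists>B. \<forall>m. A m \<le> B) \<and>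
     (\<forall>m. (\<lambda>n. cmod (E m n) * real n powr (-1/2)) summable_on UNIV \<and>
          (\<Sum>\<^sub>\<infinity>n. cmod (E m n) * real n powr (-1/2)) \<le> A m) \<and>
     (\<forall>n. (\<lambda>m. cmod (E m n)) summable_on UNIV \<and>
          (\<Sum>\<^sub>\<infinity>m. cmod (E m n)) \<le> real n powr (-1/2))"

lemma schur_matrix_nonneg:
  assumes "schur_matrix E A"
  shows "0 \<le> A m"
proof -
  have "0 \<le> (\<Sum>\<^sub>\<infinity>n. cmod (E m n) * real n powr (-1/2))"
    by (intro infsum_nonneg) auto
  also have "\<dots> \<le> A m"
    using assms by (auto simp: schur_matrix_def)
  finally show ?thesis .
qed

text \<open>Cauchy-Schwarz on row \<open>m\<close>, after splitting \<open>|E m n| |a n|\<close> as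
  \<open>(|E m n| n^(-1/2))^(1/2) (|E m n| n^(1/2) |a n|\<^sup>2)^(1/2)\<close>. The second factors give \<open>w\<close>, and summing
  \<open>w\<close> over the rows first meets the column sums, which cancel the weight. The bound is stated row
  by row so that a tail of rows with small \<open>A\<close> contributes a small norm.\<close>

lemma schur_test:
  fixes a :: "nat \<Rightarrow> complex"
  assumes E: "schur_matrix E A"
    and a: "(\<lambda>n. (cmod (a n))\<^sup>2) summable_on UNIV"
  obtains w where "\<And>m. (\<lambda>n. cmod (E m n) * cmod (a n)) summable_on UNIV"
    "\<And>m. (\<Sum>\<^sub>\<infinity>n. cmod (E m n) * cmod (a n))\<^sup>2 \<le> A m * w m"
    "\<And>m. 0 \<le> w m" "w summable_on UNIV" "infsum w UNIV \<le> (\<Sum>\<^sub>\<infinity>n. (cmod (a n))\<^sup>2)"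
proof -
  define K where "K m n = cmod (E m n) * (real n powr (1/2) * (cmod (a n))\<^sup>2)" for m n
  define w where "w m = (\<Sum>\<^sub>\<infinity>n. K m n)" for m
  have K0: "K m n \<ge> 0" for m n
    by (simp add: K_def)
  have E0: "E m 0 = 0" for m
    using E by (auto simp: schur_matrix_def)
  have row: "(\<lambda>n. cmod (E m n) * real n powr (-1/2)) summable_on UNIV"
     "(\<Sum>\<^sub>\<infinity>n. cmod (E m n) * real n powr (-1/2)) \<le> A m" for m
    using E by (auto simp: schur_matrix_def)
  have col: "(\<lambda>m. cmod (E m n)) summable_on UNIV" "(\<Sum>\<^sub>\<infinity>m. cmod (E m n)) \<le> real n powr (-1/2)" for n
    using E by (auto simp: schur_matrix_def)
  have Kcol: "(\<lambda>m. K m n) summable_on UNIV" "(\<Sum>\<^sub>\<infinity>m. K m n) \<le> (cmod (a n))\<^sup>2" for n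
  proof -
    show "(\<lambda>m. K m n) summable_on UNIV"
      unfolding K_def by (rule summable_on_cmult_left[OF col(1)])
    have "(\<Sum>\<^sub>\<infinity>m. K m n) = (\<Sum>\<^sub>\<infinity>m. cmod (E m n)) * (real n powr (1/2) * (cmod (a n))\<^sup>2)"
      unfolding K_def by (rule infsum_cmult_left) (use col in auto)
    also have "\<dots> \<le> real n powr (-1/2) * (real n powr (1/2) * (cmod (a n))\<^sup>2)"
      by (intro mult_right_mono col) auto
    also have "\<dots> \<le> (cmod (a n))\<^sup>2"
      by (cases "n = 0") (auto simp: powr_minus field_simps)
    finally show "(\<Sum>\<^sub>\<infinity>m. K m n) \<le> (cmod (a n))\<^sup>2" .
  qed
  have S: "(\<lambda>(n,m). K m n) summable_on (UNIV \<times> UNIV)"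
  proof (rule summable_on_SigmaI)
    show "((\<lambda>m. case (n,m) of (n,m) \<Rightarrow> K m n) has_sum (\<Sum>\<^sub>\<infinity>m. K m n)) UNIV" for n
      using Kcol(1)[of n] by simp
    show "(\<lambda>n. \<Sum>\<^sub>\<infinity>m. K m n) summable_on UNIV"
      by (rule summable_on_comparison_test[OF a]) (use Kcol K0 in \<open>auto intro: infsum_nonneg\<close>)
  qed (use K0 in auto)
  have S': "(\<lambda>(m,n). K m n) summable_on (UNIV \<times> UNIV)"
    using S by (subst summable_on_swap) auto
  have Krow: "(\<lambda>n. K m n) summable_on UNIV" for m
    using summable_on_SigmaD1[OF S', of m] K0 by auto
  have CS: "(\<lambda>n. cmod (E m n) * cmod (a n)) summable_on UNIV \<and>
        (\<Sum>\<^sub>\<infinity>n. cmod (E m n) * cmod (a n))\<^sup>2 \<le> A m * w m" for m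
  proof -
    define f where "f n = sqrt (cmod (E m n) * real n powr (-1/2))" for n
    define g where "g n = sqrt (K m n)" for n
    have f2: "(f n)\<^sup>2 = cmod (E m n) * real n powr (-1/2)" for n
      by (simp add: f_def)
    have g2: "(g n)\<^sup>2 = K m n" for n
      using K0 by (simp add: g_def)
    have fg: "f n * g n = cmod (E m n) * cmod (a n)" for n
    proof (cases "n = 0")
      case False
      have "f n * g n = sqrt ((cmod (E m n) * cmod (a n))\<^sup>2 * (real n powr (-1/2) * real n powr (1/2)))"
        unfolding f_def g_def K_def by (simp add: real_sqrt_mult[symmetric] power2_eq_square algebra_simps)
      also have "real n powr (-1/2) * real n powr (1/2) = 1"
        using False by (simp add: powr_add[symmetric])
      finally show ?thesis by simp
    qed (simp add: f_def E0)
    have "(\<lambda>n. f n * g n) summable_on UNIV"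
      "(\<Sum>\<^sub>\<infinity>n. f n * g n)\<^sup>2 \<le> (\<Sum>\<^sub>\<infinity>n. (f n)\<^sup>2) * (\<Sum>\<^sub>\<infinity>n. (g n)\<^sup>2)"
      by (rule infsum_Cauchy_Schwarz; use row Krow in \<open>auto simp: f2 g2\<close>; auto simp: f_def g_def K0)+
    moreover have "(\<Sum>\<^sub>\<infinity>n. (f n)\<^sup>2) * (\<Sum>\<^sub>\<infinity>n. (g n)\<^sup>2) \<le> A m * w m"
      unfolding f2 g2 w_def by (intro mult_right_mono row infsum_nonneg K0)
    ultimately show ?thesis
      by (simp add: fg)
  qed
  have w: "w summable_on UNIV"
    unfolding w_def using summable_on_Sigma_banach[of K UNIV "\<lambda>_. UNIV"] S' by simp
  have "infsum w UNIV = (\<Sum>\<^sub>\<infinity>n. \<Sum>\<^sub>\<infinity>m. K m n)"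
    unfolding w_def using infsum_swap_banach[of K UNIV UNIV] S' by simp
  also have "\<dots> \<le> (\<Sum>\<^sub>\<infinity>n. (cmod (a n))\<^sup>2)"
    by (rule infsum_mono[OF _ a]) (use summable_on_Sigma_banach[of "\<lambda>n m. K m n" UNIV "\<lambda>_. UNIV"] S Kcol in auto)
  finally show ?thesis
    by (intro that[of w]) (use CS w in \<open>auto simp: w_def intro: infsum_nonneg K0\<close>)
qed

section \<open>Dirichlet series with square summable coefficients\<close>

lemma infsum_eq_suminf_nonneg:
  fixes f :: "nat \<Rightarrow> real"
  assumes "\<And>n. 0 \<le> f n" "summable f"
  shows "f summable_on UNIV" "infsum f UNIV = suminf f"
  using assms by (auto simp: summable_on_UNIV_nonneg_real_iff intro: infsumI sums_nonneg_imp_has_sum summable_sums)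

lemma coeff_summable_on: "(\<lambda>n. (cmod (coeff f n))\<^sup>2) summable_on UNIV"
  by (rule infsum_eq_suminf_nonneg) (auto simp: coeff_summable)

lemma norm_dirichlet_H_infsum: "(norm f)\<^sup>2 = (\<Sum>\<^sub>\<infinity>n. (cmod (coeff f n))\<^sup>2)"
  unfolding norm_dirichlet_H_def
  by (subst infsum_eq_suminf_nonneg(2)) (auto simp: coeff_summable intro!: real_sqrt_pow2 suminf_nonneg)

lemma coeff_0 [simp]: "coeff f 0 = 0"
  using coeff[of f] by simp

lemma coeff_Abs:
  assumes "a 0 = 0" "(\<lambda>n. (cmod (a n))\<^sup>2) summable_on UNIV"
  shows "coeff (Abs_dirichlet_H a) = a"
  using assms by (intro Abs_dirichlet_H_inverse) (auto simp: summable_on_UNIV_nonneg_real_iff)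

lemma cmod_coeff_le: "cmod (coeff f n) \<le> norm f"
proof -
  have "(\<Sum>k\<in>{n}. (cmod (coeff f k))\<^sup>2) \<le> (\<Sum>\<^sub>\<infinity>n. (cmod (coeff f n))\<^sup>2)"
    by (rule finite_sum_le_infsum) (auto simp: coeff_summable_on)
  then have "(cmod (coeff f n))\<^sup>2 \<le> (norm f)\<^sup>2"
    by (simp add: norm_dirichlet_H_infsum)
  then show ?thesis
    by (rule power2_le_imp_le) simp
qed

lemma coeff_minus: "coeff (f - g) n = coeff f n - coeff g n"
  unfolding minus_dirichlet_H_def by (simp only: plus_dirichlet_H.rep_eq uminus_dirichlet_H.rep_eq) simp

lemma coeff_sum: "coeff (\<Sum>j\<in>J. F j) n = (\<Sum>j\<in>J. coeff (F j) n)"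
  by (induction J rule: infinite_finite_induct)
     (auto simp: zero_dirichlet_H.rep_eq plus_dirichlet_H.rep_eq)

text \<open>Besides estimates, this serves to evaluate an element at points outside \<open>half_plane (1/2)\<close>, as
  long as only few coefficients enter.\<close>

lemma coeff_pairing:
  assumes h: "(\<lambda>n. (cmod (h n))\<^sup>2) summable_on UNIV"
  shows "(\<lambda>n. h n * coeff f n) abs_summable_on UNIV"
    and "cmod (\<Sum>\<^sub>\<infinity>n. h n * coeff f n) \<le> norm f * sqrt (\<Sum>\<^sub>\<infinity>n. (cmod (h n))\<^sup>2)"
proof -
  note CS = infsum_Cauchy_Schwarz[OF h coeff_summable_on[of f]]
  show 1: "(\<lambda>n. h n * coeff f n) abs_summable_on UNIV"
    using CS(1) by (simp add: norm_mult)
  have "cmod (\<Sum>\<^sub>\<infinity>n. h n * coeff f n) \<le> (\<Sum>\<^sub>\<infinity>n. cmod (h n) * cmod (coeff f n))"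
    using norm_infsum_bound[OF 1] by (simp add: norm_mult)
  also have "\<dots> \<le> sqrt ((\<Sum>\<^sub>\<infinity>n. (cmod (h n))\<^sup>2) * (norm f)\<^sup>2)"
    unfolding norm_dirichlet_H_infsum using CS(2) by (intro real_le_rsqrt) auto
  finally show "cmod (\<Sum>\<^sub>\<infinity>n. h n * coeff f n) \<le> norm f * sqrt (\<Sum>\<^sub>\<infinity>n. (cmod (h n))\<^sup>2)"
    by (simp add: real_sqrt_mult mult.commute)
qed

lemma powr_square_summable:
  assumes "1/2 < Re s"
  shows "(\<lambda>n. (cmod (of_nat n powr (-s)))\<^sup>2) summable_on (UNIV::nat set)"
proof -
  have "(cmod (of_nat n powr (-s)))\<^sup>2 = real n powr (- 2 * Re s)" for n :: nat
    by (cases "n = 0") (auto simp: norm_powr_real_powr powr_add[symmetric] power2_eq_square)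
  then show ?thesis
    using assms by (simp add: summable_on_UNIV_nonneg_real_iff summable_real_powr_iff)
qed

lemma dirichlet_series_coeff:
  assumes "1/2 < Re s"
  shows "(\<lambda>n. of_nat n powr (-s) * coeff f n) abs_summable_on UNIV"
    and "dirichlet_series (coeff f) s = (\<Sum>\<^sub>\<infinity>n. of_nat n powr (-s) * coeff f n)"
proof -
  show *: "(\<lambda>n. of_nat n powr (-s) * coeff f n) abs_summable_on UNIV"
    by (rule coeff_pairing[OF powr_square_summable[OF assms]])
  have "(\<lambda>n. of_nat n powr (-s) * coeff f n) sums (\<Sum>\<^sub>\<infinity>n. of_nat n powr (-s) * coeff f n)"
    by (intro has_sum_imp_sums has_sum_infsum abs_summable_summable[OF *])
  then have "(\<lambda>n. of_nat (Suc n) powr (-s) * coeff f (Suc n)) sums (\<Sum>\<^sub>\<infinity>n. of_nat n powr (-s) * coeff f n)"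
    by (subst sums_Suc_iff) simp
  then show "dirichlet_series (coeff f) s = (\<Sum>\<^sub>\<infinity>n. of_nat n powr (-s) * coeff f n)"
    unfolding dirichlet_series_def by (simp add: sums_iff mult.commute)
qed

lemma dirichlet_series_minus:
  assumes "1/2 < Re s"
  shows "dirichlet_series (coeff (f - g)) s = dirichlet_series (coeff f) s - dirichlet_series (coeff g) s"
proof -
  have "(\<lambda>n. of_nat n powr (-s) * coeff f n + - (of_nat n powr (-s) * coeff g n)) = (\<lambda>n. of_nat n powr (-s) * coeff (f - g) n)"
    by (simp add: coeff_minus algebra_simps fun_eq_iff)
  moreover have "(\<Sum>\<^sub>\<infinity>n. of_nat n powr (-s) * coeff f n + - (of_nat n powr (-s) * coeff g n))
      = (\<Sum>\<^sub>\<infinity>n. of_nat n powr (-s) * coeff f n) + (\<Sum>\<^sub>\<infinity>n. - (of_nat n powr (-s) * coeff g n))"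
    using dirichlet_series_coeff(1)[OF assms, THEN abs_summable_summable]
    by (intro infsum_add) (simp_all add: summable_on_uminus)
  ultimately show ?thesis
    by (simp add: dirichlet_series_coeff(2)[OF assms] infsum_uminus)
qed

text \<open>If \<open>a\<^sub>n n^(-s)\<close> is the first nonzero term, all later ones together are \<open>O((n+1)^(-\<sigma>))\<close> as
  \<open>\<sigma> = Re s\<close> grows, and cannot cancel it.\<close>

lemma dirichlet_series_eq_0_imp:
  assumes "\<And>s. s \<in> half_plane (1/2) \<Longrightarrow> dirichlet_series (coeff h) s = 0"
  shows "h = 0"
proof (rule ccontr)
  assume "h \<noteq> 0"
  then have ex: "\<exists>n. coeff h n \<noteq> 0"
    by (auto simp: coeff_inject[symmetric] zero_dirichlet_H.rep_eq fun_eq_iff)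
  define n where "n = (LEAST n. coeff h n \<noteq> 0)"
  have n: "coeff h n \<noteq> 0" and less: "\<And>k. k < n \<Longrightarrow> coeff h k = 0"
    unfolding n_def using LeastI_ex[OF ex] not_less_Least by blast+
  have n0: "n > 0"
    using n by (cases n) auto
  \<comment> \<open>The exponent is split as \<open>\<sigma> = (\<sigma> - 2) + 2\<close> for the tail: one part gives the geometric
    gain, the other one summability.\<close>
  define B where "B = norm h * (\<Sum>\<^sub>\<infinity>k::nat. real k powr (-2)) * real (n+1) powr 2"
  have S2: "(\<lambda>k. real k powr (-2)) summable_on (UNIV :: nat set)"
    by (simp add: summable_on_UNIV_nonneg_real_iff summable_real_powr_iff)
  have le: "cmod (coeff h n) \<le> B * (real n / real (n+1)) powr \<sigma>" if \<sigma>: "\<sigma> \<ge> 2" for \<sigma>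
  proof -
    define t where "t k = of_nat k powr (- of_real \<sigma>) * coeff h k" for k :: nat
    have t_sum: "t abs_summable_on UNIV"
      unfolding t_def using \<sigma> by (intro dirichlet_series_coeff) auto
    have t_sum': "t abs_summable_on X" for X
      by (rule summable_on_subset_banach[OF t_sum]) auto
    have "infsum t UNIV = 0"
      unfolding t_def using dirichlet_series_coeff(2)[of "of_real \<sigma>" h] assms[of "of_real \<sigma>"] \<sigma>
      by (simp add: half_plane_def)
    moreover have "infsum t UNIV = infsum t {..n} + infsum t {n<..}"
    proof -
      have "(UNIV :: nat set) = {..n} \<union> {n<..}"
        by auto
      then show ?thesis
        using infsum_Un_disjoint[of t "{..n}" "{n<..}"] abs_summable_summable[OF t_sum'] by fastforce
    qed
    moreover have "infsum t {..n} = t n"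
    proof -
      have "infsum t {..n} = sum t {..n}" by simp
      also have "\<dots> = sum t {n}"
        by (rule sum.mono_neutral_right) (auto simp: t_def less)
      finally show ?thesis by simp
    qed
    ultimately have "cmod (t n) = cmod (infsum t {n<..})"
      by (metis add_eq_0_iff norm_minus_cancel)
    also have "\<dots> \<le> (\<Sum>\<^sub>\<infinity>k\<in>{n<..}. cmod (t k))"
      by (rule norm_infsum_bound[OF t_sum'])
    also have "\<dots> \<le> (\<Sum>\<^sub>\<infinity>k\<in>{n<..}. norm h * (real (n+1) powr (2 - \<sigma>) * real k powr (-2)))"
    proof (rule infsum_mono[OF t_sum'])
      show "(\<lambda>k. norm h * (real (n+1) powr (2 - \<sigma>) * real k powr (-2))) summable_on {n<..}"
        by (intro summable_on_cmult_right summable_on_subset_banach[OF S2]) auto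
      fix k assume k: "k \<in> {n<..}"
      have "cmod (t k) = real k powr (2 - \<sigma>) * real k powr (-2) * cmod (coeff h k)"
        using k by (simp add: t_def norm_mult norm_powr_real_powr powr_add[symmetric])
      also have "\<dots> \<le> real (n+1) powr (2 - \<sigma>) * real k powr (-2) * norm h"
        using k \<sigma> by (intro mult_mono cmod_coeff_le powr_mono2') auto
      finally show "cmod (t k) \<le> norm h * (real (n+1) powr (2 - \<sigma>) * real k powr (-2))"
        by (simp add: mult_ac)
    qed
    also have "\<dots> = norm h * (real (n+1) powr (2 - \<sigma>) * (\<Sum>\<^sub>\<infinity>k\<in>{n<..}. real k powr (-2)))"
      by (simp add: infsum_cmult_right')
    also have "\<dots> \<le> norm h * (real (n+1) powr (2 - \<sigma>) * (\<Sum>\<^sub>\<infinity>k. real k powr (-2)))"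
      by (intro mult_left_mono infsum_mono_neutral summable_on_subset_banach[OF S2] S2) auto
    finally have "cmod (coeff h n) * real n powr (-\<sigma>) \<le> \<dots>"
      using n0 by (simp add: t_def norm_mult norm_powr_real_powr mult.commute)
    then have "cmod (coeff h n) \<le> norm h * (real (n+1) powr (2 - \<sigma>) * (\<Sum>\<^sub>\<infinity>k::nat. real k powr (-2))) * real n powr \<sigma>"
      using n0 by (simp add: powr_minus field_simps)
    also have "\<dots> = B * (real n / real (n+1)) powr \<sigma>"
      by (simp add: B_def powr_diff powr_divide)
    finally show ?thesis .
  qed
  have "((\<lambda>\<sigma>. B * (real n / real (n+1)) powr \<sigma>) \<longlongrightarrow> B * 0) at_top"
    by (intro tendsto_intros) (use n0 in \<open>real_asymp\<close>)
  then have "cmod (coeff h n) \<le> B * 0"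
    by (rule tendsto_lowerbound[OF _ eventually_mono[OF eventually_ge_at_top[of 2] le]]) auto
  then show False
    using n by simp
qed

lemma dirichlet_series_inject:
  assumes "\<And>s. s \<in> half_plane (1/2) \<Longrightarrow> dirichlet_series (coeff f) s = dirichlet_series (coeff g) s"
  shows "f = g"
proof -
  have "f - g = 0"
  proof (rule dirichlet_series_eq_0_imp)
    fix s assume s: "s \<in> half_plane (1/2)"
    then have "1/2 < Re s"
      by (simp add: half_plane_def)
    then show "dirichlet_series (coeff (f - g)) s = 0"
      using assms[OF s] by (simp only: dirichlet_series_minus diff_self)
  qed
  then show ?thesis
    by (metis eq_iff_diff_eq_0)
qed

section \<open>Composition operators given by matrices\<close>

text \<open>The identity for arbitrary square summable \<open>h\<close> is an interchange of summation; with
  \<open>h m = m^(-s)\<close> it computes values of the image as a Dirichlet series.\<close>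

lemma schur_operator:
  assumes E: "schur_matrix E A"
  obtains g w where "coeff g = (\<lambda>m. \<Sum>\<^sub>\<infinity>n. E m n * coeff f n)"
    "\<And>h. (\<lambda>m. (cmod (h m))\<^sup>2) summable_on UNIV \<Longrightarrow>
        (\<Sum>\<^sub>\<infinity>m. h m * coeff g m) = (\<Sum>\<^sub>\<infinity>n. (\<Sum>\<^sub>\<infinity>m. h m * E m n) * coeff f n)"
    "\<And>m. (cmod (coeff g m))\<^sup>2 \<le> A m * w m"
    "\<And>m. 0 \<le> w m" "w summable_on UNIV" "infsum w UNIV \<le> (norm f)\<^sup>2"
proof -
  obtain w where w: "\<And>m. (\<lambda>n. cmod (E m n) * cmod (coeff f n)) summable_on UNIV"
    "\<And>m. (\<Sum>\<^sub>\<infinity>n. cmod (E m n) * cmod (coeff f n))\<^sup>2 \<le> A m * w m"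
    "\<And>m. 0 \<le> w m" "w summable_on UNIV" "infsum w UNIV \<le> (\<Sum>\<^sub>\<infinity>n. (cmod (coeff f n))\<^sup>2)"
    by (rule schur_test[OF E coeff_summable_on[of f]]) (rule that)
  define y where "y m = (\<Sum>\<^sub>\<infinity>n. cmod (E m n) * cmod (coeff f n))" for m
  define b where "b m = (\<Sum>\<^sub>\<infinity>n. E m n * coeff f n)" for m
  obtain B where B: "\<And>m. A m \<le> B"
    using E by (auto simp: schur_matrix_def)
  have row: "(\<lambda>n. E m n * coeff f n) abs_summable_on UNIV" for m
    using w(1)[of m] by (simp add: norm_mult)
  have yb: "cmod (b m) \<le> y m" for m
    unfolding b_def y_def using norm_infsum_bound[OF row] by (simp add: norm_mult)
  have y0: "0 \<le> y m" for m
    using yb[of m] norm_ge_zero order_trans by blast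
  have y2: "(\<lambda>m. (y m)\<^sup>2) summable_on UNIV"
  proof (rule summable_on_comparison_test)
    show "(\<lambda>m. B * w m) summable_on UNIV"
      using w by (intro summable_on_cmult_right)
    show "(y m)\<^sup>2 \<le> B * w m" for m
      using w(2)[of m] mult_right_mono[OF B w(3)] unfolding y_def by (rule order_trans)
  qed auto
  have b2: "(\<lambda>m. (cmod (b m))\<^sup>2) summable_on UNIV"
    by (rule summable_on_comparison_test[OF y2]) (auto intro: power_mono yb)
  define g where "g = Abs_dirichlet_H b"
  have g: "coeff g = b"
    unfolding g_def using E by (intro coeff_Abs b2) (auto simp: b_def schur_matrix_def)
  show ?thesis
  proof (rule that[of g w])
    fix h :: "nat \<Rightarrow> complex" assume h: "(\<lambda>m. (cmod (h m))\<^sup>2) summable_on UNIV"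
    have S: "(\<lambda>(m,n). h m * (E m n * coeff f n)) abs_summable_on UNIV \<times> UNIV"
    proof (subst Infinite_Sum.abs_summable_on_Sigma_iff, intro conjI ballI)
      fix m :: nat
      show "(\<lambda>n. case (m,n) of (m,n) \<Rightarrow> h m * (E m n * coeff f n)) abs_summable_on UNIV"
        using summable_on_cmult_right[OF row[of m], of "cmod (h m)"] by (simp add: norm_mult)
    next
      have "(\<Sum>\<^sub>\<infinity>n. norm (case (m,n) of (m,n) \<Rightarrow> h m * (E m n * coeff f n))) = cmod (h m) * y m" for m
        by (simp add: norm_mult y_def infsum_cmult_right')
      then show "(\<lambda>m. norm (\<Sum>\<^sub>\<infinity>n. norm (case (m,n) of (m,n) \<Rightarrow> h m * (E m n * coeff f n)))) summable_on UNIV"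
        using infsum_Cauchy_Schwarz(1)[OF h y2] y0 by simp
    qed
    have "(\<Sum>\<^sub>\<infinity>m. h m * b m) = (\<Sum>\<^sub>\<infinity>m. \<Sum>\<^sub>\<infinity>n. h m * (E m n * coeff f n))"
      by (simp add: b_def infsum_cmult_right')
    also have "\<dots> = (\<Sum>\<^sub>\<infinity>n. \<Sum>\<^sub>\<infinity>m. h m * (E m n * coeff f n))"
      by (rule infsum_swap_banach) (rule abs_summable_summable[OF S])
    also have "\<dots> = (\<Sum>\<^sub>\<infinity>n. (\<Sum>\<^sub>\<infinity>m. h m * E m n) * coeff f n)"
      by (simp add: infsum_cmult_left' mult.assoc[symmetric])
    finally show "(\<Sum>\<^sub>\<infinity>m. h m * coeff g m) = \<dots>"
      by (simp add: g)
  next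
    fix m
    show "(cmod (coeff g m))\<^sup>2 \<le> A m * w m"
      using w(2)[of m] power_mono[OF yb[of m], of 2] unfolding g by (simp add: y_def)
  qed (use w in \<open>simp_all add: g b_def fun_eq_iff norm_dirichlet_H_infsum\<close>)
qed

text \<open>Column \<open>n\<close> contains the Dirichlet coefficients of \<open>n^(-s) \<circ> \<phi>\<close>.\<close>

definition represents_composition :: "(nat \<Rightarrow> nat \<Rightarrow> complex) \<Rightarrow> (complex \<Rightarrow> complex) \<Rightarrow> bool" where
  "represents_composition E \<phi> \<longleftrightarrow> (\<forall>s\<in>half_plane (1/2). \<phi> s \<in> half_plane (1/2) \<and>
     (\<forall>n\<ge>1. (\<Sum>\<^sub>\<infinity>m. of_nat m powr (-s) * E m n) = of_nat n powr (- \<phi> s)))"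

lemma composition_operator_eqI:
  assumes "\<And>s. s \<in> half_plane (1/2) \<Longrightarrow> dirichlet_series (coeff g) s = dirichlet_series (coeff f) (\<phi> s)"
  shows "composition_operator \<phi> f = g"
  unfolding composition_operator_def
proof (rule the_equality)
  fix g' assume "\<forall>s\<in>half_plane (1 / 2). dirichlet_series (coeff g') s = dirichlet_series (coeff f) (\<phi> s)"
  then show "g' = g"
    using assms by (intro dirichlet_series_inject) auto
qed (use assms in blast)

text \<open>The element provided by the Schur test represents \<open>f \<circ> \<phi>\<close>, and by uniqueness of Dirichlet
  coefficients it is the one chosen in the definition of the composition operator.\<close>

lemma composition_operator_matrix:
  assumes E: "schur_matrix E A" and \<phi>: "represents_composition E \<phi>"
  obtains w where "coeff (composition_operator \<phi> f) = (\<lambda>m. \<Sum>\<^sub>\<infinity>n. E m n * coeff f n)"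
    "\<And>h. (\<lambda>m. (cmod (h m))\<^sup>2) summable_on UNIV \<Longrightarrow>
        (\<Sum>\<^sub>\<infinity>m. h m * coeff (composition_operator \<phi> f) m) = (\<Sum>\<^sub>\<infinity>n. (\<Sum>\<^sub>\<infinity>m. h m * E m n) * coeff f n)"
    "\<And>m. (cmod (coeff (composition_operator \<phi> f) m))\<^sup>2 \<le> A m * w m"
    "\<And>m. 0 \<le> w m" "w summable_on UNIV" "infsum w UNIV \<le> (norm f)\<^sup>2"
proof -
  obtain g w where g: "coeff g = (\<lambda>m. \<Sum>\<^sub>\<infinity>n. E m n * coeff f n)"
    "\<And>h. (\<lambda>m. (cmod (h m))\<^sup>2) summable_on UNIV \<Longrightarrow>
        (\<Sum>\<^sub>\<infinity>m. h m * coeff g m) = (\<Sum>\<^sub>\<infinity>n. (\<Sum>\<^sub>\<infinity>m. h m * E m n) * coeff f n)"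
    "\<And>m. (cmod (coeff g m))\<^sup>2 \<le> A m * w m"
    "\<And>m. 0 \<le> w m" "w summable_on UNIV" "infsum w UNIV \<le> (norm f)\<^sup>2"
    by (rule schur_operator[OF E, of f]) (rule that)
  have eq: "composition_operator \<phi> f = g"
  proof (rule composition_operator_eqI)
    fix s assume s: "s \<in> half_plane (1/2)"
    then have s': "1/2 < Re s" "1/2 < Re (\<phi> s)"
      using \<phi> by (auto simp: represents_composition_def half_plane_def)
    have "dirichlet_series (coeff g) s = (\<Sum>\<^sub>\<infinity>n. (\<Sum>\<^sub>\<infinity>m. of_nat m powr (-s) * E m n) * coeff f n)"
      using g(2)[OF powr_square_summable[OF s'(1)]] by (simp add: dirichlet_series_coeff(2)[OF s'(1)])
    also have "\<dots> = (\<Sum>\<^sub>\<infinity>n. of_nat n powr (- \<phi> s) * coeff f n)"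
    proof (rule infsum_cong)
      fix n show "(\<Sum>\<^sub>\<infinity>m. of_nat m powr (-s) * E m n) * coeff f n = of_nat n powr (- \<phi> s) * coeff f n"
        using \<phi> s by (cases "n = 0") (auto simp: represents_composition_def)
    qed
    finally show "dirichlet_series (coeff g) s = dirichlet_series (coeff f) (\<phi> s)"
      by (simp add: dirichlet_series_coeff(2)[OF s'(2)])
  qed
  show ?thesis
    by (rule that[of w]; (unfold eq)?; fact g)
qed

section \<open>Poisson weights\<close>

text \<open>This is the square of \<open>(2a choose a) \<le> 4\<^sup>a / sqrt (2a + 1)\<close>; in this form induction only needs
  \<open>(2a+1)(2a+3) \<le> (2a+2)\<^sup>2\<close>.\<close>

lemma central_binomial_bound:
  "(fact (2 * a) / (fact a)\<^sup>2)\<^sup>2 * (2 * real a + 1) \<le> (16::real) ^ a"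
proof (induction a)
  case (Suc a)
  define c :: real where "c = fact (2 * a) / (fact a)\<^sup>2"
  have c: "fact (2 * Suc a) / (fact (Suc a))\<^sup>2 = c * (2 * (2 * real a + 1) / (real a + 1))"
    unfolding c_def by (simp add: divide_simps power2_eq_square) (simp add: algebra_simps)
  have "(fact (2 * Suc a) / (fact (Suc a))\<^sup>2)\<^sup>2 * (2 * real (Suc a) + 1)
      = (c\<^sup>2 * (2 * real a + 1)) * (4 * ((2 * real a + 1) * (2 * real a + 3) / (real a + 1)\<^sup>2))"
    unfolding c by (simp add: divide_simps power2_eq_square) (simp add: algebra_simps)
  also have "\<dots> \<le> 16 ^ a * 16"
  proof (rule mult_mono)
    show "c\<^sup>2 * (2 * real a + 1) \<le> 16 ^ a"
      using Suc.IH by (simp add: c_def)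
    have "(2 * real a + 1) * (2 * real a + 3) \<le> 4 * (real a + 1)\<^sup>2"
      by (simp add: power2_eq_square algebra_simps)
    then show "4 * ((2 * real a + 1) * (2 * real a + 3) / (real a + 1)\<^sup>2) \<le> 16"
      by (simp add: divide_simps)
  qed auto
  finally show ?case by simp
qed simp

definition poisson :: "real \<Rightarrow> nat \<Rightarrow> real" where
  "poisson z a = exp (-z) * z ^ a / fact a"

lemma power_div_fact_le_exp:
  fixes x :: real
  assumes "0 \<le> x"
  shows "x ^ n / fact n \<le> exp x"
proof -
  have "(\<Sum>k\<in>{n}. x ^ k /\<^sub>R fact k) \<le> (\<Sum>k. x ^ k /\<^sub>R fact k)"
    by (rule sum_le_suminf[OF summable_exp_generic]) (use assms in auto)
  then show ?thesis
    by (simp add: exp_def divide_inverse mult.commute)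
qed

lemma poisson_nonneg: "0 \<le> z \<Longrightarrow> 0 \<le> poisson z a"
  by (simp add: poisson_def)

lemma poisson_le_1: "0 \<le> z \<Longrightarrow> poisson z a \<le> 1"
  using power_div_fact_le_exp[of z a] by (simp add: poisson_def exp_minus field_simps)

text \<open>The square of a Poisson probability with mean \<open>z\<close> is a Poisson probability with mean \<open>2z\<close>
  times a central binomial probability. The first factor is at most \<open>1\<close>, the second one is small.\<close>

lemma poisson_le:
  assumes z: "0 \<le> z"
  shows "poisson z a \<le> sqrt (1 / sqrt (2 * real a + 1))"
proof (rule real_le_rsqrt)
  define c :: real where "c = fact (2 * a) / (fact a)\<^sup>2 / 4 ^ a"
  have "c\<^sup>2 * (2 * real a + 1) \<le> 1"
  proof -
    have "((4::real) ^ a)\<^sup>2 = 16 ^ a"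
      by (simp add: power2_eq_square power_mult_distrib[symmetric])
    then have "c\<^sup>2 = (fact (2 * a) / (fact a)\<^sup>2)\<^sup>2 / 16 ^ a"
      unfolding c_def by (simp only: power_divide)
    then show ?thesis
      using central_binomial_bound[of a] by (simp add: divide_le_eq)
  qed
  then have "c\<^sup>2 \<le> (1 / sqrt (2 * real a + 1))\<^sup>2"
    by (simp add: power_divide field_simps)
  then have c: "c \<le> 1 / sqrt (2 * real a + 1)"
    by (rule power2_le_imp_le) simp
  have "(poisson z a)\<^sup>2 = exp (- (2 * z)) * ((2 * z) ^ (2 * a) / fact (2 * a)) * c"
    by (simp add: poisson_def c_def power_divide power_mult_distrib exp_double[symmetric] power_mult power2_eq_square exp_add[symmetric])
  also have "\<dots> \<le> 1 * c"
    using power_div_fact_le_exp[of "2 * z" "2 * a"] z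
    by (intro mult_right_mono) (auto simp: exp_minus field_simps c_def)
  finally show "(poisson z a)\<^sup>2 \<le> 1 / sqrt (2 * real a + 1)"
    using c by simp
qed

lemma poisson_sup_tendsto_0: "(\<lambda>a. sqrt (1 / sqrt (2 * real a + 1))) \<longlonglongrightarrow> 0"
  by real_asymp

text \<open>Differentiating the distribution function in the mean, the sum telescopes to its last term.\<close>

lemma poisson_deriv:
  "((\<lambda>x. - (\<Sum>i\<le>a. poisson (C * x) i)) has_real_derivative (C * poisson (C * x) a)) (at x)"
proof (induction a)
  case 0
  show ?case
    by (auto simp: poisson_def intro!: derivative_eq_intros)
next
  case (Suc a)
  have "((\<lambda>x. poisson (C * x) (Suc a)) has_real_derivative (C * poisson (C * x) a - C * poisson (C * x) (Suc a))) (at x)"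
    unfolding poisson_def
    by (auto intro!: derivative_eq_intros simp: divide_simps) (cases a; simp add: algebra_simps)
  from DERIV_diff[OF Suc this] show ?case
    by simp
qed

text \<open>The mean value theorem on \<open>[log n, log (n+1)]\<close>, to the right of \<open>log n\<close>: there the power in the
  Poisson weight only grows, and the exponential drops by at most the factor \<open>2\<^sup>C\<close>.\<close>

lemma harmonic_poisson_step:
  fixes C :: real
  assumes C: "C > 0" and n: "n \<ge> 1"
  shows "C / 2 powr (C + 1) * (real n powr (-1) * poisson (C * ln (real n)) a)
     \<le> (\<Sum>i\<le>a. poisson (C * ln (real n)) i) - (\<Sum>i\<le>a. poisson (C * ln (real (Suc n))) i)"
proof -
  have ln_less: "ln (real n) < ln (real (Suc n))"
    using n by simp
  obtain \<xi> where \<xi>: "ln (real n) < \<xi>" "\<xi> < ln (real (Suc n))"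
    and eq: "- (\<Sum>i\<le>a. poisson (C * ln (real (Suc n))) i) - - (\<Sum>i\<le>a. poisson (C * ln (real n)) i)
       = (ln (real (Suc n)) - ln (real n)) * (C * poisson (C * \<xi>) a)"
    using MVT2[OF ln_less, of "\<lambda>x. - (\<Sum>i\<le>a. poisson (C * x) i)" "\<lambda>x. C * poisson (C * x) a"] poisson_deriv
    by blast
  have ln_ge: "1 / (2 * real n) \<le> ln (real (Suc n)) - ln (real n)"
  proof -
    have "ln (real n / real (Suc n)) \<le> real n / real (Suc n) - 1"
      by (rule ln_le_minus_one) (use n in simp)
    then have "1 / real (Suc n) \<le> ln (real (Suc n)) - ln (real n)"
      using n by (simp add: ln_div field_simps)
    moreover have "1 / (2 * real n) \<le> 1 / real (Suc n)"
      using n by (intro divide_left_mono) auto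
    ultimately show ?thesis by linarith
  qed
  have "exp (- (C * ln (real n))) \<le> 2 powr C * exp (- (C * \<xi>))"
  proof -
    have "\<xi> \<le> ln (2 * real n)"
      using \<xi>(2) n by (intro order_trans[OF less_imp_le[OF \<xi>(2)]]) (subst ln_le_cancel_iff, auto)
    then have "C * \<xi> \<le> C * ln 2 + C * ln (real n)"
      using C n by (simp add: ln_mult distrib_left[symmetric])
    then have "exp (- (C * ln (real n))) \<le> exp (C * ln 2 - C * \<xi>)"
      by simp
    then show ?thesis
      by (simp add: powr_def exp_diff exp_minus field_simps)
  qed
  moreover have "(C * ln (real n)) ^ a \<le> (C * \<xi>) ^ a"
    using C n \<xi> by (intro power_mono) auto
  ultimately have "exp (- (C * ln (real n))) * (C * ln (real n)) ^ a \<le> (2 powr C * exp (- (C * \<xi>))) * (C * \<xi>) ^ a"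
    using C n by (intro mult_mono) auto
  then have p: "poisson (C * ln (real n)) a / 2 powr C \<le> poisson (C * \<xi>) a"
    by (simp add: poisson_def field_simps)
  have "C / 2 powr (C + 1) * (real n powr (-1) * poisson (C * ln (real n)) a)
      = 1 / (2 * real n) * (C * (poisson (C * ln (real n)) a / 2 powr C))"
    using n by (simp add: powr_add powr_minus field_simps)
  also have "\<dots> \<le> (ln (real (Suc n)) - ln (real n)) * (C * poisson (C * \<xi>) a)"
  proof (rule mult_mono[OF ln_ge])
    have "0 \<le> poisson (C * ln (real n)) a"
      using C n by (intro poisson_nonneg) auto
    then show "0 \<le> C * (poisson (C * ln (real n)) a / 2 powr C)"
      using C by simp
    show "C * (poisson (C * ln (real n)) a / 2 powr C) \<le> C * poisson (C * \<xi>) a"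
      using C p by (intro mult_left_mono) auto
  qed (use ln_less in auto)
  finally show ?thesis
    using eq by linarith
qed

text \<open>The discrete counterpart of \<open>\<integral> e^(-Cx) (C x)\<^sup>a / a! dx = 1/C\<close> over \<open>x = log n\<close>: the terms are dominated
  by increments of the Poisson distribution function, which add up to at most \<open>1\<close>.\<close>

lemma harmonic_poisson_sum:
  fixes C :: real
  assumes C: "C > 0"
  shows "(\<lambda>n. real n powr (-1) * poisson (C * ln (real n)) a) summable_on UNIV"
    and "(\<Sum>\<^sub>\<infinity>n. real n powr (-1) * poisson (C * ln (real n)) a) \<le> 2 powr (C + 1) / C"
proof -
  define g where "g n = real n powr (-1) * poisson (C * ln (real n)) a" for n
  define G where "G n = (\<Sum>i\<le>a. poisson (C * ln (real n)) i)" for n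
  have g0: "g n \<ge> 0" for n
    using C poisson_nonneg[of "C * ln (real n)" a] by (cases "n = 0") (auto simp: g_def)
  have G0: "G n \<ge> 0" if "n \<ge> 1" for n
    using C that by (auto simp: G_def intro!: sum_nonneg poisson_nonneg)
  have G1: "G 1 = 1"
    by (simp add: G_def poisson_def power_0_left if_distrib[of "\<lambda>x. x / _"] cong: if_cong)
  have part: "C / 2 powr (C + 1) * (\<Sum>n<Suc M. g n) \<le> 1" for M
  proof -
    have "C / 2 powr (C + 1) * (\<Sum>n<Suc M. g n) = (\<Sum>n<M. C / 2 powr (C + 1) * g (Suc n))"
      by (subst sum.lessThan_Suc_shift) (simp add: g_def sum_distrib_left)
    also have "\<dots> \<le> (\<Sum>n<M. G (Suc n) - G (Suc (Suc n)))"
      unfolding g_def G_def by (intro sum_mono harmonic_poisson_step[OF C]) auto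
    also have "\<dots> = G 1 - G (Suc M)"
      by (induction M) auto
    also have "\<dots> \<le> 1"
      using G0[of "Suc M"] G1 by simp
    finally show ?thesis .
  qed
  have fin: "sum g X \<le> 2 powr (C + 1) / C" if "finite X" for X
  proof -
    obtain M where "X \<subseteq> {..<M}"
      using \<open>finite X\<close> finite_nat_bounded by blast
    then have "sum g X \<le> (\<Sum>n<Suc M. g n)"
      using g0 by (intro sum_mono2) auto
    also have "\<dots> \<le> 2 powr (C + 1) / C"
      using part[of M] C by (simp add: field_simps)
    finally show ?thesis .
  qed
  have "g summable_on UNIV"
    by (rule nonneg_bdd_above_summable_on) (use g0 fin in \<open>auto intro!: bdd_aboveI2[where M="2 powr (C + 1) / C"]\<close>)
  moreover have "infsum g UNIV \<le> 2 powr (C + 1) / C"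
    using calculation by (rule infsum_le_finite_sums) (use fin in auto)
  ultimately show "(\<lambda>n. real n powr (-1) * poisson (C * ln (real n)) a) summable_on UNIV"
    "(\<Sum>\<^sub>\<infinity>n. real n powr (-1) * poisson (C * ln (real n)) a) \<le> 2 powr (C + 1) / C"
    by (simp_all only: g_def[abs_def])
qed

section \<open>Partial fractions and the pole of the zeta function\<close>

text \<open>After clearing denominators a polynomial in \<open>\<eta>\<close> with infinitely many zeros remains; evaluated at
  the pole \<open>- b k\<close>, only the summand of \<open>k\<close> survives.\<close>

lemma partial_fractions_independent:
  fixes \<mu> :: "'a \<Rightarrow> complex" and b :: "'a \<Rightarrow> real"
  assumes J: "finite J" and inj: "inj_on b J" and pos: "\<And>j. j \<in> J \<Longrightarrow> 0 \<le> b j"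
    and zero: "\<And>\<eta>. \<eta> > 0 \<Longrightarrow> (\<Sum>j\<in>J. \<mu> j / of_real (b j + \<eta>)) = 0"
    and k: "k \<in> J"
  shows "\<mu> k = 0"
proof -
  define p where "p = (\<Sum>j\<in>J. smult (\<mu> j) (\<Prod>i\<in>J - {j}. [:of_real (b i), 1:]))"
  have poly_p: "poly p x = (\<Sum>j\<in>J. \<mu> j * (\<Prod>i\<in>J - {j}. of_real (b i) + x))" for x
    by (simp add: p_def poly_sum poly_prod)
  have "poly p (of_real \<eta>) = 0" if "\<eta> > 0" for \<eta>
  proof -
    have "poly p (of_real \<eta>) = (\<Sum>j\<in>J. (\<Prod>i\<in>J. of_real (b i + \<eta>)) * (\<mu> j / of_real (b j + \<eta>)))"
      unfolding poly_p
    proof (rule sum.cong)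
      fix j assume j: "j \<in> J"
      have "of_real (b j + \<eta>) \<noteq> (0::complex)"
        using pos[OF j] that by (metis add_nonneg_pos of_real_eq_0_iff less_irrefl)
      then show "\<mu> j * (\<Prod>i\<in>J - {j}. of_real (b i) + of_real \<eta>)
         = (\<Prod>i\<in>J. of_real (b i + \<eta>)) * (\<mu> j / of_real (b j + \<eta>))"
        by (subst prod.remove[OF J j]) (simp add: field_simps)
    qed simp
    also have "\<dots> = 0"
      by (simp only: sum_distrib_left[symmetric] zero[OF that] mult_zero_right)
    finally show ?thesis .
  qed
  then have "of_real ` {0<..} \<subseteq> {x. poly p x = 0}"
    by auto
  moreover have "infinite (complex_of_real ` {0<..})"
    using infinite_Ioi[of "0::real"] by (simp add: finite_image_iff inj_on_def)
  ultimately have "p = 0"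
    using poly_roots_finite finite_subset by metis
  then have "0 = poly p (- of_real (b k))"
    by simp
  also have "\<dots> = (\<Sum>j\<in>{k}. \<mu> j * (\<Prod>i\<in>J - {j}. of_real (b i) - of_real (b k)))"
    unfolding poly_p
  proof (rule sum.mono_neutral_cong_right)
    show "\<forall>j\<in>J - {k}. \<mu> j * (\<Prod>i\<in>J - {j}. of_real (b i) + - of_real (b k)) = 0"
      using J k by (auto simp: prod_zero_iff)
  qed (use J k in auto)
  finally have "\<mu> k * (\<Prod>i\<in>J - {k}. of_real (b i) - complex_of_real (b k)) = 0"
    by simp
  moreover have "(\<Prod>i\<in>J - {k}. of_real (b i) - complex_of_real (b k)) \<noteq> 0"
    using J inj k by (auto simp: prod_zero_iff inj_on_def)
  ultimately show ?thesis
    by simp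
qed

text \<open>The left hand side is \<open>\<integral> n^(-1-u) - x^(-1-u) dx\<close> over \<open>[n, n+1]\<close>. It is estimated by the mean value
  inequality twice: for the integrand, and for its primitive.\<close>

lemma zeta_term_bound:
  fixes u :: complex and n :: nat
  assumes u: "Re u > 0" and n: "n \<ge> 1"
  shows "cmod (of_nat n powr (-(1+u)) - (of_nat n powr (-u) - of_nat (Suc n) powr (-u)) / u)
     \<le> cmod (1 + u) * real n powr (-2)"
proof -
  define S where "S = closed_segment (of_nat n :: complex) (of_nat (Suc n))"
  have S: "z \<notin> \<real>\<^sub>\<le>\<^sub>0" "Im z = 0" "real n \<le> Re z" "cmod (z - of_nat n) \<le> 1" "z \<noteq> 0" if "z \<in> S" for z
  proof -
    obtain t where t: "0 \<le> t" "t \<le> 1" "z = (1 - t) *\<^sub>R of_nat n + t *\<^sub>R of_nat (Suc n)"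
      using \<open>z \<in> S\<close> unfolding S_def closed_segment_def by auto
    have z: "z = of_real (real n + t)"
      unfolding t by (simp add: scaleR_conv_of_real algebra_simps)
    then show "Im z = 0" "real n \<le> Re z"
      using t(1) by simp_all
    then show "z \<noteq> 0" "z \<notin> \<real>\<^sub>\<le>\<^sub>0"
      using n by (auto simp: complex_nonpos_Reals_iff)
    have "z - of_nat n = of_real t"
      unfolding z by simp
    then show "cmod (z - of_nat n) \<le> 1"
      using t(1,2) by simp
  qed
  have ends: "of_nat n \<in> S" "of_nat (Suc n) \<in> S" "convex S"
    by (auto simp: S_def)
  have norm_powr: "cmod (z powr (- w)) \<le> real n powr (- Re w)" if "z \<in> S" "Re w \<ge> 0" for z w
  proof -
    have "cmod (z powr (- w)) = Re z powr (- Re w)"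
      using S(2,3)[OF that(1)] by (subst norm_powr_real_powr) (auto simp: complex_is_Real_iff)
    also have "\<dots> \<le> real n powr (- Re w)"
      using S(3)[OF that(1)] n that(2) by (intro powr_mono2') auto
    finally show ?thesis .
  qed
  have u0: "u \<noteq> 0"
    using u by auto
  have d1: "cmod (of_nat n powr (-(1+u)) - z powr (-(1+u))) \<le> cmod (1 + u) * real n powr (-2)" if z: "z \<in> S" for z
  proof -
    have "cmod (of_nat n powr (-(1+u)) - z powr (-(1+u))) \<le> (cmod (1+u) * real n powr (-2)) * cmod (of_nat n - z)"
    proof (rule field_differentiable_bound[OF ends(3) _ _ ends(1) z])
      fix y assume y: "y \<in> S"
      show "((\<lambda>y. y powr (-(1+u))) has_field_derivative (-(1+u) * y powr (-(1+u)-1))) (at y within S)"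
        by (rule has_field_derivative_at_within[OF has_field_derivative_powr[OF S(1)[OF y]]])
      have "cmod (y powr (-(2+u))) \<le> real n powr (- Re (2+u))"
        using u by (intro norm_powr y) auto
      also have "\<dots> \<le> real n powr (-2)"
        using n u by (intro powr_mono) auto
      finally have "cmod (y powr (-(2+u))) \<le> real n powr (-2)" .
      moreover have "-(1+u) - 1 = -(2+u)" by simp
      ultimately show "cmod (-(1+u) * y powr (-(1+u)-1)) \<le> cmod (1+u) * real n powr (-2)"
        unfolding norm_mult norm_minus_cancel by (metis mult_left_mono norm_ge_zero)
    qed
    also have "\<dots> \<le> (cmod (1+u) * real n powr (-2)) * 1"
      using S(4)[OF z] by (intro mult_left_mono) (auto simp: norm_minus_commute)
    finally show ?thesis by simp
  qed
  define g where "g z = z * of_nat n powr (-(1+u)) + z powr (-u) / u" for z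
  have "cmod (g (of_nat (Suc n)) - g (of_nat n)) \<le> (cmod (1 + u) * real n powr (-2)) * cmod (of_nat (Suc n) - of_nat n :: complex)"
  proof (rule field_differentiable_bound[OF ends(3) _ _ ends(2) ends(1)])
    fix z assume z: "z \<in> S"
    have "-(1+u) = -u-1"
      by simp
    then have "((\<lambda>z. z powr (-u)) has_field_derivative (-u * z powr (-(1+u)))) (at z within S)"
      by (simp only: has_field_derivative_at_within[OF has_field_derivative_powr[OF S(1)[OF z]]])
    from DERIV_add[OF DERIV_cmult_right[OF DERIV_ident, of "of_nat n powr (-(1+u))" z S] DERIV_cdivide[OF this, of u]]
    show "(g has_field_derivative (of_nat n powr (-(1+u)) - z powr (-(1+u)))) (at z within S)"
      unfolding g_def using u0 by (simp add: algebra_simps)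
  qed (rule d1)
  moreover have "g (of_nat (Suc n)) - g (of_nat n) = of_nat n powr (-(1+u)) - (of_nat n powr (-u) - of_nat (Suc n) powr (-u)) / u"
    unfolding g_def by (simp add: algebra_simps diff_divide_distrib)
  ultimately show ?thesis
    by simp
qed

lemma powr_abs_summable:
  assumes "Re s > 1"
  shows "(\<lambda>n. cmod (of_nat n powr (-s))) summable_on (UNIV :: nat set)"
proof -
  have "cmod (of_nat n powr (-s)) = real n powr (- Re s)" for n :: nat
    by (cases "n = 0") (auto simp: norm_powr_real_powr)
  then show ?thesis
    using assms by (simp add: summable_on_UNIV_nonneg_real_iff summable_real_powr_iff)
qed

text \<open>The compensating terms telescope to \<open>1/u\<close>.\<close>

lemma zeta_pole_bound:
  fixes u :: complex
  assumes u: "Re u > 0"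
  shows "cmod ((\<Sum>\<^sub>\<infinity>n::nat. of_nat n powr (-(1+u))) - 1 / u) \<le> cmod (1 + u) * (\<Sum>n. real (Suc n) powr (-2))"
proof -
  have "(\<lambda>n. of_nat n powr (-(1+u))) sums (\<Sum>\<^sub>\<infinity>n::nat. of_nat n powr (-(1+u)))"
    by (rule has_sum_imp_sums[OF has_sum_infsum[OF abs_summable_summable[OF powr_abs_summable]]]) (use u in simp)
  then have 1: "(\<lambda>n. of_nat (Suc n) powr (-(1+u))) sums (\<Sum>\<^sub>\<infinity>n::nat. of_nat n powr (-(1+u)))"
    by (subst sums_Suc_iff) simp
  have "(\<lambda>n. of_nat (Suc n) powr (-u)) \<longlonglongrightarrow> 0"
  proof (rule tendsto_norm_zero_cancel)
    have "(\<lambda>n. real (Suc n) powr (- Re u)) \<longlonglongrightarrow> 0"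
      using u by real_asymp
    then show "(\<lambda>n. cmod (of_nat (Suc n) powr (-u))) \<longlonglongrightarrow> 0"
      by (simp add: norm_powr_real_powr del: of_nat_Suc)
  qed
  from telescope_sums'[OF this] have "(\<lambda>n. of_nat (Suc n) powr (-u) - of_nat (Suc (Suc n)) powr (-u)) sums (1 - 0)"
    by simp
  from sums_diff[OF 1 sums_divide[OF this, of u]]
  have 2: "(\<lambda>n. of_nat (Suc n) powr (-(1+u)) - (of_nat (Suc n) powr (-u) - of_nat (Suc (Suc n)) powr (-u)) / u)
     sums ((\<Sum>\<^sub>\<infinity>n::nat. of_nat n powr (-(1+u))) - 1 / u)"
    by simp
  have S: "summable (\<lambda>n. cmod (1 + u) * real (Suc n) powr (-2))"
    using summable_Suc_iff[of "\<lambda>n. real n powr (-2)"] by (intro summable_mult) (simp add: summable_real_powr_iff)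
  have "cmod (\<Sum>n. of_nat (Suc n) powr (-(1+u)) - (of_nat (Suc n) powr (-u) - of_nat (Suc (Suc n)) powr (-u)) / u)
     \<le> (\<Sum>n. cmod (1 + u) * real (Suc n) powr (-2))"
    by (rule norm_suminf_le[OF _ S]) (rule zeta_term_bound[OF u], simp)
  also have "\<dots> = cmod (1 + u) * (\<Sum>n. real (Suc n) powr (-2))"
    using summable_Suc_iff[of "\<lambda>n. real n powr (-2)"] by (intro suminf_mult) (simp add: summable_real_powr_iff)
  finally show ?thesis
    using 2 by (simp add: sums_iff)
qed

section \<open>Compact operators\<close>

lemma norm_le_finite_sums:
  assumes "\<And>X. finite X \<Longrightarrow> (\<Sum>m\<in>X. (cmod (coeff f m))\<^sup>2) \<le> R\<^sup>2" "0 \<le> R"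
  shows "norm f \<le> R"
proof (rule power2_le_imp_le)
  show "(norm f)\<^sup>2 \<le> R\<^sup>2"
    unfolding norm_dirichlet_H_infsum
    by (rule infsum_le_finite_sums[OF coeff_summable_on]) (rule assms)
qed (fact assms)

text \<open>A bounded set with uniformly small tails of coefficients: by a diagonal argument a sequence in it
  has a subsequence converging coordinatewise, and the tail bounds, which pass to the limit, turn
  this into convergence in norm. Bounding finite partial sums only makes the conditions visibly
  closed under coordinatewise limits and provides completeness at the same time.\<close>

lemma compact_equitail:
  fixes R :: real and L :: "nat \<Rightarrow> nat"
  defines "K \<equiv> {f. (\<forall>X. finite X \<longrightarrow> (\<Sum>m\<in>X. (cmod (coeff f m))\<^sup>2) \<le> R\<^sup>2) \<and>
      (\<forall>k X. finite X \<longrightarrow> X \<subseteq> {L k..} \<longrightarrow> (\<Sum>m\<in>X. (cmod (coeff f m))\<^sup>2) \<le> 1 / real (Suc k))}"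
  shows "compact K"
  unfolding compact_eq_seq_compact_metric seq_compact_def
proof (intro allI impI)
  fix F :: "nat \<Rightarrow> dirichlet_H" assume F: "\<forall>n. F n \<in> K"
  have bound: "cmod (coeff (F n) m) \<le> \<bar>R\<bar>" for n m
    using F norm_le_finite_sums[of "F n" "\<bar>R\<bar>"] order_trans[OF cmod_coeff_le] by (auto simp: K_def)
  obtain r a where r: "strict_mono (r :: nat \<Rightarrow> nat)" and a: "\<And>m. (\<lambda>n. coeff (F (r n)) m) \<longlonglongrightarrow> a m"
    using function_convergent_subsequence[of UNIV "\<lambda>n. coeff (F n)" "\<bar>R\<bar>", OF _ bound] by (metis UNIV_I countableI_type)
  have lim: "(\<lambda>n. \<Sum>m\<in>X. (cmod (coeff (F (r n)) m))\<^sup>2) \<longlonglongrightarrow> (\<Sum>m\<in>X. (cmod (a m))\<^sup>2)" for X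
    by (intro tendsto_intros a)
  have a_le: "(\<Sum>m\<in>X. (cmod (a m))\<^sup>2) \<le> R\<^sup>2" if "finite X" for X
    by (rule LIMSEQ_le_const2[OF lim]) (use F that in \<open>auto simp: K_def\<close>)
  have a_tail: "(\<Sum>m\<in>X. (cmod (a m))\<^sup>2) \<le> 1 / real (Suc k)" if "finite X" "X \<subseteq> {L k..}" for X k
    by (rule LIMSEQ_le_const2[OF lim]) (use F that in \<open>auto simp: K_def simp del: of_nat_Suc\<close>)
  have "a 0 = 0"
    using LIMSEQ_unique[OF a[of 0]] by simp
  moreover have "(\<lambda>m. (cmod (a m))\<^sup>2) summable_on UNIV"
    by (rule nonneg_bdd_above_summable_on) (use a_le in \<open>auto intro!: bdd_aboveI2[where M="R\<^sup>2"]\<close>)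
  ultimately obtain g where g: "coeff g = a"
    using coeff_Abs by blast
  have "g \<in> K"
    using a_le a_tail by (auto simp: K_def g simp del: of_nat_Suc)
  moreover have "(F \<circ> r) \<longlonglongrightarrow> g"
  proof (rule LIMSEQ_I)
    fix e :: real assume e: "e > 0"
    obtain k where k: "4 / real (Suc k) < e\<^sup>2 / 8"
    proof -
      have "(\<lambda>k. 4 / real (Suc k)) \<longlonglongrightarrow> 0"
        by real_asymp
      then have "\<forall>\<^sub>F k in sequentially. 4 / real (Suc k) < e\<^sup>2 / 8"
        by (rule order_tendstoD) (use e in simp)
      then show ?thesis
        using that eventually_happens' sequentially_bot by blast
    qed
    have "(\<lambda>n. \<Sum>m<L k. (cmod (coeff (F (r n)) m - a m))\<^sup>2) \<longlonglongrightarrow> (\<Sum>m<L k. (cmod (a m - a m))\<^sup>2)"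
      by (intro tendsto_intros a)
    then have "\<forall>\<^sub>F n in sequentially. (\<Sum>m<L k. (cmod (coeff (F (r n)) m - a m))\<^sup>2) < e\<^sup>2 / 8"
      by (rule order_tendstoD) (use e in simp)
    then obtain n0 where n0: "\<And>n. n \<ge> n0 \<Longrightarrow> (\<Sum>m<L k. (cmod (coeff (F (r n)) m - a m))\<^sup>2) < e\<^sup>2 / 8"
      by (auto simp: eventually_sequentially)
    have "norm (F (r n) - g) \<le> e / 2" if n: "n \<ge> n0" for n
    proof (rule norm_le_finite_sums)
      fix X :: "nat set" assume X: "finite X"
      have "(\<Sum>m\<in>X. (cmod (coeff (F (r n) - g) m))\<^sup>2) \<le> (\<Sum>m\<in>{..<L k} \<union> (X \<inter> {L k..}). (cmod (coeff (F (r n) - g) m))\<^sup>2)"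
        using X by (intro sum_mono2) auto
      also have "\<dots> = (\<Sum>m<L k. (cmod (coeff (F (r n) - g) m))\<^sup>2) + (\<Sum>m\<in>X \<inter> {L k..}. (cmod (coeff (F (r n) - g) m))\<^sup>2)"
        using X by (intro sum.union_disjoint) auto
      also have "(\<Sum>m<L k. (cmod (coeff (F (r n) - g) m))\<^sup>2) \<le> e\<^sup>2 / 8"
        using n0[OF n] by (simp add: coeff_minus g)
      also have "(\<Sum>m\<in>X \<inter> {L k..}. (cmod (coeff (F (r n) - g) m))\<^sup>2)
         \<le> (\<Sum>m\<in>X \<inter> {L k..}. 2 * (cmod (coeff (F (r n)) m))\<^sup>2 + 2 * (cmod (a m))\<^sup>2)"
      proof (rule sum_mono)
        fix m
        have "(cmod (coeff (F (r n)) m - a m))\<^sup>2 \<le> (cmod (coeff (F (r n)) m) + cmod (a m))\<^sup>2"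
          by (intro power_mono norm_triangle_ineq4) auto
        also have "\<dots> \<le> 2 * (cmod (coeff (F (r n)) m))\<^sup>2 + 2 * (cmod (a m))\<^sup>2"
          using sum_squares_bound[of "cmod (coeff (F (r n)) m)" "cmod (a m)"] by (simp add: power2_sum)
        finally show "(cmod (coeff (F (r n) - g) m))\<^sup>2 \<le> 2 * (cmod (coeff (F (r n)) m))\<^sup>2 + 2 * (cmod (a m))\<^sup>2"
          by (simp add: coeff_minus g)
      qed
      also have "\<dots> = 2 * (\<Sum>m\<in>X \<inter> {L k..}. (cmod (coeff (F (r n)) m))\<^sup>2) + 2 * (\<Sum>m\<in>X \<inter> {L k..}. (cmod (a m))\<^sup>2)"
        by (simp add: sum.distrib sum_distrib_left)
      also have "(\<Sum>m\<in>X \<inter> {L k..}. (cmod (coeff (F (r n)) m))\<^sup>2) \<le> 1 / real (Suc k)"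
        using F X by (auto simp: K_def simp del: of_nat_Suc)
      also have "(\<Sum>m\<in>X \<inter> {L k..}. (cmod (a m))\<^sup>2) \<le> 1 / real (Suc k)"
        using X by (intro a_tail) auto
      finally show "(\<Sum>m\<in>X. (cmod (coeff (F (r n) - g) m))\<^sup>2) \<le> (e / 2)\<^sup>2"
        using k by (simp add: power_divide)
    qed (use e in simp)
    then show "\<exists>n0. \<forall>n\<ge>n0. norm ((F \<circ> r) n - g) < e"
      using e by (intro exI[of _ n0]) force
  qed
  ultimately show "\<exists>l\<in>K. \<exists>r. strict_mono r \<and> (F \<circ> r) \<longlonglongrightarrow> l"
    using r by blast
qed

interpretation H: vector_space scaleC
  by unfold_locales (transfer; simp add: algebra_simps)+

lemma linear_scaleC_iff:
  "Vector_Spaces.linear scaleC scaleC T \<longleftrightarrow>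
     (\<forall>f g. T (f + g) = T f + T g) \<and> (\<forall>c f. T (scaleC c f) = scaleC c (T f))"
  using H.vector_space_axioms
  by (auto simp: Vector_Spaces.linear_iff module_hom_iff_linear[symmetric] module_hom_iff vector_space_def module_def
      linear_iff_module_hom)

lemma norm_scaleC: "norm (scaleC c f) = cmod c * norm f"
proof -
  have "(norm (scaleC c f))\<^sup>2 = (cmod c * norm f)\<^sup>2"
    by (simp add: norm_dirichlet_H_infsum scaleC.rep_eq norm_mult power_mult_distrib infsum_cmult_right')
  then show ?thesis
    by (rule power2_eq_imp_eq) auto
qed

lemma scaleC_diff: "scaleC c (f - g) = scaleC c f - scaleC c g"
  using H.scale_right_diff_distrib .

lemma continuous_on_scaleC: "continuous_on S (scaleC c)"
  by (rule lipschitz_on_continuous_on[OF lipschitz_onI[of _ _ "cmod c"]])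
     (simp_all add: dist_norm scaleC_diff[symmetric] norm_scaleC)

lemma compact_operatorI:
  assumes "\<And>f g. T (f + g) = T f + T g" "\<And>c f. T (scaleC c f) = scaleC c (T f)"
    and "T ` cball 0 1 \<subseteq> K" "compact K"
  shows "compact_operator T"
  unfolding compact_operator_def linear_scaleC_iff
proof (intro conjI allI)
  have "closure (T ` cball 0 1) \<subseteq> K"
    using assms(3,4) by (simp add: closure_minimal compact_imp_closed)
  then show "compact (closure (T ` cball 0 1))"
    using compact_Int_closed[OF assms(4) closed_closure[of "T ` cball 0 1"]] by (simp add: Int_absorb1)
qed (fact assms)+

lemma compact_operatorD:
  assumes "compact_operator T"
  shows "T (f + g) = T f + T g" "T (scaleC c f) = scaleC c (T f)" 
  using assms by (auto simp: compact_operator_def linear_scaleC_iff)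

lemma compact_operator_add:
  assumes S: "compact_operator S" and T: "compact_operator T"
  shows "compact_operator (\<lambda>f. S f + T f)"
proof (rule compact_operatorI)
  let ?K = "{x + y |x y. x \<in> closure (S ` cball 0 1) \<and> y \<in> closure (T ` cball 0 1)}"
  show "compact ?K"
    using S T by (intro compact_sums) (simp_all add: compact_operator_def)
  show "(\<lambda>f. S f + T f) ` cball 0 1 \<subseteq> ?K"
  proof
    fix y assume "y \<in> (\<lambda>f. S f + T f) ` cball 0 1"
    then obtain f where "f \<in> cball 0 1" "y = S f + T f"
      by blast
    then show "y \<in> ?K"
      by (intro CollectI exI[of _ "S f"] exI[of _ "T f"] conjI subsetD[OF closure_subset] imageI)
  qed
qed (simp_all add: compact_operatorD[OF S] compact_operatorD[OF T] H.scale_right_distrib)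

lemma compact_operator_scaleC:
  assumes T: "compact_operator T"
  shows "compact_operator (\<lambda>f. scaleC c (T f))"
proof (rule compact_operatorI)
  show "compact (scaleC c ` closure (T ` cball 0 1))"
    using T by (intro compact_continuous_image continuous_on_scaleC) (simp add: compact_operator_def)
  show "(\<lambda>f. scaleC c (T f)) ` cball 0 1 \<subseteq> scaleC c ` closure (T ` cball 0 1)"
    using image_mono[OF closure_subset[of "T ` cball 0 1"], of "scaleC c"] by (simp add: image_image)
qed (simp_all add: compact_operatorD[OF T] H.scale_right_distrib
      H.scale_left_commute)

lemma compact_operator_sum:
  assumes "\<And>j. j \<in> J \<Longrightarrow> compact_operator (T j)"
  shows "compact_operator (\<lambda>f. \<Sum>j\<in>J. T j f)"
  using assms
proof (induction J rule: infinite_finite_induct)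
  case (insert j J)
  then show ?case
    by (simp add: compact_operator_add)
qed (auto intro!: compact_operatorI[of _ "{0}"] simp: H.scale_zero_right)

text \<open>Only one limit point is possible for the images, since coefficients are continuous.\<close>

lemma compact_operator_tendsto_0:
  assumes T: "compact_operator T" and F: "\<And>n. norm (F n) \<le> 1"
    and coord: "\<And>m. (\<lambda>n. coeff (T (F n)) m) \<longlonglongrightarrow> 0"
  shows "(\<lambda>n. norm (T (F n))) \<longlonglongrightarrow> 0"
proof (rule ccontr)
  assume "\<not> (\<lambda>n. norm (T (F n))) \<longlonglongrightarrow> 0"
  then obtain e where e: "e > 0" and "\<And>n0. \<exists>n\<ge>n0. e \<le> norm (T (F n))"
    unfolding LIMSEQ_iff by (auto simp: not_less)
  then have "infinite {n. e \<le> norm (T (F n))}"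
    by (auto simp: infinite_nat_iff_unbounded_le)
  then obtain r where r: "strict_mono (r :: nat \<Rightarrow> nat)" "\<And>n. e \<le> norm (T (F (r n)))"
    using infinite_enumerate by blast
  have "\<forall>n. T (F (r n)) \<in> closure (T ` cball 0 1)"
    using F by (intro allI subsetD[OF closure_subset] imageI) simp
  then obtain l p where p: "strict_mono (p :: nat \<Rightarrow> nat)" and l: "((\<lambda>n. T (F (r n))) \<circ> p) \<longlonglongrightarrow> l"
    using T unfolding compact_operator_def compact_eq_seq_compact_metric seq_compact_def by meson
  have "coeff l m = 0" for m
  proof (rule LIMSEQ_unique)
    show "(\<lambda>n. coeff (T (F (r (p n)))) m) \<longlonglongrightarrow> 0"
      using LIMSEQ_subseq_LIMSEQ[OF coord strict_mono_o[OF r(1) p]] by (simp add: o_def)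
    have "(\<lambda>n. norm (T (F (r (p n))) - l)) \<longlonglongrightarrow> 0"
      using l by (simp add: o_def LIM_zero tendsto_norm_zero)
    then have "(\<lambda>n. coeff (T (F (r (p n))) - l) m) \<longlonglongrightarrow> 0"
      by (rule Lim_null_comparison[rotated]) (simp add: cmod_coeff_le)
    then show "(\<lambda>n. coeff (T (F (r (p n)))) m) \<longlonglongrightarrow> coeff l m"
      by (simp add: coeff_minus LIM_zero_iff)
  qed
  then have "l = 0"
    by (simp add: coeff_inject[symmetric] zero_dirichlet_H.rep_eq fun_eq_iff)
  then have "(\<lambda>n. norm (T (F (r (p n))))) \<longlonglongrightarrow> 0"
    using tendsto_norm[OF l] by (simp add: o_def)
  then have "e \<le> 0"
    by (rule LIMSEQ_le_const) (use r in auto)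
  with e show False by simp
qed

lemma schur_row_summable:
  assumes "schur_matrix E A"
  shows "(\<lambda>n. E m n * coeff f n) summable_on UNIV"
proof -
  have "(\<lambda>n. cmod (E m n) * cmod (coeff f n)) summable_on UNIV"
    by (rule schur_test[OF assms coeff_summable_on[of f]])
  then show ?thesis
    by (intro abs_summable_summable[of "\<lambda>n. E m n * coeff f n"]) (simp add: norm_mult)
qed

text \<open>By the rowwise Schur bound the tail of \<open>C\<^sub>\<phi> f\<close> beyond row \<open>L\<close> has squared norm at most
  \<open>sup {A m | m \<ge> L}\<close>, uniformly over the unit ball.\<close>

lemma compact_composition_operator:
  assumes E: "schur_matrix E A" and \<phi>: "represents_composition E \<phi>" and A: "A \<longlonglongrightarrow> 0"
  shows "compact_operator (composition_operator \<phi>)"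
proof -
  have coeff_C: "coeff (composition_operator \<phi> f) m = (\<Sum>\<^sub>\<infinity>n. E m n * coeff f n)" for f m
    by (rule composition_operator_matrix[OF E \<phi>, of f]) (rule fun_cong)
  obtain B where B: "\<And>m. A m \<le> B"
    using E by (auto simp: schur_matrix_def)
  have B0: "0 \<le> B"
    using B[of 0] schur_matrix_nonneg[OF E, of 0] by simp
  have weighted: "(\<Sum>m\<in>X. (cmod (coeff (composition_operator \<phi> f) m))\<^sup>2) \<le> b"
    if X: "finite X" and b: "\<And>m. m \<in> X \<Longrightarrow> A m \<le> b" and f: "norm f \<le> 1" and b0: "0 \<le> b" for X b f
  proof -
    obtain w where w: "\<And>m. (cmod (coeff (composition_operator \<phi> f) m))\<^sup>2 \<le> A m * w m"
      "\<And>m. 0 \<le> w m" "w summable_on UNIV" "infsum w UNIV \<le> (norm f)\<^sup>2"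
      by (rule composition_operator_matrix[OF E \<phi>, of f]) (rule that)
    have "(\<Sum>m\<in>X. (cmod (coeff (composition_operator \<phi> f) m))\<^sup>2) \<le> (\<Sum>m\<in>X. b * w m)"
      using b w(2) by (intro sum_mono order_trans[OF w(1)] mult_right_mono)
    also have "\<dots> = b * sum w X"
      by (simp add: sum_distrib_left)
    also have "\<dots> \<le> b * infsum w UNIV"
      using X w b0 by (intro mult_left_mono finite_sum_le_infsum) auto
    also have "\<dots> \<le> b * 1"
      using f w(4) b0 power_mono[OF f, of 2] by (intro mult_left_mono) auto
    finally show ?thesis by simp
  qed
  have "\<exists>L. \<forall>m\<ge>L. A m \<le> 1 / real (Suc k)" for k
  proof -
    have "\<forall>\<^sub>F m in sequentially. A m < 1 / real (Suc k)"
      using order_tendstoD(2)[OF A, of "1 / real (Suc k)"] by simp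
    then show ?thesis
      unfolding eventually_sequentially by (meson less_imp_le)
  qed
  then obtain L where L: "\<And>k m. m \<ge> L k \<Longrightarrow> A m \<le> 1 / real (Suc k)"
    by metis
  show ?thesis
  proof (rule compact_operatorI[OF _ _ _ compact_equitail[of "sqrt B" L]])
    show "composition_operator \<phi> ` cball 0 1 \<subseteq> {f. (\<forall>X. finite X \<longrightarrow> (\<Sum>m\<in>X. (cmod (coeff f m))\<^sup>2) \<le> (sqrt B)\<^sup>2) \<and>
      (\<forall>k X. finite X \<longrightarrow> X \<subseteq> {L k..} \<longrightarrow> (\<Sum>m\<in>X. (cmod (coeff f m))\<^sup>2) \<le> 1 / real (Suc k))}"
      using B B0 L by (auto intro!: weighted simp del: of_nat_Suc)
  next
    fix f g
    have "coeff (composition_operator \<phi> (f + g)) m = coeff (composition_operator \<phi> f + composition_operator \<phi> g) m" for m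
      by (simp add: coeff_C plus_dirichlet_H.rep_eq distrib_left infsum_add schur_row_summable[OF E])
    then show "composition_operator \<phi> (f + g) = composition_operator \<phi> f + composition_operator \<phi> g"
      by (simp add: coeff_inject[symmetric] fun_eq_iff)
  next
    fix c f
    have "coeff (composition_operator \<phi> (scaleC c f)) m = coeff (scaleC c (composition_operator \<phi> f)) m" for m
      by (simp add: coeff_C scaleC.rep_eq mult.left_commute[of _ c] infsum_cmult_right')
    then show "composition_operator \<phi> (scaleC c f) = scaleC c (composition_operator \<phi> f)"
      by (simp add: coeff_inject[symmetric] fun_eq_iff)
  qed
qed

section \<open>The matrix of a linear symbol\<close>

text \<open>A product of exponential series. The value for \<open>cmod (z k)\<close> is nonzero, which already entails
  absolute summability, as a divergent sum would have the default value \<open>0\<close>.\<close>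

lemma exp_series_PiE:
  fixes z :: "'k \<Rightarrow> complex"
  assumes "finite K"
  shows "(\<lambda>\<alpha>. \<Prod>k\<in>K. z k ^ \<alpha> k / fact (\<alpha> k)) abs_summable_on (K \<rightarrow>\<^sub>E UNIV)"
    and "(\<Sum>\<^sub>\<infinity>\<alpha>\<in>K \<rightarrow>\<^sub>E UNIV. \<Prod>k\<in>K. z k ^ \<alpha> k / fact (\<alpha> k)) = exp (\<Sum>k\<in>K. z k)"
    and "(\<Sum>\<^sub>\<infinity>\<alpha>\<in>K \<rightarrow>\<^sub>E UNIV. \<Prod>k\<in>K. cmod (z k) ^ \<alpha> k / fact (\<alpha> k)) = exp (\<Sum>k\<in>K. cmod (z k))"
proof -
  have norm_sum: "((\<lambda>a. cmod (z k) ^ a / fact a) has_sum exp (cmod (z k))) UNIV" for k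
    using exp_converges[of "cmod (z k)"] by (intro sums_nonneg_imp_has_sum) (auto simp: divide_inverse mult.commute)
  have eq_norm: "cmod (z k ^ a / fact a) = cmod (z k) ^ a / fact a" for k a
    by (simp add: norm_divide norm_power)
  have abs: "(\<lambda>a. z k ^ a / fact a) abs_summable_on UNIV" for k
    using has_sum_imp_summable[OF norm_sum] by (simp add: eq_norm)
  have sum: "(\<Sum>\<^sub>\<infinity>a. z k ^ a / fact a) = exp (z k)" for k
  proof -
    have "(\<lambda>a. z k ^ a / fact a) sums (\<Sum>\<^sub>\<infinity>a. z k ^ a / fact a)"
      by (intro has_sum_imp_sums has_sum_infsum abs_summable_summable[OF abs])
    moreover have "(\<lambda>a. z k ^ a / fact a) sums exp (z k)"
      using exp_converges[of "z k"] by (simp add: scaleR_conv_of_real divide_inverse mult.commute)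
    ultimately show ?thesis
      by (rule sums_unique2)
  qed
  show "(\<Sum>\<^sub>\<infinity>\<alpha>\<in>K \<rightarrow>\<^sub>E UNIV. \<Prod>k\<in>K. z k ^ \<alpha> k / fact (\<alpha> k)) = exp (\<Sum>k\<in>K. z k)"
    using infsum_prod_PiE_abs[OF assms, of "\<lambda>k a. z k ^ a / fact a" "\<lambda>_. UNIV"] abs assms
    by (simp add: sum exp_sum)
  show norm_eq: "(\<Sum>\<^sub>\<infinity>\<alpha>\<in>K \<rightarrow>\<^sub>E UNIV. \<Prod>k\<in>K. cmod (z k) ^ \<alpha> k / fact (\<alpha> k)) = exp (\<Sum>k\<in>K. cmod (z k))"
    using infsum_prod_PiE_abs[OF assms, of "\<lambda>k a. cmod (z k) ^ a / fact a" "\<lambda>_. UNIV"]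
      has_sum_imp_summable[OF norm_sum] assms
    by (simp add: infsumI[OF norm_sum] exp_sum)
  have "(\<lambda>\<alpha>. \<Prod>k\<in>K. cmod (z k) ^ \<alpha> k / fact (\<alpha> k)) summable_on (K \<rightarrow>\<^sub>E UNIV)"
  proof (rule ccontr)
    assume "\<not> ?thesis"
    from infsum_not_exists[OF this] norm_eq show False by simp
  qed
  then show "(\<lambda>\<alpha>. \<Prod>k\<in>K. z k ^ \<alpha> k / fact (\<alpha> k)) abs_summable_on (K \<rightarrow>\<^sub>E UNIV)"
    by (simp add: prod_norm[symmetric] eq_norm)
qed

text \<open>Keeps the index set \<open>{1..d}\<close> and the index \<open>1\<close> in the same form.\<close>

declare One_nat_def [simp del]

text \<open>The coefficients of a linear symbol of zero characteristic, with the Gordon-Hedenmalm condition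
  in its explicit form. If \<open>d = 0\<close> the symbol is constant, and its value lies in the open half
  plane.\<close>

locale linear_data =
  fixes c\<^sub>1 :: complex and d :: nat and q :: "nat \<Rightarrow> nat" and C :: "nat \<Rightarrow> complex"
  assumes independent: "multiplicatively_independent d q"
    and q_ne_1: "\<And>k. k \<in> {1..d} \<Longrightarrow> q k \<noteq> 1"
    and C_ne_0: "\<And>k. k \<in> {1..d} \<Longrightarrow> C k \<noteq> 0"
    and half_plane_condition: "1/2 + (\<Sum>k=1..d. cmod (C k)) \<le> Re c\<^sub>1"
    and degenerate_condition: "d = 0 \<Longrightarrow> 1/2 < Re c\<^sub>1"
begin

abbreviation exponents :: "(nat \<Rightarrow> nat) set" where
  "exponents \<equiv> {1..d} \<rightarrow>\<^sub>E UNIV"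

definition monomial :: "(nat \<Rightarrow> nat) \<Rightarrow> nat" where
  "monomial \<alpha> = (\<Prod>k=1..d. q k ^ \<alpha> k)"

definition symbol :: "complex \<Rightarrow> complex" where
  "symbol s = c\<^sub>1 + (\<Sum>k=1..d. C k * of_nat (q k) powr (-s))"

text \<open>The coefficient of \<open>(monomial \<alpha>)^(-s)\<close> in the expansion of \<open>n\<close> to the power \<open>- symbol s\<close>.\<close>

definition entry :: "(nat \<Rightarrow> nat) \<Rightarrow> nat \<Rightarrow> complex" where
  "entry \<alpha> n = of_nat n powr (-c\<^sub>1) * (\<Prod>k=1..d. (- C k * of_real (ln (real n))) ^ \<alpha> k / fact (\<alpha> k))"

definition symbol_matrix :: "nat \<Rightarrow> nat \<Rightarrow> complex" where
  "symbol_matrix m n = (if n = 0 \<or> m \<notin> monomial ` exponents then 0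
     else entry (the_inv_into exponents monomial m) n)"

text \<open>The distance of the range of the symbol on \<open>half_plane 0\<close> from the line \<open>Re = 1/2\<close>.\<close>

definition gap :: real where
  "gap = Re c\<^sub>1 - 1/2 - (\<Sum>k=1..d. cmod (C k))"

lemma gap_nonneg: "0 \<le> gap"
  using half_plane_condition by (simp add: gap_def)

lemma q_ge_2:
  assumes "k \<in> {1..d}"
  shows "2 \<le> q k"
proof -
  have "0 < q k"
    using independent assms by (simp add: multiplicatively_independent_def)
  then show ?thesis
    using q_ne_1[OF assms] by linarith
qed

lemma monomial_pos: "0 < monomial \<alpha>"
  unfolding monomial_def
proof (rule prod_pos)
  show "0 < q k ^ \<alpha> k" if "k \<in> {1..d}" for k
    using q_ge_2[OF that] by simp
qed

lemma inj_monomial: "inj_on monomial exponents"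
proof (rule inj_onI)
  fix \<alpha> \<beta> assume \<alpha>: "\<alpha> \<in> exponents" and \<beta>: "\<beta> \<in> exponents" and eq: "monomial \<alpha> = monomial \<beta>"
  have pos: "real (q k) \<noteq> 0" if "k \<in> {1..d}" for k
    using q_ge_2[OF that] by simp
  have "(\<Prod>k=1..d. real (q k) powi (int (\<alpha> k) - int (\<beta> k))) = (\<Prod>k=1..d. real (q k) ^ \<alpha> k / real (q k) ^ \<beta> k)"
    using pos by (intro prod.cong) (auto simp: power_int_diff)
  also have "\<dots> = real (monomial \<alpha>) / real (monomial \<beta>)"
    by (simp add: monomial_def prod_dividef)
  also have "\<dots> = 1"
    using eq monomial_pos[of \<beta>] by simp
  finally have "\<forall>k\<in>{1..d}. int (\<alpha> k) - int (\<beta> k) = 0"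
    using independent unfolding multiplicatively_independent_def by fast
  then show "\<alpha> = \<beta>"
    using \<alpha> \<beta> by (intro PiE_ext) auto
qed

lemma symbol_matrix_monomial:
  assumes "\<alpha> \<in> exponents" "n \<noteq> 0"
  shows "symbol_matrix (monomial \<alpha>) n = entry \<alpha> n"
  using assms by (simp add: symbol_matrix_def the_inv_into_f_f[OF inj_monomial])

lemma symbol_matrix_eq_0:
  assumes "m \<notin> monomial ` exponents \<or> n = 0"
  shows "symbol_matrix m n = 0"
  using assms by (auto simp: symbol_matrix_def)

text \<open>Sums over a column are sums over exponent vectors, whatever function \<open>F\<close> of the entry is summed.\<close>

lemma column_reindex:
  fixes F :: "nat \<Rightarrow> complex \<Rightarrow> 'a :: {topological_comm_monoid_add, t2_space}"
  assumes "n \<noteq> 0" and F0: "\<And>m. F m 0 = 0"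
  shows "(\<lambda>m. F m (symbol_matrix m n)) summable_on UNIV \<longleftrightarrow> (\<lambda>\<alpha>. F (monomial \<alpha>) (entry \<alpha> n)) summable_on exponents"
    and "(\<Sum>\<^sub>\<infinity>m. F m (symbol_matrix m n)) = (\<Sum>\<^sub>\<infinity>\<alpha>\<in>exponents. F (monomial \<alpha>) (entry \<alpha> n))"
proof -
  have "(\<lambda>m. F m (symbol_matrix m n)) summable_on UNIV \<longleftrightarrow> (\<lambda>m. F m (symbol_matrix m n)) summable_on monomial ` exponents"
    by (rule summable_on_cong_neutral) (auto simp: symbol_matrix_eq_0 F0)
  also have "\<dots> \<longleftrightarrow> (\<lambda>\<alpha>. F (monomial \<alpha>) (symbol_matrix (monomial \<alpha>) n)) summable_on exponents"
    using summable_on_reindex[OF inj_monomial] by (simp add: o_def)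
  also have "\<dots> \<longleftrightarrow> (\<lambda>\<alpha>. F (monomial \<alpha>) (entry \<alpha> n)) summable_on exponents"
    using assms by (intro summable_on_cong) (simp add: symbol_matrix_monomial)
  finally show "(\<lambda>m. F m (symbol_matrix m n)) summable_on UNIV \<longleftrightarrow> (\<lambda>\<alpha>. F (monomial \<alpha>) (entry \<alpha> n)) summable_on exponents" .
  have "(\<Sum>\<^sub>\<infinity>m. F m (symbol_matrix m n)) = (\<Sum>\<^sub>\<infinity>m\<in>monomial ` exponents. F m (symbol_matrix m n))"
    by (rule infsum_cong_neutral) (auto simp: symbol_matrix_eq_0 F0)
  also have "\<dots> = (\<Sum>\<^sub>\<infinity>\<alpha>\<in>exponents. F (monomial \<alpha>) (symbol_matrix (monomial \<alpha>) n))"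
    using infsum_reindex[OF inj_monomial] by (simp add: o_def)
  also have "\<dots> = (\<Sum>\<^sub>\<infinity>\<alpha>\<in>exponents. F (monomial \<alpha>) (entry \<alpha> n))"
    using assms by (intro infsum_cong) (simp add: symbol_matrix_monomial)
  finally show "(\<Sum>\<^sub>\<infinity>m. F m (symbol_matrix m n)) = (\<Sum>\<^sub>\<infinity>\<alpha>\<in>exponents. F (monomial \<alpha>) (entry \<alpha> n))" .
qed

lemma symbol_matrix_column:
  assumes n: "n \<noteq> 0"
  shows "(\<Sum>\<^sub>\<infinity>m. of_nat m powr (-s) * symbol_matrix m n) = of_nat n powr (- symbol s)"
proof -
  define z where "z k = - C k * of_real (ln (real n)) * of_nat (q k) powr (-s)" for k
  have powr_eq_exp: "of_nat n powr w = exp (w * of_real (ln (real n)))" for w :: complex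
    using n by (simp add: powr_def Ln_of_nat)
  have term_eq: "of_nat (monomial \<alpha>) powr (-s) * entry \<alpha> n
      = of_nat n powr (-c\<^sub>1) * (\<Prod>k=1..d. z k ^ \<alpha> k / fact (\<alpha> k))" for \<alpha>
  proof -
    have pow: "of_nat (q k ^ a) powr (-s) = (of_nat (q k) powr (-s)) ^ a" for k a
      by (induction a) (simp_all add: powr_times_real)
    have "of_nat (\<Prod>k\<in>K. q k ^ \<alpha> k) powr (-s) = (\<Prod>k\<in>K. (of_nat (q k) powr (-s)) ^ \<alpha> k)" if "finite K" for K
      using that
    proof induction
      case (insert k K)
      have "of_nat (q k ^ \<alpha> k * (\<Prod>k\<in>K. q k ^ \<alpha> k)) powr (-s)
          = of_nat (q k ^ \<alpha> k) powr (-s) * of_nat (\<Prod>k\<in>K. q k ^ \<alpha> k) powr (-s)"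
        unfolding of_nat_mult by (intro powr_times_real) (simp_all del: of_nat_prod of_nat_power)
      then show ?case
        using insert by (simp add: pow del: of_nat_power of_nat_mult of_nat_prod)
    qed simp
    then have "of_nat (monomial \<alpha>) powr (-s) = (\<Prod>k=1..d. (of_nat (q k) powr (-s)) ^ \<alpha> k)"
      by (simp add: monomial_def del: of_nat_prod)
    moreover have "(\<Prod>k=1..d. z k ^ \<alpha> k / fact (\<alpha> k)) = (\<Prod>k=1..d. (of_nat (q k) powr (-s)) ^ \<alpha> k)
        * (\<Prod>k=1..d. (- C k * of_real (ln (real n))) ^ \<alpha> k / fact (\<alpha> k))"
      unfolding prod.distrib[symmetric] z_def by (intro prod.cong) (simp_all only: power_mult_distrib mult.commute times_divide_eq_right)
    ultimately show ?thesis
      by (simp only: entry_def mult.left_commute)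
  qed
  have "(\<Sum>\<^sub>\<infinity>m. of_nat m powr (-s) * symbol_matrix m n)
      = (\<Sum>\<^sub>\<infinity>\<alpha>\<in>exponents. of_nat n powr (-c\<^sub>1) * (\<Prod>k=1..d. z k ^ \<alpha> k / fact (\<alpha> k)))"
    using column_reindex(2)[OF n, of "\<lambda>m x. of_nat m powr (-s) * x"] by (simp add: term_eq)
  also have "\<dots> = of_nat n powr (-c\<^sub>1) * exp (\<Sum>k=1..d. z k)"
    by (simp add: infsum_cmult_right' exp_series_PiE(2))
  also have "\<dots> = exp (- c\<^sub>1 * of_real (ln (real n)) + (\<Sum>k=1..d. z k))"
    by (simp only: powr_eq_exp exp_add)
  also have "- c\<^sub>1 * of_real (ln (real n)) + (\<Sum>k=1..d. z k) = - symbol s * of_real (ln (real n))"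
  proof -
    have "(\<Sum>k=1..d. z k) = - (\<Sum>k=1..d. C k * of_nat (q k) powr (-s)) * of_real (ln (real n))"
      unfolding z_def sum_negf[symmetric] sum_distrib_right by (intro sum.cong) simp_all
    then show ?thesis
      by (simp add: symbol_def algebra_simps)
  qed
  also have "exp \<dots> = of_nat n powr (- symbol s)"
    by (simp only: powr_eq_exp)
  finally show ?thesis .
qed

lemma norm_entry:
  assumes n: "n \<noteq> 0"
  shows "cmod (entry \<alpha> n) = real n powr (- Re c\<^sub>1) * (\<Prod>k=1..d. (cmod (C k) * ln (real n)) ^ \<alpha> k / fact (\<alpha> k))"
  using n by (simp add: entry_def norm_mult norm_divide norm_power norm_powr_real_powr prod_norm[symmetric])

text \<open>Replacing \<open>C k\<close> by \<open>- cmod (C k)\<close> turns the sum of the moduli into the expansion of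
  \<open>n\<close> to the power \<open>- Re c\<^sub>1 + \<Sum>k. cmod (C k)\<close>.\<close>

lemma symbol_matrix_column_norm:
  assumes n: "n \<noteq> 0"
  shows "(\<lambda>m. cmod (symbol_matrix m n)) summable_on UNIV"
    and "(\<Sum>\<^sub>\<infinity>m. cmod (symbol_matrix m n)) \<le> real n powr (-1/2)"
proof -
  define z where "z k = complex_of_real (cmod (C k) * ln (real n))" for k
  have z: "cmod (z k) = cmod (C k) * ln (real n)" for k
    using n by (simp add: z_def norm_mult)
  note series = exp_series_PiE[of "{1..d}" z, unfolded prod_norm[symmetric] norm_divide norm_power norm_fact z]
  have "(\<lambda>\<alpha>. cmod (entry \<alpha> n)) summable_on exponents"
    unfolding norm_entry[OF n] by (intro summable_on_cmult_right series(1)) simp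
  then show "(\<lambda>m. cmod (symbol_matrix m n)) summable_on UNIV"
    using column_reindex(1)[OF n, of "\<lambda>m x. cmod x"] by simp
  have "(\<Sum>\<^sub>\<infinity>m. cmod (symbol_matrix m n)) = (\<Sum>\<^sub>\<infinity>\<alpha>\<in>exponents. cmod (entry \<alpha> n))"
    using column_reindex(2)[OF n, of "\<lambda>m x. cmod x"] by simp
  also have "\<dots> = real n powr (- Re c\<^sub>1) * exp (\<Sum>k=1..d. cmod (C k) * ln (real n))"
    unfolding norm_entry[OF n] by (subst infsum_cmult_right') (subst series(3), simp_all)
  also have "\<dots> = real n powr (- Re c\<^sub>1 + (\<Sum>k=1..d. cmod (C k)))"
    unfolding sum_distrib_right[symmetric] using n by (simp add: powr_def exp_add[symmetric] algebra_simps)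
  also have "\<dots> \<le> real n powr (-1/2)"
    using n half_plane_condition by (intro powr_mono) auto
  finally show "(\<Sum>\<^sub>\<infinity>m. cmod (symbol_matrix m n)) \<le> real n powr (-1/2)" .
qed

definition row_weight :: "nat \<Rightarrow> real" where
  "row_weight m = (\<Sum>\<^sub>\<infinity>n. cmod (symbol_matrix m n) * real n powr (-1/2))"

text \<open>The exponentials normalising the Poisson weights account for the part
  \<open>1/2 + \<Sum>k. cmod (C k)\<close> of \<open>Re c\<^sub>1\<close>, leaving the gap.\<close>

lemma row_term:
  assumes "n \<noteq> 0" "\<alpha> \<in> exponents"
  shows "cmod (symbol_matrix (monomial \<alpha>) n) * real n powr (-1/2)
     = real n powr (-1 - gap) * (\<Prod>k=1..d. poisson (cmod (C k) * ln (real n)) (\<alpha> k))"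
proof -
  have "(\<Prod>k=1..d. poisson (cmod (C k) * ln (real n)) (\<alpha> k))
      = (\<Prod>k=1..d. exp (- (cmod (C k) * ln (real n)))) * (\<Prod>k=1..d. (cmod (C k) * ln (real n)) ^ \<alpha> k / fact (\<alpha> k))"
    by (simp add: poisson_def prod.distrib[symmetric])
  also have "(\<Prod>k=1..d. exp (- (cmod (C k) * ln (real n)))) = real n powr (- (\<Sum>k=1..d. cmod (C k)))"
    unfolding exp_sum[OF finite_atLeastAtMost, symmetric] sum_negf sum_distrib_right[symmetric]
    using assms by (simp add: powr_def)
  finally have p: "(\<Prod>k=1..d. poisson (cmod (C k) * ln (real n)) (\<alpha> k)) = real n powr (- (\<Sum>k=1..d. cmod (C k)))
     * (\<Prod>k=1..d. (cmod (C k) * ln (real n)) ^ \<alpha> k / fact (\<alpha> k))" .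
  have "real n powr (-1 - gap) * real n powr (- (\<Sum>k=1..d. cmod (C k))) = real n powr (- Re c\<^sub>1) * real n powr (-1/2)"
    by (simp add: powr_add[symmetric] gap_def)
  then show ?thesis
    unfolding p symbol_matrix_monomial[OF assms(2,1)] norm_entry[OF assms(1)] by (simp add: mult_ac)
qed

lemma poisson_C:
  assumes "n \<noteq> (0::nat)"
  shows "0 \<le> poisson (cmod (C k) * ln (real n)) a" "poisson (cmod (C k) * ln (real n)) a \<le> 1"
  using assms by (auto intro!: poisson_nonneg poisson_le_1)

text \<open>Poisson weights with index outside \<open>K\<close> are at most \<open>1\<close> and can be dropped. The remaining ones are
  compared with a summable majorant \<open>B\<close>, the factor \<open>c\<close> carrying the decay in \<open>\<alpha>\<close>.\<close>

lemma row_bound: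
  assumes \<alpha>: "\<alpha> \<in> exponents" and K: "K \<subseteq> {1..d}" and c: "0 \<le> c"
    and B: "B summable_on UNIV" "\<And>n. 0 \<le> B n"
    and le: "\<And>n. n \<noteq> 0 \<Longrightarrow> real n powr (-1 - gap) * (\<Prod>k\<in>K. poisson (cmod (C k) * ln (real n)) (\<alpha> k)) \<le> c * B n"
  shows "(\<lambda>n. cmod (symbol_matrix (monomial \<alpha>) n) * real n powr (-1/2)) summable_on UNIV"
    and "row_weight (monomial \<alpha>) \<le> c * infsum B UNIV"
proof -
  have *: "cmod (symbol_matrix (monomial \<alpha>) n) * real n powr (-1/2) \<le> c * B n" for n
  proof (cases "n = 0")
    case False
    have "(\<Prod>k=1..d. poisson (cmod (C k) * ln (real n)) (\<alpha> k)) \<le> (\<Prod>k\<in>K. poisson (cmod (C k) * ln (real n)) (\<alpha> k))"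
    proof -
      have "(\<Prod>k=1..d. poisson (cmod (C k) * ln (real n)) (\<alpha> k)) = (\<Prod>k\<in>{1..d} - K. poisson (cmod (C k) * ln (real n)) (\<alpha> k)) * (\<Prod>k\<in>K. poisson (cmod (C k) * ln (real n)) (\<alpha> k))"
        using K by (intro prod.subset_diff) auto
      also have "\<dots> \<le> 1 * (\<Prod>k\<in>K. poisson (cmod (C k) * ln (real n)) (\<alpha> k))"
        using poisson_C[OF False] by (intro mult_right_mono prod_le_1 prod_nonneg) auto
      finally show ?thesis by simp
    qed
    then have "real n powr (-1 - gap) * (\<Prod>k=1..d. poisson (cmod (C k) * ln (real n)) (\<alpha> k))
       \<le> real n powr (-1 - gap) * (\<Prod>k\<in>K. poisson (cmod (C k) * ln (real n)) (\<alpha> k))"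
      by (intro mult_left_mono) auto
    then show ?thesis
      unfolding row_term[OF False \<alpha>] using le[OF False] by linarith
  qed (simp add: B(2) c)
  have S: "(\<lambda>n. c * B n) summable_on UNIV"
    using B by (intro summable_on_cmult_right)
  show S': "(\<lambda>n. cmod (symbol_matrix (monomial \<alpha>) n) * real n powr (-1/2)) summable_on UNIV"
    by (rule summable_on_comparison_test[OF S]) (use * in auto)
  have "row_weight (monomial \<alpha>) \<le> (\<Sum>\<^sub>\<infinity>n. c * B n)"
    unfolding row_weight_def by (rule infsum_mono[OF S' S *])
  then show "row_weight (monomial \<alpha>) \<le> c * infsum B UNIV"
    by (simp add: infsum_cmult_right')
qed

lemma harmonic_summand_nonneg: "0 \<le> real n powr (-1) * poisson (cmod (C k) * ln (real n)) a"
  using poisson_C(1)[of n k a] by (cases "n = 0") auto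

lemma gap_powr_summable: "0 < gap \<Longrightarrow> (\<lambda>n. real n powr (-1 - gap)) summable_on UNIV"
  by (simp add: summable_on_UNIV_nonneg_real_iff summable_real_powr_iff)

lemma powr_gap_le: "n \<noteq> 0 \<Longrightarrow> real n powr (-1 - gap) \<le> real n powr (-1)"
  using gap_nonneg by (intro powr_mono) auto

text \<open>A single Poisson weight, or else the gap, makes the row sum converge.\<close>

lemma row_bounded:
  obtains M where "\<And>\<alpha>. \<alpha> \<in> exponents \<Longrightarrow>
      (\<lambda>n. cmod (symbol_matrix (monomial \<alpha>) n) * real n powr (-1/2)) summable_on UNIV \<and> row_weight (monomial \<alpha>) \<le> M"
proof (cases "d = 0")
  case True
  then have "0 < gap"
    unfolding gap_def using degenerate_condition by simp
  then have "(\<lambda>n. cmod (symbol_matrix (monomial \<alpha>) n) * real n powr (-1/2)) summable_on UNIV \<and>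
     row_weight (monomial \<alpha>) \<le> 1 * (\<Sum>\<^sub>\<infinity>n. real n powr (-1 - gap))" if "\<alpha> \<in> exponents" for \<alpha>
    using row_bound[OF that, of "{}" 1 "\<lambda>n. real n powr (-1 - gap)"] gap_powr_summable by simp
  then show ?thesis
    using that by blast
next
  case False
  then have 1: "1 \<in> {1..d}" by simp
  have "(\<lambda>n. cmod (symbol_matrix (monomial \<alpha>) n) * real n powr (-1/2)) summable_on UNIV \<and>
     row_weight (monomial \<alpha>) \<le> 2 powr (cmod (C 1) + 1) / cmod (C 1)" if \<alpha>: "\<alpha> \<in> exponents" for \<alpha>
  proof -
    let ?B = "\<lambda>n. real n powr (-1) * poisson (cmod (C 1) * ln (real n)) (\<alpha> 1)"
    have C1: "0 < cmod (C 1)"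
      using C_ne_0[OF 1] by simp
    have "real n powr (-1 - gap) * (\<Prod>k\<in>{1}. poisson (cmod (C k) * ln (real n)) (\<alpha> k)) \<le> 1 * ?B n" if "n \<noteq> 0" for n
      using mult_right_mono[OF powr_gap_le[OF that] poisson_C(1)[OF that, of 1 "\<alpha> 1"]] by simp
    from row_bound[OF \<alpha>, of "{1}" 1 ?B, OF _ _ harmonic_poisson_sum(1)[OF C1] harmonic_summand_nonneg this] 1
      harmonic_poisson_sum(2)[OF C1, of "\<alpha> 1"]
    show ?thesis by auto
  qed
  then show ?thesis
    using that by blast
qed

lemma schur_symbol_matrix: "schur_matrix symbol_matrix row_weight"
proof -
  obtain M where M: "\<And>\<alpha>. \<alpha> \<in> exponents \<Longrightarrow>
      (\<lambda>n. cmod (symbol_matrix (monomial \<alpha>) n) * real n powr (-1/2)) summable_on UNIV \<and> row_weight (monomial \<alpha>) \<le> M"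
    by (rule row_bounded) (rule that)
  have row: "(\<lambda>n. cmod (symbol_matrix m n) * real n powr (-1/2)) summable_on UNIV \<and> row_weight m \<le> max M 0" for m
  proof (cases "m \<in> monomial ` exponents")
    case True
    then show ?thesis
      using M by fastforce
  next
    case False
    then show ?thesis
      by (simp add: symbol_matrix_eq_0 row_weight_def)
  qed
  have 0: "0 \<notin> monomial ` exponents"
    using monomial_pos by (metis imageE less_irrefl)
  show ?thesis
    unfolding schur_matrix_def
  proof (intro conjI allI impI)
    fix m n :: nat
    show "m = 0 \<or> n = 0 \<Longrightarrow> symbol_matrix m n = 0"
      using 0 symbol_matrix_eq_0 by metis
    show "(\<lambda>m. cmod (symbol_matrix m n)) summable_on UNIV"
      by (cases "n = 0") (simp_all add: symbol_matrix_eq_0 symbol_matrix_column_norm)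
    show "(\<Sum>\<^sub>\<infinity>m. cmod (symbol_matrix m n)) \<le> real n powr (-1/2)"
      by (cases "n = 0") (simp_all add: symbol_matrix_eq_0 symbol_matrix_column_norm(2)[simplified])
    show "(\<Sum>\<^sub>\<infinity>n. cmod (symbol_matrix m n) * real n powr (-1/2)) \<le> row_weight m"
      by (simp add: row_weight_def)
  qed (use row in blast)+
qed

text \<open>The weight of index \<open>k\<close> yields the decay. Summability in \<open>n\<close> then has to come from somewhere
  else: from the gap, or from the weight of a second index \<open>j\<close>. This is why a single frequency
  without gap is exceptional.\<close>

lemma row_decay:
  assumes "2 \<le> d \<or> 0 < gap"
  obtains M where "\<And>\<alpha> k. \<alpha> \<in> exponents \<Longrightarrow> k \<in> {1..d} \<Longrightarrow>
      row_weight (monomial \<alpha>) \<le> sqrt (1 / sqrt (2 * real (\<alpha> k) + 1)) * M"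
proof (cases "0 < gap")
  case True
  let ?M = "(\<Sum>\<^sub>\<infinity>n. real n powr (-1 - gap))"
  show ?thesis
  proof (rule that[of ?M])
    fix \<alpha> k assume \<alpha>: "\<alpha> \<in> exponents" and k: "k \<in> {1..d}"
    show "row_weight (monomial \<alpha>) \<le> sqrt (1 / sqrt (2 * real (\<alpha> k) + 1)) * ?M"
    proof (rule row_bound(2)[OF \<alpha>, of "{k}"])
      fix n :: nat assume n: "n \<noteq> 0"
      have "poisson (cmod (C k) * ln (real n)) (\<alpha> k) \<le> sqrt (1 / sqrt (2 * real (\<alpha> k) + 1))"
        using n by (intro poisson_le) auto
      then show "real n powr (-1 - gap) * (\<Prod>k\<in>{k}. poisson (cmod (C k) * ln (real n)) (\<alpha> k))
          \<le> sqrt (1 / sqrt (2 * real (\<alpha> k) + 1)) * real n powr (-1 - gap)"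
        using mult_left_mono[of _ _ "real n powr (-1 - gap)"] by (simp add: mult.commute[of "sqrt _"])
    qed (use k gap_powr_summable[OF True] in auto)
  qed
next
  case False
  then have d: "2 \<le> d" using assms by simp
  define D where "D j = 2 powr (cmod (C j) + 1) / cmod (C j)" for j
  have D0: "0 \<le> D j" for j by (simp add: D_def)
  show ?thesis
  proof (rule that[of "\<Sum>j=1..d. D j"])
    fix \<alpha> k assume \<alpha>: "\<alpha> \<in> exponents" and k: "k \<in> {1..d}"
    obtain j where j: "j \<in> {1..d}" "j \<noteq> k"
    proof (cases "k = 1")
      case True
      then show ?thesis using that[of 2] d by auto
    qed (use that[of 1] d in auto)
    let ?B = "\<lambda>n. real n powr (-1) * poisson (cmod (C j) * ln (real n)) (\<alpha> j)"
    have Cj: "0 < cmod (C j)"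
      using C_ne_0[OF j(1)] by simp
    have "row_weight (monomial \<alpha>) \<le> sqrt (1 / sqrt (2 * real (\<alpha> k) + 1)) * infsum ?B UNIV"
    proof (rule row_bound(2)[OF \<alpha>, of "{j, k}"])
      fix n :: nat assume n: "n \<noteq> 0"
      have "poisson (cmod (C k) * ln (real n)) (\<alpha> k) \<le> sqrt (1 / sqrt (2 * real (\<alpha> k) + 1))"
        using n by (intro poisson_le) auto
      then have "real n powr (-1 - gap) * poisson (cmod (C j) * ln (real n)) (\<alpha> j) * poisson (cmod (C k) * ln (real n)) (\<alpha> k)
          \<le> ?B n * sqrt (1 / sqrt (2 * real (\<alpha> k) + 1))"
        using poisson_C[OF n] powr_gap_le[OF n] by (intro mult_mono mult_nonneg_nonneg) auto
      then show "real n powr (-1 - gap) * (\<Prod>k\<in>{j, k}. poisson (cmod (C k) * ln (real n)) (\<alpha> k))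
          \<le> sqrt (1 / sqrt (2 * real (\<alpha> k) + 1)) * ?B n"
        using j by (simp add: mult_ac)
    qed (use j k harmonic_poisson_sum(1)[OF Cj] harmonic_summand_nonneg in auto)
    also have "infsum ?B UNIV \<le> D j"
      unfolding D_def by (rule harmonic_poisson_sum(2)[OF Cj])
    also have "D j \<le> (\<Sum>j=1..d. D j)"
      using j D0 by (intro member_le_sum) auto
    finally show "row_weight (monomial \<alpha>) \<le> sqrt (1 / sqrt (2 * real (\<alpha> k) + 1)) * (\<Sum>j=1..d. D j)"
      by (simp add: mult_left_mono)
  qed
qed

text \<open>A large row index has a large exponent.\<close>

lemma row_weight_tendsto_0:
  assumes "2 \<le> d \<or> 0 < gap"
  shows "row_weight \<longlonglongrightarrow> 0"
proof (rule LIMSEQ_I)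
  fix e :: real assume e: "0 < e"
  obtain M where M: "\<And>\<alpha> k. \<alpha> \<in> exponents \<Longrightarrow> k \<in> {1..d} \<Longrightarrow>
      row_weight (monomial \<alpha>) \<le> sqrt (1 / sqrt (2 * real (\<alpha> k) + 1)) * M"
    by (rule row_decay[OF assms]) (rule that)
  have "(\<lambda>a. sqrt (1 / sqrt (2 * real a + 1)) * M) \<longlonglongrightarrow> 0"
    using tendsto_mult_right[OF poisson_sup_tendsto_0, of M] by simp
  then have "\<forall>\<^sub>F a in sequentially. sqrt (1 / sqrt (2 * real a + 1)) * M < e"
    by (rule order_tendstoD) (fact e)
  then obtain L where L: "\<And>a. a \<ge> L \<Longrightarrow> sqrt (1 / sqrt (2 * real a + 1)) * M < e"
    by (auto simp: eventually_sequentially)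
  define m\<^sub>0 where "m\<^sub>0 = (\<Prod>k=1..d. q k ^ L)"
  have "norm (row_weight m - 0) < e" if m: "m \<ge> Suc m\<^sub>0" for m
  proof (cases "m \<in> monomial ` exponents")
    case True
    then obtain \<alpha> where \<alpha>: "\<alpha> \<in> exponents" "m = monomial \<alpha>" by auto
    have "\<exists>k\<in>{1..d}. L \<le> \<alpha> k"
    proof (rule ccontr)
      assume "\<not> ?thesis"
      then have "monomial \<alpha> \<le> m\<^sub>0"
        unfolding monomial_def m\<^sub>0_def using q_ge_2 by (intro prod_mono conjI power_increasing) (force simp del: One_nat_def)+
      with m \<alpha> show False by simp
    qed
    then obtain k where k: "k \<in> {1..d}" "L \<le> \<alpha> k" by blast
    have "row_weight m < e"
      unfolding \<alpha>(2) using M[OF \<alpha>(1) k(1)] L[OF k(2)] by (rule le_less_trans)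
    then show ?thesis
      using schur_matrix_nonneg[OF schur_symbol_matrix, of m] by simp
  qed (use e in \<open>simp add: row_weight_def symbol_matrix_eq_0\<close>)
  then show "\<exists>m\<^sub>0. \<forall>m\<ge>m\<^sub>0. norm (row_weight m - 0) < e"
    by blast
qed

lemma represents_symbol:
  assumes "\<phi> ` half_plane (1/2) \<subseteq> half_plane (1/2)" "\<And>s. s \<in> half_plane (1/2) \<Longrightarrow> \<phi> s = symbol s"
  shows "represents_composition symbol_matrix \<phi>"
  using assms symbol_matrix_column by (auto simp: represents_composition_def)

end

declare One_nat_def [simp]

section \<open>The Gordon-Hedenmalm condition for linear symbols\<close>

text \<open>The factor \<open>1 / (2 * pi)\<close> is the normalisation of Kronecker's theorem, which measures phases in
  full turns.\<close>

lemma ln_independent_over_int: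
  assumes ind: "multiplicatively_independent d q"
  defines "\<theta> \<equiv> \<lambda>i. ln (real (q (Suc i))) / (2 * pi)"
  shows "inj_on \<theta> {..<d}" and "module.independent (\<lambda>r. (*) (real_of_int r)) (\<theta> ` {..<d})"
proof -
  have pos: "0 < q k" if "k \<in> {1..d}" for k
    using ind that by (simp add: multiplicatively_independent_def)
  have ind': "a k = 0" if "(\<Sum>i<d. real_of_int (a (Suc i)) * \<theta> i) = 0" "k \<in> {1..d}" for a :: "nat \<Rightarrow> int" and k
  proof -
    have "(\<Sum>k=1..d. real_of_int (a k) * ln (real (q k))) = 2 * pi * (\<Sum>i<d. real_of_int (a (Suc i)) * \<theta> i)"
      unfolding sum_distrib_left by (rule sum.reindex_bij_witness[of _ Suc "\<lambda>k. k - 1"]) (auto simp: \<theta>_def)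
    then have "(\<Sum>k=1..d. real_of_int (a k) * ln (real (q k))) = 0"
      using that by simp
    then have "1 = exp (\<Sum>k=1..d. real_of_int (a k) * ln (real (q k)))"
      by simp
    also have "\<dots> = (\<Prod>k=1..d. real (q k) powi a k)"
      unfolding exp_sum[OF finite_atLeastAtMost]
    proof (rule prod.cong)
      fix k assume "k \<in> {1..d}"
      then show "exp (real_of_int (a k) * ln (real (q k))) = real (q k) powi a k"
        using pos[of k] powr_real_of_int'[of "real (q k)" "a k"] by (simp add: powr_def)
    qed simp
    finally show ?thesis
      using ind that(2) unfolding multiplicatively_independent_def by metis
  qed
  show inj: "inj_on \<theta> {..<d}"
  proof (rule inj_onI, rule ccontr)
    fix i j assume ij: "i \<in> {..<d}" "j \<in> {..<d}" "\<theta> i = \<theta> j" "i \<noteq> j"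
    define a :: "nat \<Rightarrow> int" where "a k = (if k = Suc i then 1 else 0) - (if k = Suc j then 1 else 0)" for k
    have "(\<Sum>l<d. real_of_int (a (Suc l)) * \<theta> l) = (\<Sum>l<d. (if l = i then \<theta> i else 0) - (if l = j then \<theta> j else 0))"
      by (intro sum.cong) (auto simp: a_def)
    also have "\<dots> = 0"
      using ij by (simp add: sum_subtractf)
    finally have "a (Suc i) = 0"
      using ij by (intro ind') auto
    with ij show False
      by (simp add: a_def)
  qed
  interpret M: Modules.module "(\<lambda>r. (*) (real_of_int r))"
    by (simp add: Modules.module.intro distrib_left mult.commute)
  show "M.independent (\<theta> ` {..<d})"
    unfolding M.independent_explicit_module
  proof (intro allI impI)
    fix t and u :: "real \<Rightarrow> int" and v
    assume t: "finite t" "t \<subseteq> \<theta> ` {..<d}" "(\<Sum>v\<in>t. real_of_int (u v) * v) = 0" "v \<in> t"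
    obtain i where i: "i < d" "v = \<theta> i"
      using t by auto
    define a :: "nat \<Rightarrow> int" where "a k = (if \<theta> (k - 1) \<in> t then u (\<theta> (k - 1)) else 0)" for k
    have "(\<Sum>l<d. real_of_int (a (Suc l)) * \<theta> l) = (\<Sum>l\<in>{..<d}. if \<theta> l \<in> t then real_of_int (u (\<theta> l)) * \<theta> l else 0)"
      by (intro sum.cong) (auto simp: a_def)
    also have "\<dots> = (\<Sum>v\<in>\<theta> ` {..<d}. if v \<in> t then real_of_int (u v) * v else 0)"
      by (simp add: sum.reindex[OF inj])
    also have "\<dots> = (\<Sum>v\<in>t. real_of_int (u v) * v)"
      using t(2) by (simp add: sum.inter_restrict[symmetric] Int_absorb1)
    finally have "a (Suc i) = 0"
      using t(3) i by (intro ind') auto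
    then show "u v = 0"
      using i t(4) by (simp add: a_def)
  qed
qed

text \<open>Kronecker's theorem moves the numbers \<open>C\<^sub>k q\<^sub>k^(-it)\<close> simultaneously close to \<open>- |C\<^sub>k|\<close>.\<close>

lemma phases_opposite:
  assumes ind: "multiplicatively_independent d q" and e: "0 < e"
  obtains t :: real where
    "\<And>k. k \<in> {1..d} \<Longrightarrow> Re (C k * exp (- \<i> * of_real (t * ln (real (q k))))) \<le> - (1 - e) * cmod (C k)"
proof -
  define \<theta> where "\<theta> = (\<lambda>i. ln (real (q (Suc i))) / (2 * pi))"
  have "isCont cos (0::real)" by simp
  then obtain \<delta> where \<delta>: "0 < \<delta>" "\<And>y. \<bar>y\<bar> < \<delta> \<Longrightarrow> \<bar>cos y - 1\<bar> < e"
    using e unfolding continuous_at_eps_delta by (auto simp: dist_real_def)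
  define \<alpha> where "\<alpha> i = (Arg (C (Suc i)) - pi) / (2 * pi)" for i
  have "0 < \<delta> / (2 * pi)" using \<delta> by simp
  then obtain t and h :: "nat \<Rightarrow> int" where th: "\<And>i. i < d \<Longrightarrow> \<bar>t * \<theta> i - of_int (h i) - \<alpha> i\<bar> < \<delta> / (2 * pi)"
    using Kronecker_thm_1[of \<theta> d "\<delta> / (2 * pi)" \<alpha>] ln_independent_over_int[OF ind] unfolding \<theta>_def by metis
  show ?thesis
  proof (rule that[of t])
    fix k assume k: "k \<in> {1..d}"
    define i where "i = k - 1"
    have i: "i < d" "k = Suc i" using k by (auto simp: i_def)
    define y where "y = 2 * pi * (t * \<theta> i - of_int (h i) - \<alpha> i)"
    have "\<bar>y\<bar> = 2 * pi * \<bar>t * \<theta> i - of_int (h i) - \<alpha> i\<bar>"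
      by (simp add: y_def abs_mult)
    also have "\<dots> < 2 * pi * (\<delta> / (2 * pi))"
      using th[OF i(1)] by (intro mult_strict_left_mono) auto
    finally have "\<bar>y\<bar> < \<delta>" by simp
    from \<delta>(2)[OF this] have cos_y: "cos y \<ge> 1 - e" by linarith
    have arg: "Arg (C k) - t * ln (real (q k)) = pi - y - 2 * pi * of_int (h i)"
      by (simp add: y_def \<theta>_def \<alpha>_def i field_simps)
    have "C k * exp (- \<i> * of_real (t * ln (real (q k)))) = of_real (cmod (C k)) * exp (\<i> * of_real (Arg (C k) - t * ln (real (q k))))"
      using Arg_eq[of "C k"] by (cases "C k = 0") (simp_all add: exp_diff exp_minus algebra_simps divide_inverse)
    then have "Re (C k * exp (- \<i> * of_real (t * ln (real (q k))))) = cmod (C k) * cos (Arg (C k) - t * ln (real (q k)))"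
      by (simp add: Re_exp)
    also have "cos (Arg (C k) - t * ln (real (q k))) = - cos y"
      unfolding arg cos_diff[of "pi - y"] cos_int_2pin sin_int_2pin by (simp add: cos_diff)
    also have "cmod (C k) * - cos y \<le> - (1 - e) * cmod (C k)"
      using mult_left_mono[OF cos_y, of "cmod (C k)"] by (simp add: algebra_simps)
    finally show "Re (C k * exp (- \<i> * of_real (t * ln (real (q k))))) \<le> - (1 - e) * cmod (C k)" .
  qed
qed

lemma dirichlet_series_uniform_limit:
  assumes "uniformly_convergent_on S (dirichlet_partial_sum c)"
  shows "uniform_limit S (dirichlet_partial_sum c) (dirichlet_series c) sequentially"
proof -
  have "lim (\<lambda>m. dirichlet_partial_sum c m s) = dirichlet_series c s" for s
  proof -
    have "(\<Sum>k<m. c (Suc k) * of_nat (Suc k) powr (- s)) = dirichlet_partial_sum c m s" for m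
      unfolding dirichlet_partial_sum_def
      by (rule sum.reindex_bij_witness[of _ "\<lambda>k. k - 1" Suc]) auto
    then show ?thesis
      by (simp add: dirichlet_series_def suminf_eq_lim del: of_nat_Suc)
  qed
  then show ?thesis
    using assms by (simp add: uniformly_convergent_uniform_limit_iff)
qed

lemma open_half_plane: "open (half_plane \<theta>)"
  unfolding half_plane_def by (rule open_halfspace_Re_gt)

lemma dirichlet_series_holomorphic:
  assumes "\<And>\<epsilon>. 0 < \<epsilon> \<Longrightarrow> uniformly_convergent_on (half_plane \<epsilon>) (dirichlet_partial_sum c)"
  shows "dirichlet_series c holomorphic_on half_plane 0"
proof (rule holomorphic_uniform_sequence[OF open_half_plane])
  show "dirichlet_partial_sum c m holomorphic_on half_plane 0" for m
    unfolding dirichlet_partial_sum_def by (auto intro!: holomorphic_intros)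
  fix s assume s: "s \<in> half_plane 0"
  define r where "r = Re s / 2"
  have r: "0 < r" using s by (simp add: r_def half_plane_def)
  have "cball s (r / 2) \<subseteq> half_plane r"
  proof
    fix z assume "z \<in> cball s (r / 2)"
    then have "\<bar>Re (s - z)\<bar> \<le> r / 2"
      using abs_Re_le_cmod[of "s - z"] by (simp add: dist_norm)
    then show "z \<in> half_plane r"
      using r abs_ge_self[of "Re (s - z)"] by (simp add: half_plane_def r_def)
  qed
  moreover have "half_plane r \<subseteq> half_plane 0"
    using r by (auto simp: half_plane_def)
  ultimately show "\<exists>d>0. cball s d \<subseteq> half_plane 0 \<and> uniform_limit (cball s d) (dirichlet_partial_sum c) (dirichlet_series c) sequentially"
    using r uniform_limit_on_subset[OF dirichlet_series_uniform_limit[OF assms[OF r]]]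
    by (intro exI[of _ "r / 2"]) auto
qed

text \<open>A uniform limit of bounded partial sums. It excludes a positive characteristic for a bounded
  symbol.\<close>

lemma dirichlet_series_bounded:
  assumes "uniformly_convergent_on (half_plane \<epsilon>) (dirichlet_partial_sum c)" "0 \<le> \<epsilon>"
  obtains B where "\<And>s. s \<in> half_plane \<epsilon> \<Longrightarrow> cmod (dirichlet_series c s) \<le> B"
proof -
  have "\<forall>\<^sub>F m in sequentially. \<forall>s\<in>half_plane \<epsilon>. dist (dirichlet_partial_sum c m s) (dirichlet_series c s) < 1"
    using uniform_limitD[OF dirichlet_series_uniform_limit[OF assms(1)], of 1] by simp
  then obtain m where m: "\<And>s. s \<in> half_plane \<epsilon> \<Longrightarrow> dist (dirichlet_partial_sum c m s) (dirichlet_series c s) < 1"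
    by (auto simp: eventually_sequentially)
  show ?thesis
  proof (rule that[of "1 + (\<Sum>n=1..m. cmod (c n))"])
    fix s assume s: "s \<in> half_plane \<epsilon>"
    have "cmod (dirichlet_partial_sum c m s) \<le> (\<Sum>n=1..m. cmod (c n))"
      unfolding dirichlet_partial_sum_def
    proof (rule sum_norm_le)
      fix n assume n: "n \<in> {1..m}"
      have "real n powr (- Re s) \<le> real n powr 0"
        using n s assms(2) by (intro powr_mono) (auto simp: half_plane_def)
      then have "real n powr (- Re s) \<le> 1"
        using n by simp
      then show "cmod (c n * of_nat n powr (- s)) \<le> cmod (c n)"
        using mult_left_mono[of "real n powr (- Re s)" 1 "cmod (c n)"] by (simp add: norm_mult norm_powr_real_powr)
    qed
    then show "cmod (dirichlet_series c s) \<le> 1 + (\<Sum>n=1..m. cmod (c n))"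
      using m[OF s] norm_triangle_ineq2[of "dirichlet_series c s" "dirichlet_partial_sum c m s"]
      by (simp add: dist_norm norm_minus_commute)
  qed
qed

text \<open>The series in the Gordon-Hedenmalm class need not be given by the same coefficients as the linear
  symbol. The characteristic is \<open>0\<close> because the symbol is bounded; then analytic continuation
  identifies both functions on \<open>half_plane 0\<close>. There the symbol comes arbitrarily close to the real
  part \<open>Re c\<^sub>1 - \<Sum>k. |C\<^sub>k|\<close>.\<close>

lemma linear_symbol_data:
  assumes "linear_symbol 0 \<phi>"
  obtains c\<^sub>1 d q C where "linear_data c\<^sub>1 d q C" "\<phi> ` half_plane (1/2) \<subseteq> half_plane (1/2)"
    "\<And>s. s \<in> half_plane (1/2) \<Longrightarrow> \<phi> s = c\<^sub>1 + (\<Sum>k=1..d. C k * of_nat (q k) powr (-s))"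
proof -
  obtain a :: "nat \<Rightarrow> complex" and d q where ind: "multiplicatively_independent d q"
    and nz: "\<forall>k\<in>{1..d}. q k \<noteq> 1 \<and> a (q k) \<noteq> 0"
    and \<phi>: "\<forall>s\<in>half_plane (1/2). \<phi> s = of_nat 0 * s + a 1 + (\<Sum>k=1..d. a (q k) * of_nat (q k) powr (-s))"
    using assms unfolding linear_symbol_def by blast
  have GH: "\<phi> \<in> gordon_hedenmalm"
    using assms by (simp add: linear_symbol_def)
  define C where "C k = a (q k)" for k
  define \<psi> where "\<psi> s = a 1 + (\<Sum>k=1..d. C k * of_nat (q k) powr (-s))" for s
  have \<phi>_eq: "\<phi> s = \<psi> s" if "s \<in> half_plane (1/2)" for s
    using \<phi> that by (simp add: \<psi>_def C_def)
  have q2: "2 \<le> q k" if "k \<in> {1..d}" for k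
    using ind nz that unfolding multiplicatively_independent_def by (metis One_nat_def Suc_1 Suc_leI le_neq_implies_less)
  from GH obtain c0 :: nat and c where maps: "\<phi> ` half_plane (1/2) \<subseteq> half_plane (1/2)"
    and \<phi>c: "\<forall>s\<in>half_plane (1/2). \<phi> s = of_nat c0 * s + dirichlet_series c s"
    and unif: "\<forall>\<epsilon>>0. uniformly_convergent_on (half_plane \<epsilon>) (dirichlet_partial_sum c)"
    and zero: "c0 = 0 \<longrightarrow> dirichlet_series c ` half_plane 0 \<subseteq> half_plane (1/2)"
    unfolding gordon_hedenmalm_def mem_Collect_eq by (elim exE conjE) (rule that)
  have "c0 = 0"
  proof -
    \<comment> \<open>Otherwise \<open>c0 * s\<close> would be bounded on the half plane, contrary to the point \<open>x\<close>.\<close>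
    obtain B where B: "\<And>s. s \<in> half_plane (1/2) \<Longrightarrow> cmod (dirichlet_series c s) \<le> B"
      by (rule dirichlet_series_bounded[OF unif[rule_format, of "1/2"]]) (simp, simp, rule that)
    define D where "D = cmod (a 1) + (\<Sum>k=1..d. cmod (C k))"
    define x where "x = B + D + 1"
    have \<psi>_le: "cmod (\<psi> s) \<le> D" if "s \<in> half_plane (1/2)" for s
    proof -
      have "cmod (\<Sum>k=1..d. C k * of_nat (q k) powr (-s)) \<le> (\<Sum>k=1..d. cmod (C k))"
      proof (rule sum_norm_le)
        fix k assume k: "k \<in> {1..d}"
        have "real (q k) powr (- Re s) \<le> real (q k) powr 0"
          using q2[OF k] that by (intro powr_mono) (auto simp: half_plane_def)
        then have "real (q k) powr (- Re s) \<le> 1"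
          using q2[OF k] by simp
        then show "cmod (C k * of_nat (q k) powr (-s)) \<le> cmod (C k)"
          using mult_left_mono[of "real (q k) powr (- Re s)" 1 "cmod (C k)"] by (simp add: norm_mult norm_powr_real_powr)
      qed
      then show ?thesis
        unfolding \<psi>_def D_def by (intro order_trans[OF norm_triangle_ineq]) simp
    qed
    have one: "1 \<in> half_plane (1/2)" by (simp add: half_plane_def)
    have "0 \<le> B" "0 \<le> D"
      using order_trans[OF norm_ge_zero B[OF one]] order_trans[OF norm_ge_zero \<psi>_le[OF one]] by auto
    then have x: "of_real x \<in> half_plane (1/2)" "0 < x"
      by (auto simp: x_def half_plane_def)
    have "of_nat c0 * of_real x = \<psi> (of_real x) - dirichlet_series c (of_real x)"
      using \<phi>c \<phi>_eq x by (metis add_diff_cancel_right')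
    then have "cmod (of_nat c0 * of_real x) \<le> D + B"
      using norm_triangle_le_diff[OF add_mono[OF \<psi>_le B]] x by simp
    then have "real c0 * x \<le> D + B"
      using x(2) by (simp add: norm_mult)
    then have "real c0 * x < 1 * x"
      by (simp add: x_def)
    then have "real c0 < 1"
      using x(2) by (simp only: mult_less_cancel_right_pos)
    then show ?thesis
      by simp
  qed
  have Re_\<psi>: "1/2 < Re (\<psi> s)" if s: "s \<in> half_plane 0" for s
  proof -
    have "dirichlet_series c s = \<psi> s"
    proof (rule analytic_continuation_open[where s="half_plane (1/2)" and s'="half_plane 0"
          and f="dirichlet_series c" and g=\<psi>, OF open_half_plane open_half_plane])
      show "half_plane (1/2) \<noteq> {}"
        by (auto simp: half_plane_def intro!: exI[of _ 1])
      show "connected (half_plane 0)"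
        unfolding half_plane_def by (intro convex_connected convex_halfspace_Re_gt)
      show "half_plane (1/2) \<subseteq> half_plane 0"
        by (auto simp: half_plane_def)
      show "dirichlet_series c holomorphic_on half_plane 0"
        using unif by (intro dirichlet_series_holomorphic) auto
      have "of_nat (q k) \<noteq> (0::complex)" if "k \<in> {1..d}" for k
        using q2[OF that] by auto
      then show "\<psi> holomorphic_on half_plane 0"
        unfolding \<psi>_def by (intro holomorphic_intros) auto
      show "dirichlet_series c z = \<psi> z" if "z \<in> half_plane (1/2)" for z
        using \<phi>c \<phi>_eq that \<open>c0 = 0\<close> by simp
    qed (fact s)
    moreover have "dirichlet_series c s \<in> half_plane (1/2)"
      using zero \<open>c0 = 0\<close> s by blast
    ultimately show ?thesis
      by (simp add: half_plane_def)
  qed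
  have approx: "1/2 \<le> Re (a 1) - (1 - e) * (\<Sum>k=1..d. cmod (C k) * real (q k) powr (-e))" if e: "0 < e" for e
  proof -
    obtain t where t: "\<And>k. k \<in> {1..d} \<Longrightarrow> Re (C k * exp (- \<i> * of_real (t * ln (real (q k))))) \<le> - (1 - e) * cmod (C k)"
      by (rule phases_opposite[OF ind e, of C]) (rule that)
    \<comment> \<open>The same \<open>e\<close> serves as real part and as tolerance for the phases.\<close>
    have "1/2 < Re (\<psi> (Complex e t))"
      using e by (intro Re_\<psi>) (simp add: half_plane_def)
    also have "\<dots> = Re (a 1) + (\<Sum>k=1..d. Re (C k * of_nat (q k) powr (- Complex e t)))"
      by (simp add: \<psi>_def)
    also have "(\<Sum>k=1..d. Re (C k * of_nat (q k) powr (- Complex e t))) \<le> (\<Sum>k=1..d. - (1 - e) * (cmod (C k) * real (q k) powr (-e)))"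
    proof (rule sum_mono)
      fix k assume k: "k \<in> {1..d}"
      have "of_nat (q k) powr (- Complex e t) = exp (of_real (- e * ln (real (q k))) + (- \<i> * of_real (t * ln (real (q k)))))"
        using q2[OF k] by (simp add: powr_def Ln_of_nat Complex_eq algebra_simps)
      also have "\<dots> = of_real (real (q k) powr (-e)) * exp (- \<i> * of_real (t * ln (real (q k))))"
        unfolding exp_add using q2[OF k] by (simp add: powr_def exp_of_real[symmetric])
      finally have "Re (C k * of_nat (q k) powr (- Complex e t)) = real (q k) powr (-e) * Re (C k * exp (- \<i> * of_real (t * ln (real (q k)))))"
        by (simp only: scaleR_conv_of_real[symmetric] mult_scaleR_right scaleR_complex.sel)
      also have "\<dots> \<le> real (q k) powr (-e) * (- (1 - e) * cmod (C k))"
        by (intro mult_left_mono t k) auto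
      finally show "Re (C k * of_nat (q k) powr (- Complex e t)) \<le> - (1 - e) * (cmod (C k) * real (q k) powr (-e))"
        by (simp only: mult_ac)
    qed
    finally have "1/2 < Re (a 1) + - ((1 - e) * (\<Sum>k=1..d. cmod (C k) * real (q k) powr (-e)))"
      by (simp only: sum_distrib_left sum_negf mult_minus_left)
    then show ?thesis
      by linarith
  qed
  have "((\<lambda>e. Re (a 1) - (1 - e) * (\<Sum>k=1..d. cmod (C k) * real (q k) powr (-e))) \<longlongrightarrow>
      Re (a 1) - (1 - 0) * (\<Sum>k=1..d. cmod (C k) * real (q k) powr (-0))) (at_right 0)"
    using q2 by (intro tendsto_intros tendsto_powr) force+
  then have "1/2 \<le> Re (a 1) - (1 - 0) * (\<Sum>k=1..d. cmod (C k) * real (q k) powr (-0))"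
    by (rule tendsto_lowerbound) (use approx in \<open>auto simp: eventually_at_filter\<close>)
  also have "(\<Sum>k=1..d. cmod (C k) * real (q k) powr (-0)) = (\<Sum>k=1..d. cmod (C k))"
    using q2 by (intro sum.cong) (auto, fastforce)
  finally have cond: "1/2 + (\<Sum>k=1..d. cmod (C k)) \<le> Re (a 1)"
    by simp
  have "1/2 < Re (a 1)" if "d = 0"
    using Re_\<psi>[of 1] that by (simp add: \<psi>_def half_plane_def)
  with cond have "linear_data (a 1) d q C"
    using ind nz by unfold_locales (auto simp: C_def)
  then show ?thesis
    using maps \<phi>_eq by (intro that[of "a 1" d q C]) (auto simp: \<psi>_def)
qed

section \<open>Symbols touching the critical line\<close>

text \<open>For \<open>\<phi>(s) = 1/2 + r + i\<sigma> + K p^(-s)\<close> with \<open>r = |K|\<close>, \<open>L = log p\<close> and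
  \<open>w = K p^(-it)\<close>, this is \<open>\<phi>(i t + x\<^sup>2 - i x) - 1/2 + v\<close>, where \<open>v = - i \<sigma>' + i B x + \<eta> x\<^sup>2\<close> comes
  from the test function and \<open>\<tau> = \<sigma> - \<sigma>'\<close>. The zeta function is evaluated at \<open>1\<close> plus this number.\<close>

definition boundary_distance :: "real \<Rightarrow> complex \<Rightarrow> real \<Rightarrow> real \<Rightarrow> real \<Rightarrow> real \<Rightarrow> real \<Rightarrow> complex" where
  "boundary_distance r w L \<tau> B \<eta> x = of_real r + w * exp (of_real (- L * x\<^sup>2) + \<i> * of_real (L * x))
     + \<i> * of_real (\<tau> + B * x) + of_real (\<eta> * x\<^sup>2)"

lemma boundary_distance_tendsto:
  "(boundary_distance r w L \<tau> B \<eta> \<longlongrightarrow> of_real r + w + \<i> * of_real \<tau>) (at_right 0)"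
proof -
  have "(boundary_distance r w L \<tau> B \<eta> \<longlongrightarrow> of_real r + w * exp (of_real (- L * 0\<^sup>2) + \<i> * of_real (L * 0))
     + \<i> * of_real (\<tau> + B * 0) + of_real (\<eta> * 0\<^sup>2)) (at_right 0)"
    unfolding boundary_distance_def by (intro tendsto_intros)
  then show ?thesis by simp
qed

lemma tendsto_inverse_ratio:
  fixes u :: "real \<Rightarrow> complex"
  assumes "((\<lambda>x. u x / of_real (x ^ n)) \<longlongrightarrow> l) (at_right 0)" "l \<noteq> 0" 
  shows "((\<lambda>x. of_real (x ^ n) / u x) \<longlongrightarrow> 1 / l) (at_right 0)"
  using tendsto_inverse[OF assms] by (simp add: field_simps)

text \<open>If \<open>w = - r\<close> and \<open>\<tau> = 0\<close>, expansion at \<open>x = 0\<close> gives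
  \<open>i (B - r L) x + (r L + r L\<^sup>2 / 2 + \<eta>) x\<^sup>2\<close> up to higher order, so only equal first derivatives
  \<open>r L = B\<close> leave a quadratic term alone. Otherwise already the constant term is nonzero, since
  \<open>|w| = r\<close>.\<close>

lemma boundary_ratio_tendsto:
  assumes r: "0 < r" and L: "0 < L" and \<eta>: "0 < \<eta>" and w: "cmod w = r"
  shows "((\<lambda>x. of_real (x\<^sup>2) / boundary_distance r w L \<tau> B \<eta> x) \<longlongrightarrow>
     (if w = - of_real r \<and> \<tau> = 0 \<and> r * L = B then 1 / of_real (B + B * L / 2 + \<eta>) else 0)) (at_right 0)"
proof (cases "w = - of_real r \<and> \<tau> = 0")
  case False
  have "of_real r + w + \<i> * of_real \<tau> \<noteq> 0"
  proof
    assume 0: "of_real r + w + \<i> * of_real \<tau> = 0"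
    then have Re: "Re w = - r" and Im: "Im w = - \<tau>"
      by (auto simp: complex_eq_iff)
    have "r\<^sup>2 = (Re w)\<^sup>2 + (Im w)\<^sup>2"
      using w by (simp add: cmod_power2[symmetric])
    then have "\<tau> = 0"
      by (simp add: Re Im)
    with Re Im have "w = - of_real r"
      by (simp add: complex_eq_iff)
    with \<open>\<tau> = 0\<close> False show False by simp
  qed
  then have "((\<lambda>x. of_real (x\<^sup>2) / boundary_distance r w L \<tau> B \<eta> x) \<longlongrightarrow> of_real (0\<^sup>2) / (of_real r + w + \<i> * of_real \<tau>)) (at_right 0)"
    by (intro tendsto_divide boundary_distance_tendsto tendsto_intros)
  then show ?thesis
    using False by auto
next
  case True
  have Re: "Re (boundary_distance r w L \<tau> B \<eta> x) = r - r * exp (- L * x\<^sup>2) * cos (L * x) + \<eta> * x\<^sup>2"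
    and Im: "Im (boundary_distance r w L \<tau> B \<eta> x) = B * x - r * exp (- L * x\<^sup>2) * sin (L * x)" for x
    using True by (simp_all add: boundary_distance_def exp_add Re_exp Im_exp)
  show ?thesis
  proof (cases "r * L = B")
    case B: True
    have "((\<lambda>x. Complex ((r - r * exp (- L * x\<^sup>2) * cos (L * x) + \<eta> * x\<^sup>2) / x\<^sup>2) ((r * L * x - r * exp (- L * x\<^sup>2) * sin (L * x)) / x\<^sup>2))
        \<longlongrightarrow> Complex (r * L + r * L * L / 2 + \<eta>) 0) (at_right 0)"
    proof (rule tendsto_Complex)
      show "((\<lambda>x. (r - r * exp (- L * x\<^sup>2) * cos (L * x) + \<eta> * x\<^sup>2) / x\<^sup>2) \<longlongrightarrow> r * L + r * L * L / 2 + \<eta>) (at_right 0)"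
        using r L \<eta> by real_asymp
      show "((\<lambda>x. (r * L * x - r * exp (- L * x\<^sup>2) * sin (L * x)) / x\<^sup>2) \<longlongrightarrow> 0) (at_right 0)"
        using r L by real_asymp
    qed
    moreover have "Complex ((r - r * exp (- L * x\<^sup>2) * cos (L * x) + \<eta> * x\<^sup>2) / x\<^sup>2) ((r * L * x - r * exp (- L * x\<^sup>2) * sin (L * x)) / x\<^sup>2)
       = boundary_distance r w L \<tau> B \<eta> x / of_real (x\<^sup>2)" for x
      unfolding complex_eq_iff Re_divide_of_real Im_divide_of_real Re Im B by simp
    moreover have "Complex (r * L + r * L * L / 2 + \<eta>) 0 = of_real (B + B * L / 2 + \<eta>)"
      by (simp add: complex_eq_iff B)
    ultimately have lim: "((\<lambda>x. boundary_distance r w L \<tau> B \<eta> x / of_real (x\<^sup>2)) \<longlongrightarrow> of_real (B + B * L / 2 + \<eta>)) (at_right 0)"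
      by simp
    have "0 < B + B * L / 2 + \<eta>"
      using r L \<eta> by (auto simp: B[symmetric] intro!: add_pos_pos)
    then have "complex_of_real (B + B * L / 2 + \<eta>) \<noteq> 0"
      by (simp only: of_real_eq_0_iff)
    from tendsto_inverse_ratio[OF lim this] show ?thesis
      using True B by simp
  next
    case B: False
    have "((\<lambda>x. Complex ((r - r * exp (- L * x\<^sup>2) * cos (L * x) + \<eta> * x\<^sup>2) / x) ((B * x - r * exp (- L * x\<^sup>2) * sin (L * x)) / x))
        \<longlongrightarrow> Complex 0 (B - r * L)) (at_right 0)"
    proof (rule tendsto_Complex)
      show "((\<lambda>x. (r - r * exp (- L * x\<^sup>2) * cos (L * x) + \<eta> * x\<^sup>2) / x) \<longlongrightarrow> 0) (at_right 0)"
        using r L \<eta> by real_asymp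
      have "((\<lambda>x. B - r * (exp (- L * x\<^sup>2) * sin (L * x) / x)) \<longlongrightarrow> B - r * L) (at_right 0)"
      proof (intro tendsto_intros)
        show "((\<lambda>x. exp (- L * x\<^sup>2) * sin (L * x) / x) \<longlongrightarrow> L) (at_right 0)"
          using L by real_asymp
      qed
      then show "((\<lambda>x. (B * x - r * exp (- L * x\<^sup>2) * sin (L * x)) / x) \<longlongrightarrow> B - r * L) (at_right 0)"
        by (rule Lim_transform_eventually) (auto simp: eventually_at_filter field_simps)
    qed
    moreover have "Complex ((r - r * exp (- L * x\<^sup>2) * cos (L * x) + \<eta> * x\<^sup>2) / x) ((B * x - r * exp (- L * x\<^sup>2) * sin (L * x)) / x)
       = boundary_distance r w L \<tau> B \<eta> x / of_real (x ^ 1)" for x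
      unfolding complex_eq_iff power_one_right Re_divide_of_real Im_divide_of_real Re Im by simp
    ultimately have lim: "((\<lambda>x. boundary_distance r w L \<tau> B \<eta> x / of_real (x ^ 1)) \<longlongrightarrow> Complex 0 (B - r * L)) (at_right 0)"
      by simp
    have "Complex 0 (B - r * L) \<noteq> 0"
      using B by (simp add: complex_eq_iff)
    from tendsto_mult[OF tendsto_of_real[OF tendsto_ident_at] tendsto_inverse_ratio[OF lim this]]
    show ?thesis
      using B by (simp add: power2_eq_square)
  qed
qed

lemma has_sum_finite_sum:
  fixes f :: "'j \<Rightarrow> 'a \<Rightarrow> 'b :: topological_comm_monoid_add"
  assumes "\<And>j. j \<in> J \<Longrightarrow> (f j has_sum l j) A"
  shows "((\<lambda>x. \<Sum>j\<in>J. f j x) has_sum (\<Sum>j\<in>J. l j)) A"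
  using assms by (induction J rule: infinite_finite_induct) (auto intro!: has_sum_add)

text \<open>The squared norm of the evaluation at real part \<open>x\<^sup>2\<close> on series supported on powers of \<open>p\<close>, which
  grows only like \<open>x^(-2)\<close>.\<close>

lemma geometric_norm_bound:
  fixes p :: nat and x :: real
  assumes p: "2 \<le> p" and x: "0 < x"
  shows "(\<lambda>m. if m \<in> range (\<lambda>a. p ^ a) then real m powr (- 2 * x\<^sup>2) else 0) summable_on UNIV"
    and "x\<^sup>2 * (\<Sum>\<^sub>\<infinity>m. if m \<in> range (\<lambda>a. p ^ a) then real m powr (- 2 * x\<^sup>2) else 0) \<le> x\<^sup>2 + 1 / (2 * ln (real p))"
proof -
  define f where "f m = (if m \<in> range (\<lambda>a. p ^ a) then real m powr (- 2 * x\<^sup>2) else 0)" for m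
  define y where "y = 2 * x\<^sup>2 * ln (real p)"
  have y: "0 < y"
    using p x by (simp add: y_def)
  have inj: "inj (\<lambda>a. p ^ a)"
    using p by (auto simp: inj_def)
  have f_pow: "f (p ^ a) = exp (-y) ^ a" for a
    using p by (simp add: f_def y_def powr_def exp_of_nat_mult[symmetric] ln_realpow algebra_simps)
  have "((\<lambda>a. exp (-y) ^ a) has_sum 1 / (1 - exp (-y))) UNIV"
    using geometric_sums[of "exp (-y)"] y by (intro sums_nonneg_imp_has_sum) auto
  then have "(f has_sum 1 / (1 - exp (-y))) (range (\<lambda>a. p ^ a))"
    unfolding has_sum_reindex[OF inj] by (simp add: o_def f_pow)
  then have sum: "(f has_sum 1 / (1 - exp (-y))) UNIV"
    by (subst has_sum_cong_neutral[where T = "range (\<lambda>a. p ^ a)" and g = f]) (auto simp: f_def)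
  then show "f summable_on UNIV"
    by (rule has_sum_imp_summable)
  have "1 / (1 - exp (-y)) \<le> 1 + 1 / y"
  proof -
    have "1 + y \<le> exp y" by (rule exp_ge_add_one_self)
    then have "exp (-y) \<le> 1 / (1 + y)"
      using y by (simp add: exp_minus divide_inverse)
    then have "y / (1 + y) \<le> 1 - exp (-y)"
      using y by (simp add: field_simps)
    then have "1 / (1 - exp (-y)) \<le> 1 / (y / (1 + y))"
      using y by (intro divide_left_mono) auto
    then show ?thesis
      using y by (simp add: field_simps)
  qed
  then have "x\<^sup>2 * infsum f UNIV \<le> x\<^sup>2 * (1 + 1 / y)"
    unfolding infsumI[OF sum] by (intro mult_left_mono) auto
  also have "\<dots> = x\<^sup>2 + 1 / (2 * ln (real p))"
    using x p by (simp add: y_def field_simps)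
  finally show "x\<^sup>2 * infsum f UNIV \<le> x\<^sup>2 + 1 / (2 * ln (real p))" .
qed

text \<open>All images are supported on powers of the finitely many \<open>p j\<close>. On such series evaluation at \<open>s\<close>
  is bounded for \<open>Re s > 0\<close>, with norm of order \<open>1/x\<close> at the points \<open>s x\<close> below. The test functions
  \<open>F x\<close> are kernels of norm of order \<open>1/x\<close> multiplied by \<open>x\<close>, and they tend to \<open>0\<close> weakly, so
  a compact combination sends them to \<open>0\<close> in norm. Multiplying the evaluation by another \<open>x\<close> thus
  gives a null sequence, and this compares \<open>x\<^sup>2 \<zeta>(1 + u j x)\<close> with its limit.\<close>

lemma touching_combination:
  fixes J :: "'j set" and p :: "'j \<Rightarrow> nat" and K :: "'j \<Rightarrow> complex" and \<tau> :: "'j \<Rightarrow> real" and \<mu> :: "'j \<Rightarrow> complex"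
  assumes J: "finite J"
    and E: "\<And>j. j \<in> J \<Longrightarrow> schur_matrix (E j) (A j)"
    and \<phi>: "\<And>j. j \<in> J \<Longrightarrow> represents_composition (E j) (\<phi> j)"
    and support: "\<And>j m n. j \<in> J \<Longrightarrow> m \<notin> range (\<lambda>a. p j ^ a) \<Longrightarrow> E j m n = 0"
    and column: "\<And>j s n. j \<in> J \<Longrightarrow> n \<noteq> 0 \<Longrightarrow> (\<Sum>\<^sub>\<infinity>m. of_nat m powr (-s) * E j m n)
        = of_nat n powr (- (1/2 + of_real (cmod (K j)) + \<i> * of_real (\<tau> j) + K j * of_nat (p j) powr (-s)))"
    and p: "\<And>j. j \<in> J \<Longrightarrow> 2 \<le> p j" and K: "\<And>j. j \<in> J \<Longrightarrow> K j \<noteq> 0"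
    and distinct: "\<And>i j. i \<in> J \<Longrightarrow> j \<in> J \<Longrightarrow> \<tau> i = \<tau> j \<Longrightarrow> p i = p j \<Longrightarrow> K i = K j \<Longrightarrow> i = j"
    and compact: "compact_operator (\<lambda>f. \<Sum>j\<in>J. scaleC (\<mu> j) (composition_operator (\<phi> j) f))"
    and k: "k \<in> J"
  shows "\<mu> k = 0"
proof -
  define L where "L j = ln (real (p j))" for j
  define B where "B = cmod (K k) * L k"
  \<comment> \<open>The point \<open>i t\<^sub>0\<close> is chosen such that symbol \<open>k\<close> touches there, see \<open>w_k\<close>; \<open>B\<close> is its
    first derivative.\<close>
  define t\<^sub>0 where "t\<^sub>0 = (Arg (K k) - pi) / L k"
  define w where "w j = K j * exp (- \<i> * of_real (t\<^sub>0 * L j))" for j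
  define T where "T f = (\<Sum>j\<in>J. scaleC (\<mu> j) (composition_operator (\<phi> j) f))" for f
  have L: "0 < L j" if "j \<in> J" for j
    using p[OF that] by (simp add: L_def)
  have B: "0 < B"
    using L[OF k] K[OF k] by (simp add: B_def)
  have norm_w: "cmod (w j) = cmod (K j)" for j
    by (simp add: w_def norm_mult)
  have w_k: "w k = - of_real (cmod (K k))"
  proof -
    have "w k = of_real (cmod (K k)) * exp (\<i> * of_real (Arg (K k) - t\<^sub>0 * L k))"
      using Arg_eq[OF K[OF k]] unfolding w_def by (simp add: exp_diff exp_minus algebra_simps divide_inverse)
    also have "Arg (K k) - t\<^sub>0 * L k = pi"
      using L[OF k] by (simp add: t\<^sub>0_def)
    finally show ?thesis by simp
  qed
  \<comment> \<open>The indices with the same boundary point and first derivative as \<open>k\<close> at \<open>i t\<^sub>0\<close>.\<close>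
  define J' where "J' = {j \<in> J. w j = - of_real (cmod (K j)) \<and> \<tau> j - \<tau> k = 0 \<and> cmod (K j) * L j = B}"
  define b where "b j = B + B * L j / 2" for j
  have sum_0: "(\<Sum>j\<in>J'. \<mu> j / of_real (b j + \<eta>)) = 0" if \<eta>: "0 < \<eta>" for \<eta> :: real
  proof -
    \<comment> \<open>A tangential approach to \<open>i t\<^sub>0\<close>. The test function \<open>n^(-1/2-v)\<close> is the kernel at the
      conjugate of \<open>1/2 + v x\<close>, which follows the image of this path under symbol \<open>k\<close> to first order.\<close>
    define s where "s x = \<i> * of_real t\<^sub>0 + of_real (x\<^sup>2) - \<i> * of_real x" for x :: real
    define v where "v x = - \<i> * of_real (\<tau> k) + \<i> * of_real (B * x) + of_real (\<eta> * x\<^sup>2)" for x :: real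
    define u where "u j = boundary_distance (cmod (K j)) (w j) (L j) (\<tau> j - \<tau> k) B \<eta>" for j
    define Z where "Z j x = (\<Sum>\<^sub>\<infinity>n::nat. of_nat n powr (- (1 + u j x)))" for j x
    define M where "M = (\<Sum>n. real (Suc n) powr (-2))"
    have M: "0 \<le> M"
      unfolding M_def using summable_Suc_iff[of "\<lambda>n. real n powr (-2)"] by (intro suminf_nonneg) (simp_all add: summable_real_powr_iff)
    have u_eq: "1/2 + of_real (cmod (K j)) + \<i> * of_real (\<tau> j) + K j * of_nat (p j) powr (- s x) + (1/2 + v x) = 1 + u j x"
      if "j \<in> J" for j x
    proof -
      have "of_nat (p j) powr (- s x) = exp (- s x * of_real (L j))"
        using p[OF that] by (simp add: powr_def Ln_of_nat L_def)
      also have "- s x * of_real (L j) = - \<i> * of_real (t\<^sub>0 * L j) + (of_real (- L j * x\<^sup>2) + \<i> * of_real (L j * x))"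
        by (simp add: s_def algebra_simps)
      finally have "K j * of_nat (p j) powr (- s x) = w j * exp (of_real (- L j * x\<^sup>2) + \<i> * of_real (L j * x))"
        by (simp only: exp_add w_def mult.assoc)
      then show ?thesis
        by (simp add: u_def boundary_distance_def v_def algebra_simps)
    qed
    have Re_u: "0 < Re (u j x)" if "j \<in> J" "0 < x" for j x
    proof -
      have "Re (w j * exp (of_real (- L j * x\<^sup>2) + \<i> * of_real (L j * x))) \<ge> - cmod (w j * exp (of_real (- L j * x\<^sup>2) + \<i> * of_real (L j * x)))"
        using abs_Re_le_cmod abs_le_D2 by (metis minus_le_iff)
      moreover have "cmod (w j * exp (of_real (- L j * x\<^sup>2) + \<i> * of_real (L j * x))) = cmod (K j) * exp (- L j * x\<^sup>2)"
        by (simp add: norm_mult norm_w exp_add)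
      moreover have "cmod (K j) * exp (- L j * x\<^sup>2) \<le> cmod (K j) * 1"
        using L[OF that(1)] by (intro mult_left_mono) auto
      moreover have "0 < \<eta> * x\<^sup>2"
        using \<eta> that by simp
      ultimately show ?thesis
        by (simp add: u_def boundary_distance_def)
    qed
    have u_lim: "((\<lambda>x. of_real (x\<^sup>2) / u j x) \<longlongrightarrow> (if j \<in> J' then 1 / of_real (b j + \<eta>) else 0)) (at_right 0)" if j: "j \<in> J" for j
    proof -
      have iff: "j \<in> J' \<longleftrightarrow> w j = - of_real (cmod (K j)) \<and> \<tau> j - \<tau> k = 0 \<and> cmod (K j) * L j = B"
        using j by (simp add: J'_def)
      show ?thesis
        unfolding u_def b_def iff by (rule boundary_ratio_tendsto) (use K[OF j] L[OF j] \<eta> norm_w in auto)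
    qed
    have Z_lim: "((\<lambda>x. of_real (x\<^sup>2) * Z j x) \<longlongrightarrow> (if j \<in> J' then 1 / of_real (b j + \<eta>) else 0)) (at_right 0)" if j: "j \<in> J" for j
    proof -
      have "((\<lambda>x. x\<^sup>2 * (cmod (1 + u j x) * M)) \<longlongrightarrow> 0\<^sup>2 * (cmod (1 + (of_real (cmod (K j)) + w j + \<i> * of_real (\<tau> j - \<tau> k))) * M)) (at_right 0)"
        unfolding u_def by (intro tendsto_intros boundary_distance_tendsto)
      then have "((\<lambda>x. x\<^sup>2 * (cmod (1 + u j x) * M)) \<longlongrightarrow> 0) (at_right 0)"
        by simp
      moreover have "\<forall>\<^sub>F x in at_right 0. norm (of_real (x\<^sup>2) * (Z j x - 1 / u j x)) \<le> x\<^sup>2 * (cmod (1 + u j x) * M)"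
      proof (rule eventually_mono[OF eventually_at_right_less[of 0]])
        fix x :: real assume "0 < x"
        from zeta_pole_bound[OF Re_u[OF j this]]
        have "cmod (Z j x - 1 / u j x) \<le> cmod (1 + u j x) * M"
          by (simp add: Z_def M_def)
        then show "norm (of_real (x\<^sup>2) * (Z j x - 1 / u j x)) \<le> x\<^sup>2 * (cmod (1 + u j x) * M)"
          unfolding norm_mult norm_of_real by (simp add: mult_left_mono)
      qed
      ultimately have "((\<lambda>x. of_real (x\<^sup>2) * (Z j x - 1 / u j x)) \<longlongrightarrow> 0) (at_right 0)"
        by (rule Lim_null_comparison[rotated])
      from tendsto_add[OF this u_lim[OF j]] show ?thesis
        by (simp add: right_diff_distrib)
    qed

    \<comment> \<open>The bound \<open>\<zeta>(1 + \<epsilon>) \<le> 1/\<epsilon> + (1 + \<epsilon>) M\<close> with \<open>\<epsilon> = 2 \<eta> x\<^sup>2\<close>, multiplied by \<open>x\<^sup>2\<close>.\<close>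
    define R where "R = 1 / (2 * \<eta>) + (1 + 2 * \<eta>) * M"
    have R: "0 < R"
      using \<eta> M by (auto simp: R_def intro!: add_pos_nonneg)
    define F where "F x = Abs_dirichlet_H (\<lambda>n. of_real (x / sqrt R) * of_nat n powr (- (1/2 + v x)))" for x
    have F: "coeff (F x) = (\<lambda>n. of_real (x / sqrt R) * of_nat n powr (- (1/2 + v x)))" "norm (F x) \<le> 1" if x: "0 < x" "x \<le> 1" for x
    proof -
      have sq: "(cmod (of_real (x / sqrt R) * of_nat n powr (- (1/2 + v x))))\<^sup>2 = x\<^sup>2 / R * real n powr (- (1 + 2 * \<eta> * x\<^sup>2))" for n :: nat
      proof -
        have norm_n: "cmod (of_nat n powr (- (1/2 + v x))) = real n powr (- (1/2 + \<eta> * x\<^sup>2))"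
          by (cases "n = 0") (simp_all add: norm_powr_real_powr v_def algebra_simps)
        have "(cmod (of_nat n powr (- (1/2 + v x))))\<^sup>2 = real n powr (- (1 + 2 * \<eta> * x\<^sup>2))"
        proof -
          have "(real n powr a)\<^sup>2 = real n powr (2 * a)" for a
            by (simp add: power2_eq_square powr_add[symmetric])
          then show ?thesis
            unfolding norm_n by (simp add: algebra_simps)
        qed
        moreover have "(cmod (of_real (x / sqrt R)))\<^sup>2 = x\<^sup>2 / R"
          using R by (simp only: norm_of_real power2_abs power_divide real_sqrt_pow2 less_imp_le)
        ultimately show ?thesis
          by (simp only: norm_mult power_mult_distrib)
      qed
      have "0 < \<eta> * x\<^sup>2" using \<eta> x by simp
      then have S: "(\<lambda>n. real n powr (- (1 + 2 * \<eta> * x\<^sup>2))) summable_on UNIV"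
        by (simp add: summable_on_UNIV_nonneg_real_iff summable_real_powr_iff)
      show cF: "coeff (F x) = (\<lambda>n. of_real (x / sqrt R) * of_nat n powr (- (1/2 + v x)))"
        unfolding F_def by (rule coeff_Abs) (simp, unfold sq, intro summable_on_cmult_right S)
      have "of_real (\<Sum>\<^sub>\<infinity>n. real n powr (- (1 + 2 * \<eta> * x\<^sup>2))) = (\<Sum>\<^sub>\<infinity>n::nat. of_nat n powr (- (1 + complex_of_real (2 * \<eta> * x\<^sup>2))))"
      proof -
        have eq: "complex_of_real (real n powr (- (1 + 2 * \<eta> * x\<^sup>2))) = of_nat n powr (- (1 + complex_of_real (2 * \<eta> * x\<^sup>2)))" for n :: nat
          by (cases "n = 0") (simp_all add: powr_of_real[symmetric])
        have "((\<lambda>n. complex_of_real (real n powr (- (1 + 2 * \<eta> * x\<^sup>2)))) has_sum complex_of_real (\<Sum>\<^sub>\<infinity>n. real n powr (- (1 + 2 * \<eta> * x\<^sup>2)))) UNIV"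
          by (intro has_sum_of_real has_sum_infsum S)
        from infsumI[OF this] show ?thesis
          by (simp only: eq)
      qed
      moreover have "cmod ((\<Sum>\<^sub>\<infinity>n::nat. of_nat n powr (- (1 + complex_of_real (2 * \<eta> * x\<^sup>2)))) - 1 / complex_of_real (2 * \<eta> * x\<^sup>2))
          \<le> cmod (1 + complex_of_real (2 * \<eta> * x\<^sup>2)) * M"
        unfolding M_def by (rule zeta_pole_bound) (use \<open>0 < \<eta> * x\<^sup>2\<close> in simp)
      ultimately have "cmod (of_real ((\<Sum>\<^sub>\<infinity>n. real n powr (- (1 + 2 * \<eta> * x\<^sup>2))) - 1 / (2 * \<eta> * x\<^sup>2)))
          \<le> cmod (of_real (1 + 2 * \<eta> * x\<^sup>2)) * M"
        by simp
      then have "(\<Sum>\<^sub>\<infinity>n. real n powr (- (1 + 2 * \<eta> * x\<^sup>2))) - 1 / (2 * \<eta> * x\<^sup>2) \<le> (1 + 2 * \<eta> * x\<^sup>2) * M"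
        unfolding norm_of_real using \<open>0 < \<eta> * x\<^sup>2\<close> by simp
      then have "x\<^sup>2 * (\<Sum>\<^sub>\<infinity>n. real n powr (- (1 + 2 * \<eta> * x\<^sup>2))) \<le> x\<^sup>2 * (1 / (2 * \<eta> * x\<^sup>2) + (1 + 2 * \<eta> * x\<^sup>2) * M)"
        by (intro mult_left_mono) auto
      also have "\<dots> = 1 / (2 * \<eta>) + x\<^sup>2 * (1 + 2 * \<eta> * x\<^sup>2) * M"
        using x \<eta> by (simp add: field_simps)
      also have "\<dots> \<le> 1 / (2 * \<eta>) + 1 * (1 + 2 * \<eta> * 1) * M"
        using x \<eta> M power_le_one[of x 2] by (intro add_mono mult_mono mult_right_mono mult_left_mono) auto
      finally have le_R: "x\<^sup>2 * (\<Sum>\<^sub>\<infinity>n. real n powr (- (1 + 2 * \<eta> * x\<^sup>2))) \<le> R"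
        by (simp add: R_def)
      have "(norm (F x))\<^sup>2 = x\<^sup>2 / R * (\<Sum>\<^sub>\<infinity>n. real n powr (- (1 + 2 * \<eta> * x\<^sup>2)))"
        unfolding norm_dirichlet_H_infsum cF sq by (rule infsum_cmult_right')
      also have "\<dots> \<le> 1\<^sup>2"
        using le_R R by (simp add: field_simps)
      finally show "norm (F x) \<le> 1"
        by (rule power2_le_imp_le) simp
    qed

    \<comment> \<open>Evaluation at \<open>s x\<close>, restricted to the indices where images can be nonzero.\<close>
    define S where "S = (\<Union>j\<in>J. range (\<lambda>a. p j ^ a))"
    define h where "h x m = (if m \<in> S then of_nat m powr (- s x) else 0)" for x and m :: nat
    define D where "D = (\<Sum>j\<in>J. 1 + 1 / (2 * L j))"
    have h: "(\<lambda>m. (cmod (h x m))\<^sup>2) summable_on UNIV" "x\<^sup>2 * (\<Sum>\<^sub>\<infinity>m. (cmod (h x m))\<^sup>2) \<le> D" if x: "0 < x" "x \<le> 1" for x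
    proof -
      define f where "f j m = (if m \<in> range (\<lambda>a. p j ^ a) then real m powr (- 2 * x\<^sup>2) else 0)" for j and m :: nat
      have f: "f j summable_on UNIV" "x\<^sup>2 * infsum (f j) UNIV \<le> x\<^sup>2 + 1 / (2 * L j)" if "j \<in> J" for j
        using geometric_norm_bound[OF p[OF that] x(1)] by (simp_all add: f_def[abs_def] L_def)
      have le: "(cmod (h x m))\<^sup>2 \<le> (\<Sum>j\<in>J. f j m)" for m
      proof (cases "m \<in> S")
        case True
        then obtain i where i: "i \<in> J" "m \<in> range (\<lambda>a. p i ^ a)"
          by (auto simp: S_def)
        have "m \<noteq> 0"
          using i p[OF i(1)] by auto
        then have "(cmod (h x m))\<^sup>2 = f i m"
          using True i by (simp add: h_def f_def norm_powr_real_powr s_def power2_eq_square powr_add[symmetric])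
        also have "\<dots> \<le> (\<Sum>j\<in>J. f j m)"
          using J i by (intro member_le_sum) (auto simp: f_def)
        finally show ?thesis .
      qed (auto simp: h_def f_def intro: sum_nonneg)
      have f_sum: "((\<lambda>m. \<Sum>j\<in>J. f j m) has_sum (\<Sum>j\<in>J. infsum (f j) UNIV)) UNIV"
        by (intro has_sum_finite_sum has_sum_infsum f)
      then have Sf: "(\<lambda>m. \<Sum>j\<in>J. f j m) summable_on UNIV"
        by (rule has_sum_imp_summable)
      show S: "(\<lambda>m. (cmod (h x m))\<^sup>2) summable_on UNIV"
        by (rule summable_on_comparison_test[OF Sf]) (use le in auto)
      have "x\<^sup>2 * (\<Sum>\<^sub>\<infinity>m. (cmod (h x m))\<^sup>2) \<le> x\<^sup>2 * (\<Sum>\<^sub>\<infinity>m. \<Sum>j\<in>J. f j m)"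
        by (intro mult_left_mono infsum_mono S Sf le) auto
      also have "\<dots> = (\<Sum>j\<in>J. x\<^sup>2 * infsum (f j) UNIV)"
        unfolding infsumI[OF f_sum] by (rule sum_distrib_left)
      also have "\<dots> \<le> D"
        unfolding D_def using x power_le_one[of x 2] by (intro sum_mono order_trans[OF f(2)]) auto
      finally show "x\<^sup>2 * (\<Sum>\<^sub>\<infinity>m. (cmod (h x m))\<^sup>2) \<le> D" .
    qed

    have coeff_T: "coeff (T f) m = (\<Sum>j\<in>J. \<mu> j * coeff (composition_operator (\<phi> j) f) m)" for f m
      by (simp add: T_def coeff_sum scaleC.rep_eq)
    have pairing: "(\<Sum>\<^sub>\<infinity>m. h x m * coeff (T (F x)) m) = of_real (x / sqrt R) * (\<Sum>j\<in>J. \<mu> j * Z j x)" if x: "0 < x" "x \<le> 1" for x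
    proof -
      have "(\<Sum>\<^sub>\<infinity>m. h x m * coeff (T (F x)) m) = (\<Sum>\<^sub>\<infinity>m. \<Sum>j\<in>J. \<mu> j * (h x m * coeff (composition_operator (\<phi> j) (F x)) m))"
        by (simp add: coeff_T sum_distrib_left mult.left_commute)
      also have "\<dots> = (\<Sum>j\<in>J. \<mu> j * (\<Sum>\<^sub>\<infinity>m. h x m * coeff (composition_operator (\<phi> j) (F x)) m))"
        by (intro infsumI has_sum_finite_sum has_sum_cmult_right has_sum_infsum
            coeff_pairing(1)[OF h(1)[OF x], THEN abs_summable_summable])
      also have "\<dots> = (\<Sum>j\<in>J. \<mu> j * (of_real (x / sqrt R) * Z j x))"
      proof (intro sum.cong refl arg_cong[of _ _ "(*) _"])
        fix j assume j: "j \<in> J"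
        have "(\<Sum>\<^sub>\<infinity>m. h x m * coeff (composition_operator (\<phi> j) (F x)) m)
            = (\<Sum>\<^sub>\<infinity>n. (\<Sum>\<^sub>\<infinity>m. h x m * E j m n) * coeff (F x) n)"
          by (rule composition_operator_matrix[OF E[OF j] \<phi>[OF j], of "F x"]) (use h(1)[OF x] in blast)
        also have "\<dots> = (\<Sum>\<^sub>\<infinity>n. of_real (x / sqrt R) * of_nat n powr (- (1 + u j x)))"
        proof (rule infsum_cong)
          fix n :: nat
          show "(\<Sum>\<^sub>\<infinity>m. h x m * E j m n) * coeff (F x) n = of_real (x / sqrt R) * of_nat n powr (- (1 + u j x))"
          proof (cases "n = 0")
            case False
            have "(\<Sum>\<^sub>\<infinity>m. h x m * E j m n) = (\<Sum>\<^sub>\<infinity>m. of_nat m powr (- s x) * E j m n)"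
              using support[OF j] j by (intro infsum_cong) (auto simp: h_def S_def)
            also have "\<dots> * coeff (F x) n = of_real (x / sqrt R) * (of_nat n powr (- (1/2 + of_real (cmod (K j)) + \<i> * of_real (\<tau> j) + K j * of_nat (p j) powr (- s x))) * of_nat n powr (- (1/2 + v x)))"
              unfolding column[OF j False] F(1)[OF x] by (simp only: mult.left_commute)
            also have "\<dots> = of_real (x / sqrt R) * of_nat n powr (- (1 + u j x))"
              unfolding u_eq[OF j, symmetric] minus_add_distrib powr_add by (simp only: mult.assoc)
            finally show ?thesis .
          qed simp
        qed
        also have "\<dots> = of_real (x / sqrt R) * Z j x"
          unfolding Z_def by (rule infsum_cmult_right')
        finally show "(\<Sum>\<^sub>\<infinity>m. h x m * coeff (composition_operator (\<phi> j) (F x)) m) = of_real (x / sqrt R) * Z j x" .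
      qed
      finally show ?thesis
        by (simp only: sum_distrib_left mult.left_commute)
    qed

    define x where "x i = 1 / real (Suc i)" for i
    have x: "0 < x i" "x i \<le> 1" for i
      by (auto simp: x_def)
    have x_0: "x \<longlonglongrightarrow> 0"
      unfolding x_def by real_asymp
    have x_right: "filterlim x (at_right 0) sequentially"
      unfolding x_def[abs_def] by real_asymp
    have T_0: "(\<lambda>i. norm (T (F (x i)))) \<longlonglongrightarrow> 0"
    proof (rule compact_operator_tendsto_0[where T = T and F = "\<lambda>i. F (x i)"])
      show "compact_operator T"
        using compact by (simp add: T_def[abs_def])
      show "norm (F (x i)) \<le> 1" for i
        by (rule F(2)[OF x])
      fix m
      show "(\<lambda>i. coeff (T (F (x i))) m) \<longlonglongrightarrow> 0"
      proof (rule Lim_null_comparison)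
        show "(\<lambda>i. (\<Sum>j\<in>J. cmod (\<mu> j) * (x i / sqrt R * A j m))) \<longlonglongrightarrow> 0"
          using x_0 R by (auto intro!: tendsto_eq_intros)
        have "cmod (coeff (T (F (x i))) m) \<le> (\<Sum>j\<in>J. cmod (\<mu> j) * (x i / sqrt R * A j m))" for i
          unfolding coeff_T
        proof (rule sum_norm_le)
          fix j assume j: "j \<in> J"
          have row: "(\<lambda>n. cmod (E j m n) * real n powr (-1/2)) summable_on UNIV"
            "(\<Sum>\<^sub>\<infinity>n. cmod (E j m n) * real n powr (-1/2)) \<le> A j m"
            using E[OF j] by (auto simp: schur_matrix_def)
          have le: "cmod (E j m n * coeff (F (x i)) n) \<le> x i / sqrt R * (cmod (E j m n) * real n powr (-1/2))" for n
          proof (cases "n = 0")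
            case False
            have "cmod (of_nat n powr (- (1/2 + v (x i)))) = real n powr (- (1/2 + \<eta> * (x i)\<^sup>2))"
              using False by (simp add: norm_powr_real_powr v_def algebra_simps)
            also have "\<dots> \<le> real n powr (-1/2)"
              using False \<eta> by (intro powr_mono) auto
            finally have "cmod (coeff (F (x i)) n) \<le> x i / sqrt R * real n powr (-1/2)"
              unfolding F(1)[OF x] norm_mult norm_of_real using x(1)[of i] R by (simp add: mult_left_mono divide_right_mono)
            then show ?thesis
              unfolding norm_mult by (simp only: mult.left_commute[of "x i / sqrt R"] mult_left_mono norm_ge_zero)
          qed simp
          have S: "(\<lambda>n. x i / sqrt R * (cmod (E j m n) * real n powr (-1/2))) summable_on UNIV"
            by (rule summable_on_cmult_right[OF row(1)])
          have abs: "(\<lambda>n. E j m n * coeff (F (x i)) n) abs_summable_on UNIV"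
            by (rule summable_on_comparison_test[OF S]) (use le in auto)
          have "coeff (composition_operator (\<phi> j) (F (x i))) m = (\<Sum>\<^sub>\<infinity>n. E j m n * coeff (F (x i)) n)"
            by (rule composition_operator_matrix[OF E[OF j] \<phi>[OF j], of "F (x i)"]) (rule fun_cong)
          also have "cmod \<dots> \<le> (\<Sum>\<^sub>\<infinity>n. cmod (E j m n * coeff (F (x i)) n))"
            by (rule norm_infsum_bound[OF abs])
          also have "\<dots> \<le> (\<Sum>\<^sub>\<infinity>n. x i / sqrt R * (cmod (E j m n) * real n powr (-1/2)))"
            by (rule infsum_mono[OF abs S le])
          also have "\<dots> = x i / sqrt R * (\<Sum>\<^sub>\<infinity>n. cmod (E j m n) * real n powr (-1/2))"
            by (rule infsum_cmult_right')
          also have "\<dots> \<le> x i / sqrt R * A j m"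
            using x(1)[of i] R row(2) by (intro mult_left_mono) auto
          finally show "cmod (\<mu> j * coeff (composition_operator (\<phi> j) (F (x i))) m) \<le> cmod (\<mu> j) * (x i / sqrt R * A j m)"
            unfolding norm_mult by (intro mult_left_mono) auto
        qed
        then show "\<forall>\<^sub>F i in sequentially. norm (coeff (T (F (x i))) m) \<le> (\<Sum>j\<in>J. cmod (\<mu> j) * (x i / sqrt R * A j m))"
          by (simp add: always_eventually)
      qed
    qed
    have "(\<lambda>i. \<Sum>j\<in>J. \<mu> j * (of_real ((x i)\<^sup>2) * Z j (x i))) \<longlonglongrightarrow> 0"
    proof (rule Lim_null_comparison)
      show "(\<lambda>i. sqrt R * (norm (T (F (x i))) * sqrt D)) \<longlonglongrightarrow> 0"
        by (intro tendsto_mult_right_zero tendsto_mult_left_zero T_0)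
      have "cmod (\<Sum>j\<in>J. \<mu> j * (of_real ((x i)\<^sup>2) * Z j (x i))) \<le> sqrt R * (norm (T (F (x i))) * sqrt D)" for i
      proof -
        have "(\<Sum>j\<in>J. \<mu> j * (of_real ((x i)\<^sup>2) * Z j (x i))) = of_real ((x i)\<^sup>2) * (\<Sum>j\<in>J. \<mu> j * Z j (x i))"
          by (simp only: sum_distrib_left mult.left_commute)
        also have "\<dots> = of_real (sqrt R * x i) * (of_real (x i / sqrt R) * (\<Sum>j\<in>J. \<mu> j * Z j (x i)))"
          using R by (simp add: power2_eq_square)
        also have "\<dots> = of_real (sqrt R * x i) * (\<Sum>\<^sub>\<infinity>m. h (x i) m * coeff (T (F (x i))) m)"
          by (simp only: pairing[OF x])
        finally have "cmod (\<Sum>j\<in>J. \<mu> j * (of_real ((x i)\<^sup>2) * Z j (x i)))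
            = sqrt R * x i * cmod (\<Sum>\<^sub>\<infinity>m. h (x i) m * coeff (T (F (x i))) m)"
          using R x(1)[of i] by (simp add: norm_mult)
        also have "\<dots> \<le> sqrt R * x i * (norm (T (F (x i))) * sqrt (\<Sum>\<^sub>\<infinity>m. (cmod (h (x i) m))\<^sup>2))"
          using R x(1)[of i] by (intro mult_left_mono coeff_pairing(2) h(1) x) auto
        also have "\<dots> = sqrt R * (norm (T (F (x i))) * sqrt ((x i)\<^sup>2 * (\<Sum>\<^sub>\<infinity>m. (cmod (h (x i) m))\<^sup>2)))"
          using x(1)[of i] by (simp add: real_sqrt_mult)
        also have "\<dots> \<le> sqrt R * (norm (T (F (x i))) * sqrt D)"
          using R h(2)[OF x] by (intro mult_left_mono) auto
        finally show ?thesis .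
      qed
      then show "\<forall>\<^sub>F i in sequentially. norm (\<Sum>j\<in>J. \<mu> j * (of_real ((x i)\<^sup>2) * Z j (x i))) \<le> sqrt R * (norm (T (F (x i))) * sqrt D)"
        by (simp add: always_eventually)
    qed
    moreover have "(\<lambda>i. \<Sum>j\<in>J. \<mu> j * (of_real ((x i)\<^sup>2) * Z j (x i))) \<longlonglongrightarrow> (\<Sum>j\<in>J. \<mu> j * (if j \<in> J' then 1 / of_real (b j + \<eta>) else 0))"
      by (intro tendsto_sum tendsto_mult tendsto_const filterlim_compose[OF Z_lim x_right])
    ultimately have "0 = (\<Sum>j\<in>J. \<mu> j * (if j \<in> J' then 1 / of_real (b j + \<eta>) else 0))"
      by (rule LIMSEQ_unique)
    also have "\<dots> = (\<Sum>j\<in>J'. \<mu> j / of_real (b j + \<eta>))"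
      using J by (intro sum.mono_neutral_cong_right) (auto simp: J'_def)
    finally show ?thesis by simp
  qed
  show ?thesis
  proof (rule partial_fractions_independent[OF _ _ _ sum_0])
    show "finite J'" using J by (simp add: J'_def)
    show "k \<in> J'" using k w_k by (simp add: J'_def B_def)
    show "0 \<le> b j" if "j \<in> J'" for j
      using B L[of j] that by (simp add: b_def J'_def)
    show "inj_on b J'"
    proof (rule inj_onI)
      fix i j assume ij: "i \<in> J'" "j \<in> J'" "b i = b j"
      then have J: "i \<in> J" "j \<in> J" by (auto simp: J'_def)
      have L_eq: "L i = L j"
        using ij(3) B by (simp add: b_def)
      then have p_eq: "p i = p j"
        using p[OF J(1)] p[OF J(2)] by (simp add: L_def)
      have "cmod (K i) * L j = cmod (K j) * L j"
        using ij L_eq by (simp add: J'_def)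
      then have "cmod (K i) = cmod (K j)"
        using L[OF J(2)] by simp
      then have "w i = w j"
        using ij by (simp add: J'_def)
      then have "K i = K j"
        using L_eq by (simp add: w_def)
      with ij p_eq J show "i = j"
        by (intro distinct) (auto simp: J'_def)
    qed
  qed
qed

section \<open>Linear combinations of composition operators\<close>

text \<open>By the decay of row weights only \<open>d = 1\<close> without gap can fail to be compact. What is recorded
  about the matrix is exactly what the test with kernels uses.\<close>

lemma noncompact_linear_symbol:
  assumes "linear_symbol 0 \<phi>" and noncompact: "\<not> compact_operator (composition_operator \<phi>)"
  shows "\<exists>p K \<tau> E A. 2 \<le> p \<and> K \<noteq> 0 \<and> schur_matrix E A \<and> represents_composition E \<phi> \<and>
       (\<forall>m n. m \<notin> range (\<lambda>a. p ^ a) \<longrightarrow> E m n = 0) \<and>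
       (\<forall>s n. n \<noteq> 0 \<longrightarrow> (\<Sum>\<^sub>\<infinity>m. of_nat m powr (-s) * E m n)
          = of_nat n powr (- (1/2 + of_real (cmod K) + \<i> * of_real \<tau> + K * of_nat p powr (-s)))) \<and>
       (\<forall>s\<in>half_plane (1/2). \<phi> s = 1/2 + of_real (cmod K) + \<i> * of_real \<tau> + K * of_nat p powr (-s))"
proof -
  obtain c\<^sub>1 d q C where data: "linear_data c\<^sub>1 d q C" and maps: "\<phi> ` half_plane (1/2) \<subseteq> half_plane (1/2)"
    and eq: "\<And>s. s \<in> half_plane (1/2) \<Longrightarrow> \<phi> s = c\<^sub>1 + (\<Sum>k=1..d. C k * of_nat (q k) powr (-s))"
    by (rule linear_symbol_data[OF assms(1)]) (rule that)
  interpret linear_data c\<^sub>1 d q C by (fact data)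
  have matrix: "represents_composition symbol_matrix \<phi>"
    by (rule represents_symbol[OF maps]) (simp add: eq symbol_def)
  have small: "\<not> (2 \<le> d \<or> 0 < gap)"
    using compact_composition_operator[OF schur_symbol_matrix matrix row_weight_tendsto_0] noncompact by blast
  have "d \<noteq> 0"
  proof
    assume "d = 0"
    then have "0 < gap"
      unfolding gap_def using degenerate_condition by simp
    with small show False by simp
  qed
  with small have d: "d = 1" by linarith
  have "gap = 0"
    using small gap_nonneg by linarith
  then have Re: "Re c\<^sub>1 = 1/2 + cmod (C 1)"
    unfolding gap_def unfolding d by simp
  have c: "c\<^sub>1 = 1/2 + of_real (cmod (C 1)) + \<i> * of_real (Im c\<^sub>1)"
    by (simp add: complex_eq_iff Re)
  have symbol: "symbol s = 1/2 + of_real (cmod (C 1)) + \<i> * of_real (Im c\<^sub>1) + C 1 * of_nat (q 1) powr (-s)" for s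
    unfolding symbol_def unfolding d by (subst c) simp
  have "monomial \<alpha> = q 1 ^ \<alpha> 1" for \<alpha>
    unfolding monomial_def unfolding d by simp
  then have support: "symbol_matrix m n = 0" if "m \<notin> range (\<lambda>a. q 1 ^ a)" for m n
    using that by (intro symbol_matrix_eq_0) auto
  have 1: "1 \<in> {1..d}" using d by simp
  show ?thesis
    using q_ge_2[OF 1] C_ne_0[OF 1] schur_symbol_matrix matrix support
      symbol_matrix_column[unfolded symbol] eq[folded symbol_def, unfolded symbol]
    by (intro exI[of _ "q 1"] exI[of _ "C 1"] exI[of _ "Im c\<^sub>1"] exI[of _ symbol_matrix] exI[of _ row_weight]) blast
qed

theorem theorem4p8:
  fixes N :: nat
    and \<phi> :: "nat \<Rightarrow> complex \<Rightarrow> complex"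
    and \<mu> :: "nat \<Rightarrow> complex"
  assumes "N \<ge> 1"
    and "\<And>j. j \<in> {1..N} \<Longrightarrow> linear_symbol 0 (\<phi> j)"
    and "inj_on (\<lambda>j. restrict (\<phi> j) (half_plane (1/2))) {1..N}"
    and "\<And>j. j \<in> {1..N} \<Longrightarrow> \<mu> j \<noteq> 0"
  shows "compact_operator (\<lambda>f. \<Sum>j=1..N. scaleC (\<mu> j) (composition_operator (\<phi> j) f))
     \<longleftrightarrow> (\<forall>j\<in>{1..N}. compact_operator (composition_operator (\<phi> j)))"
proof
  assume "\<forall>j\<in>{1..N}. compact_operator (composition_operator (\<phi> j))"
  then show "compact_operator (\<lambda>f. \<Sum>j=1..N. scaleC (\<mu> j) (composition_operator (\<phi> j) f))"
    by (intro compact_operator_sum compact_operator_scaleC) blast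
next
  assume compact: "compact_operator (\<lambda>f. \<Sum>j=1..N. scaleC (\<mu> j) (composition_operator (\<phi> j) f))"
  define J where "J = {j \<in> {1..N}. \<not> compact_operator (composition_operator (\<phi> j))}"
  have J: "finite J" "J \<subseteq> {1..N}"
    by (auto simp: J_def)
  have "compact_operator (\<lambda>f. (\<Sum>j=1..N. scaleC (\<mu> j) (composition_operator (\<phi> j) f))
      + (\<Sum>j\<in>{1..N} - J. scaleC (- \<mu> j) (composition_operator (\<phi> j) f)))"
    by (intro compact_operator_add compact compact_operator_sum compact_operator_scaleC) (simp add: J_def)
  moreover have "(\<Sum>j=1..N. scaleC (\<mu> j) (composition_operator (\<phi> j) f))
      + (\<Sum>j\<in>{1..N} - J. scaleC (- \<mu> j) (composition_operator (\<phi> j) f))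
      = (\<Sum>j\<in>J. scaleC (\<mu> j) (composition_operator (\<phi> j) f))" for f
    unfolding sum.subset_diff[OF J(2) finite_atLeastAtMost] by (simp add: sum_negf)
  ultimately have compact_J: "compact_operator (\<lambda>f. \<Sum>j\<in>J. scaleC (\<mu> j) (composition_operator (\<phi> j) f))"
    by simp
  have "\<forall>j\<in>J. \<exists>p K \<tau> E A. 2 \<le> p \<and> K \<noteq> 0 \<and> schur_matrix E A \<and> represents_composition E (\<phi> j) \<and>
       (\<forall>m n. m \<notin> range (\<lambda>a. p ^ a) \<longrightarrow> E m n = 0) \<and>
       (\<forall>s n. n \<noteq> 0 \<longrightarrow> (\<Sum>\<^sub>\<infinity>m. of_nat m powr (-s) * E m n)
          = of_nat n powr (- (1/2 + of_real (cmod K) + \<i> * of_real \<tau> + K * of_nat p powr (-s)))) \<and>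
       (\<forall>s\<in>half_plane (1/2). \<phi> j s = 1/2 + of_real (cmod K) + \<i> * of_real \<tau> + K * of_nat p powr (-s))"
  proof (rule ballI, rule noncompact_linear_symbol)
    fix j assume "j \<in> J"
    then show "linear_symbol 0 (\<phi> j)" "\<not> compact_operator (composition_operator (\<phi> j))"
      using assms(2) by (auto simp: J_def)
  qed
  then obtain p K \<tau> E A where data: "\<forall>j\<in>J. 2 \<le> p j \<and> K j \<noteq> 0 \<and> schur_matrix (E j) (A j) \<and> represents_composition (E j) (\<phi> j) \<and>
       (\<forall>m n. m \<notin> range (\<lambda>a. p j ^ a) \<longrightarrow> E j m n = 0) \<and>
       (\<forall>s n. n \<noteq> 0 \<longrightarrow> (\<Sum>\<^sub>\<infinity>m. of_nat m powr (-s) * E j m n)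
          = of_nat n powr (- (1/2 + of_real (cmod (K j)) + \<i> * of_real (\<tau> j) + K j * of_nat (p j) powr (-s)))) \<and>
       (\<forall>s\<in>half_plane (1/2). \<phi> j s = 1/2 + of_real (cmod (K j)) + \<i> * of_real (\<tau> j) + K j * of_nat (p j) powr (-s))"
    unfolding bchoice_iff by (elim exE) (rule that)
  have distinct: "i = j" if ij: "i \<in> J" "j \<in> J" "\<tau> i = \<tau> j" "p i = p j" "K i = K j" for i j
  proof -
    have "\<phi> i s = \<phi> j s" if "s \<in> half_plane (1/2)" for s
      using data ij that by simp
    then have "restrict (\<phi> i) (half_plane (1/2)) = restrict (\<phi> j) (half_plane (1/2))"
      by (auto simp: fun_eq_iff)
    then show ?thesis
      using inj_onD[OF assms(3)] ij J(2) by blast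
  qed
  have "\<mu> k = 0" if "k \<in> J" for k
    by (rule touching_combination[where J = J and E = E and A = A and \<phi> = \<phi> and p = p and K = K and \<tau> = \<tau> and \<mu> = \<mu>,
          OF J(1) _ _ _ _ _ _ _ compact_J that]) (use data distinct in blast)+
  then have "J = {}"
    using assms(4) J(2) by blast
  then show "\<forall>j\<in>{1..N}. compact_operator (composition_operator (\<phi> j))"
    by (auto simp: J_def)
qed

end
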